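(* Let $u_h\in V^h_{\mathrm{DG}}$ be the fine-scale solution, i.e. $a_{\mathrm{DG}}(u_h,v)=(f,v)$ for all $v\in V^h_{\mathrm{DG}}$, and for $m\ge 0$ let $u_H^{(m)}\in V_H^{(m)}$ be the solution at the $m$-th iteration of the online enrichment procedure, i.e. $a_{\mathrm{DG}}(u_H^{(m)},v)=(f,v)$ for all $v\in V_H^{(m)}$. Then for every $m\ge 0$ the following residual bound holds: $$\|u_h-u_H^{(m)}\|_A^2\le 2a_0^{-1}a_1C_0\sum_{i=1}^{N_c}\Big(1+\frac{1}{\lambda^{\omega_i}_{L_i+1}}\Big)\|\widetilde R_i^{(m)}\|^2 .$$ Moreover, if $V_H^{(m+1)}$ is obtained from $V_H^{(m)}$ by adding the online basis function $\phi\in V_0^h(\omega_i)$ of a coarse neighborhood $\omega_i$ (the solution of $a_{\omega_i}(\phi,v)=R_i^{(m)}(v)$ for all $v\in V_0^h(\omega_i)$), then $$\|u_h-u_H^{(m+1)}\|_A^2\le(1-\theta)\,\|u_h-u_H^{(m)}\|_A^2,$$ where $$\theta=\frac{\|R_i^{(m)}\|^2}{\eta^2},\qquad \eta^2=2a_0^{-1}a_1C_0\sum_{j=1}^{N_c}\Big(1+\frac{1}{\lambda^{\omega_j}_{L_j+1}}\Big)\|\widetilde R_j^{(m)}\|^2$$ (with $\eta>0$, so that $\theta$ is defined).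
   Context: **Domain, meshes, coefficient.** $D\subset\mathbb R^2$ is a rectangle, $f\in L^2(D)$, $(f,v)=\int_D fv$, and $\kappa$ is a bounded coefficient on $D$ with $\kappa\ge 1$. $\mathcal T^H$ is a triangulation of $D$ into rectangles (coarse blocks), $\mathcal E^H$ is the set of all its edges (coarse edges), and $\mathcal T^h$ is a conforming refinement of $\mathcal T^H$ with mesh size $h>0$. For $K\in\mathcal T^H$, $\kappa_K$ is the maximum of $\kappa$ over $K$; $V^h(K)$ is the space of continuous piecewise bilinear functions on $K$ with respect to the fine grid; $V^h_{\mathrm{DG}}=\{v\in L^2(D): v|_K\in V^h(K)\ \forall K\in\mathcal T^H\}$. **Averages and jumps.** Each $E\in\mathcal E^H$ has a fixed unit normal $n_E$. For an interior edge $E$ shared by $K^+,K^-$, with $n_E$ pointing from $K^+$ to $K^-$, and $G^\pm=G|_{K^\pm}$: $\{G\}=\frac12(G^++G^-)$, $[G]=G^+-G^-$, $\overline\kappa=\frac12(\kappa_{K^+}+\kappa_{K^-})$ on $E$. For $E\subset\partial D$, $E\subset\partial K$: $\{G\}=[G]=G$, $\overline\kappa=\kappa_K$, and $n_E$ points out of $D$. **Normal flux.** Let $W^h(K)$ be the space of continuous piecewise bi-quadratic functions on $K$ with respect to the fine grid and $W^h(\partial K)$ its restriction to $\partial K$. With $n_{\partial K}$ the outward unit normal, the normal flux $\kappa\nabla u\cdot n_{\partial K}$ is understood as the element of $W^h(\partial K)$ defined by $\int_{\partial K}(\kappa\nabla u\cdot n_{\partial K})v=\int_K\kappa\nabla u\cdot\nabla\widehat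 v$ for all $v\in W^h(\partial K)$, where $\widehat v\in W^h(K)$ is the (discrete, $\kappa$-weighted) harmonic extension of $v$, i.e. $\widehat v=v$ on $\partial K$ and $\int_K\kappa\nabla\widehat v\cdot\nabla w=0$ for all $w\in W^h(K)$ vanishing on $\partial K$. On an edge $E$ of $K$, $\kappa\nabla u\cdot n_E$ taken from $K$ is this flux, up to the sign $n_E=\pm n_{\partial K}$. **Forms and norms.** Let $a_H^K(u,v)=\int_K\kappa\nabla u\cdot\nabla v$, $a_H(u,v)=\sum_{K\in\mathcal T^H}a_H^K(u,v)$, and, with penalty parameter $\gamma>0$, $$a_{\mathrm{DG}}(u,v)=a_H(u,v)-\sum_{E\in\mathcal E^H}\int_E\big(\{\kappa\nabla u\cdot n_E\}[v]+\{\kappa\nabla v\cdot n_E\}[u]\big)+\sum_{E\in\mathcal E^H}\frac{\gamma}{h}\int_E\overline\kappa[u][v].$$ $C_{\mathrm{inv}}>0$ is the constant of the inverse inequality $a_H^K(\widehat v,\widehat v)\le\kappa_KC_{\mathrm{inv}}^2h^{-1}\int_{\partial K}|v|^2$ for all $K\in\mathcal T^H$, $v\in W^h(\partial K)$. It is assumed that $\gamma>C_{\mathrm{inv}}^2$, and $a_0=1-C_{\mathrm{inv}}\gamma^{-1/2}>0$, $a_1=1+C_{\mathrm{inv}}\gamma^{-1/2}$. The A-norm is $\|u\|_A^2=a_{\mathrm{DG}}(u,u)$. $C_0=\max_{K\in\mathcal T^H}n_K$, where $n_K$ is the number of vertices of $K$. **Coarse neighborhoods and partition of unity.** $x_1,\dots,x_{N_c}$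 are the nodes of $\mathcal T^H$, and $\omega_i$ is the union of all coarse blocks having $x_i$ as a vertex. On each $K\in\mathcal T^H$ with vertices $y_1,\dots,y_4$, $\chi^K_{(1)},\dots,\chi^K_{(4)}$ are partition of unity functions (nonnegative, $\sum_{j=1}^4\chi^K_{(j)}=1$ on $K$), $\chi^K_{(j)}$ having value $1$ at $y_j$ and $0$ at the other three vertices; e.g. the bilinear functions or standard multiscale basis functions. No continuity across coarse edges is required. If $y_j=x_i$, write $\chi_i^K=\chi^K_{(j)}$; it is considered to be supported in $K$ (zero outside $K$). $V^h(\omega_i)=\{v\in L^2(\omega_i): v|_K\in V^h(K)\ \forall K\in\mathcal T^H,\ K\subset\omega_i\}$; $V_0^h(\omega_i)\subset V^h(\omega_i)$ consists of the functions that are zero on $\partial\omega_i$ (extended by zero to $D$). $\mathcal E_i^H$ is the set of coarse edges lying in the interior of $\omega_i$. Below, sums over $K\subset\omega_i$ are over coarse blocks $K\in\mathcal T^H$. **Spectral problem and initial space.** Define $$a_{\omega_i}(u,v)=\sum_{K\subset\omega_i}a_H^K(u,v)+\sum_{E\in\mathcal E_i^H}\frac\gamma h\int_E\overline\kappa[u][v],\qquad \|v\|_{\omega_i}^2=a_{\omega_i}(v,v),$$ $$s_{\omega_i}(u,v)=\sum_{K\subset\omega_i}\int_K\kappa|\nabla\chi_i^K|^2uv+\sum_{E\in\mathcal E_i^H}\frac\gamma h\int_E\overline\kappa[\chi_i^K]^2\{u\}\{v\},$$ where, in the edge terms, $[\chi_i^K]$ is the jump of the piecewise function equal to $\chi_i^K$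 on each $K\subset\omega_i$. Let $\lambda_1^{\omega_i}\le\lambda_2^{\omega_i}\le\cdots$ and $\psi_1^{\omega_i},\psi_2^{\omega_i},\dots\in V^h(\omega_i)$ be the eigenvalues and eigenfunctions of $a_{\omega_i}(\psi,v)=\lambda s_{\omega_i}(\psi,v)$ for all $v\in V^h(\omega_i)$ (infinite eigenvalues allowed if $s_{\omega_i}$ is degenerate, with $1/\infty=0$). For each $i$ the first $L_i\ge1$ eigenfunctions are chosen, and the initial space is $$V_H^{(0)}=\mathrm{span}\{\chi_i^K\psi_k^{\omega_i}:\ 1\le i\le N_c,\ 1\le k\le L_i,\ K\subset\omega_i\}.$$ It is assumed that $V_H^{(0)}\subset V^h_{\mathrm{DG}}$, so that the Galerkin orthogonality $a_{\mathrm{DG}}(u_h-u_H^{(m)},v)=0$ holds for all $v\in V_H^{(m)}$ (and $V_H^{(m)}\subset V^h_{\mathrm{DG}}$ for all $m$). **Online enrichment.** Given $V_H^{(m)}$ and $u_H^{(m)}$, define the local residual $R_i^{(m)}(v)=(f,v)-a_{\mathrm{DG}}(u_H^{(m)},v)$ for $v\in V_0^h(\omega_i)$, with norm $\|R_i^{(m)}\|=\sup_{v\in V_0^h(\omega_i)}|R_i^{(m)}(v)|/\|v\|_{\omega_i}$, and the modified local residual $\widetilde R_i^{(m)}(v)=\sum_{K\subset\omega_i}\big((f,\chi_i^Kv)-a_{\mathrm{DG}}(u_H^{(m)},\chi_i^Kv)\big)$ for $v\in V^h(\omega_i)$, with norm $\|\widetilde R_i^{(m)}\|=\sup_{v\in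 V^h(\omega_i)}|\widetilde R_i^{(m)}(v)|/\|\sum_{K\subset\omega_i}\chi_i^Kv\|_{\omega_i}$ (suprema over $v$ with nonzero denominator). At each iteration a neighborhood $\omega_i$ is selected, the online basis function $\phi\in V_0^h(\omega_i)$ is computed from $a_{\omega_i}(\phi,v)=R_i^{(m)}(v)$ for all $v\in V_0^h(\omega_i)$, and $V_H^{(m+1)}=V_H^{(m)}+\mathrm{span}\{\phi\}$. *)

theory Defs
  imports "HOL-Analysis.Analysis" "HOL-Library.Function_Algebras"
begin

type_synonym pt = "real^2"

text \<open>
  An element of a broken (discontinuous) space is the family of its restrictions to the closed
  coarse blocks, each restriction being extended by zero outside its block. In this way both
  one-sided traces on a coarse edge are available.
\<close>
type_synonym dgfun = "pt set \<Rightarrow> pt \<Rightarrow> real"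

definition dgscale :: "real \<Rightarrow> dgfun \<Rightarrow> dgfun"
  where "dgscale c v = (\<lambda>K x. c * v K x)"

interpretation dgv: vector_space dgscale
  by unfold_locales (auto simp: dgscale_def fun_eq_iff algebra_simps)

record dg_data =
  region :: "pt set"
  coarse_mesh :: "pt set set"
  fine_mesh :: "pt set set"
  kappa :: "pt \<Rightarrow> real"
  edge_normal :: "pt set \<Rightarrow> pt"
  penalty :: real
  pou :: "pt set \<Rightarrow> pt \<Rightarrow> pt \<Rightarrow> real"
    \<comment> \<open>\<open>pou P K y\<close> is the partition of unity function on the block \<open>K\<close> attached to its vertex \<open>y\<close>\<close>

definition rectangle :: "pt set \<Rightarrow> bool"
  where "rectangle K \<longleftrightarrow> (\<exists>a b. K = cbox a b \<and> box a b \<noteq> {})"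

text \<open>Conforming, as in the library notion \<open>triangulation\<close> (which is for simplices only).\<close>
definition rect_mesh :: "pt set \<Rightarrow> pt set set \<Rightarrow> bool"
  where "rect_mesh D T \<longleftrightarrow>
    finite T \<and> (\<forall>K\<in>T. rectangle K) \<and> \<Union>T = D \<and>
    (\<forall>K\<in>T. \<forall>K'\<in>T. (K \<inter> K') face_of K \<and> (K \<inter> K') face_of K')"

definition mesh_refines :: "pt set set \<Rightarrow> pt set set \<Rightarrow> bool"
  where "mesh_refines T' T \<longleftrightarrow> (\<forall>\<tau>\<in>T'. \<exists>K\<in>T. \<tau> \<subseteq> K)"

definition mesh_size :: "dg_data \<Rightarrow> real"
  where "mesh_size P = Max (diameter ` fine_mesh P)"

definition vertices :: "pt set \<Rightarrow> pt set"
  where "vertices K = {y. y extreme_point_of K}"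

definition nodes :: "dg_data \<Rightarrow> pt set"
  where "nodes P = (\<Union>K\<in>coarse_mesh P. vertices K)"

definition edges :: "dg_data \<Rightarrow> pt set set"
  where "edges P = {E. \<exists>K\<in>coarse_mesh P. E edge_of K}"

definition max_vertices :: "dg_data \<Rightarrow> nat"
  where "max_vertices P = Max ((\<lambda>K. card (vertices K)) ` coarse_mesh P)"

text \<open>
  For a unit normal \<open>\<nu>\<close> of an edge \<open>E\<close> of the rectangle \<open>K\<close>, this says that \<open>\<nu>\<close> is the
  outward one.
\<close>
definition points_out :: "pt set \<Rightarrow> pt set \<Rightarrow> pt \<Rightarrow> bool"
  where "points_out K E \<nu> \<longleftrightarrow> (\<forall>x\<in>K. \<forall>y\<in>E. (x - y) \<bullet> \<nu> \<le> 0)"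

definition edge_normals :: "dg_data \<Rightarrow> bool"
  where "edge_normals P \<longleftrightarrow> (\<forall>E\<in>edges P.
    norm (edge_normal P E) = 1 \<and> (\<forall>x\<in>E. \<forall>y\<in>E. (x - y) \<bullet> edge_normal P E = 0) \<and>
    (E \<subseteq> frontier (region P) \<longrightarrow> points_out (region P) E (edge_normal P E)))"

text \<open>
  The blocks \<open>K\<^sup>+\<close> and \<open>K\<^sup>-\<close> of an interior edge, the normal pointing from \<open>K\<^sup>+\<close> to \<open>K\<^sup>-\<close>.
  On a boundary edge \<open>plus_block\<close> is the only adjacent block.
\<close>
definition plus_block :: "dg_data \<Rightarrow> pt set \<Rightarrow> pt set"
  where "plus_block P E =
    (THE K. K \<in> coarse_mesh P \<and> E edge_of K \<and> points_out K E (edge_normal P E))"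

definition minus_block :: "dg_data \<Rightarrow> pt set \<Rightarrow> pt set"
  where "minus_block P E =
    (THE K. K \<in> coarse_mesh P \<and> E edge_of K \<and> \<not> points_out K E (edge_normal P E))"

definition avg :: "dg_data \<Rightarrow> pt set \<Rightarrow> dgfun \<Rightarrow> pt \<Rightarrow> real"
  where "avg P E G x =
    (if E \<subseteq> frontier (region P) then G (plus_block P E) x
     else (G (plus_block P E) x + G (minus_block P E) x) / 2)"

definition jump :: "dg_data \<Rightarrow> pt set \<Rightarrow> dgfun \<Rightarrow> pt \<Rightarrow> real"
  where "jump P E G x =
    (if E \<subseteq> frontier (region P) then G (plus_block P E) x
     else G (plus_block P E) x - G (minus_block P E) x)"

definition coeff_max :: "dg_data \<Rightarrow> pt set \<Rightarrow> real"
  where "coeff_max P K = Sup (kappa P ` K)"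

definition coeff_avg :: "dg_data \<Rightarrow> pt set \<Rightarrow> real"
  where "coeff_avg P E =
    (if E \<subseteq> frontier (region P) then coeff_max P (plus_block P E)
     else (coeff_max P (plus_block P E) + coeff_max P (minus_block P E)) / 2)"

text \<open>Arc length integral over the axis-parallel segment \<open>E\<close>, whose endpoints are its least
  and greatest corner as a degenerate box.\<close>
definition edge_integral :: "pt set \<Rightarrow> (pt \<Rightarrow> real) \<Rightarrow> real"
  where "edge_integral E g =
    (let a = interval_lowerbound E; b = interval_upperbound E
     in norm (b - a) * (LINT t|lebesgue_on {0..1}. g (a + t *\<^sub>R (b - a))))"

definition bd_integral :: "pt set \<Rightarrow> (pt \<Rightarrow> real) \<Rightarrow> real"
  where "bd_integral K g = (\<Sum>E | E edge_of K. edge_integral E g)"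

text \<open>Only used under integrals, for functions differentiable almost everywhere.\<close>
definition grad :: "(pt \<Rightarrow> real) \<Rightarrow> pt \<Rightarrow> pt"
  where "grad u x = (THE g. GDERIV u x :> g)"

definition Qspace :: "nat \<Rightarrow> dg_data \<Rightarrow> pt set \<Rightarrow> (pt \<Rightarrow> real) set"
  where "Qspace r P K = {v. continuous_on K v \<and> (\<forall>x. x \<notin> K \<longrightarrow> v x = 0) \<and>
    (\<forall>\<tau>\<in>fine_mesh P. \<tau> \<subseteq> K \<longrightarrow>
      (\<exists>c. \<forall>x\<in>\<tau>. v x = (\<Sum>i\<le>r. \<Sum>j\<le>r. c i j * (x$1) ^ i * (x$2) ^ j)))}"

definition Vh :: "dg_data \<Rightarrow> pt set \<Rightarrow> (pt \<Rightarrow> real) set"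
  where "Vh P K = Qspace 1 P K"

definition Wh :: "dg_data \<Rightarrow> pt set \<Rightarrow> (pt \<Rightarrow> real) set"
  where "Wh P K = Qspace 2 P K"

definition Wh_bd :: "dg_data \<Rightarrow> pt set \<Rightarrow> (pt \<Rightarrow> real) set"
  where "Wh_bd P K = (\<lambda>w x. if x \<in> frontier K then w x else 0) ` Wh P K"

definition VDG :: "dg_data \<Rightarrow> dgfun set"
  where "VDG P = {v. (\<forall>K\<in>coarse_mesh P. v K \<in> Vh P K) \<and> (\<forall>K. K \<notin> coarse_mesh P \<longrightarrow> v K = 0)}"

definition aH_block :: "dg_data \<Rightarrow> pt set \<Rightarrow> (pt \<Rightarrow> real) \<Rightarrow> (pt \<Rightarrow> real) \<Rightarrow> real"
  where "aH_block P K u v = (LINT x|lebesgue_on K. kappa P x * (grad u x \<bullet> grad v x))"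

definition harmonic_ext :: "dg_data \<Rightarrow> pt set \<Rightarrow> (pt \<Rightarrow> real) \<Rightarrow> pt \<Rightarrow> real"
  where "harmonic_ext P K v = (THE w. w \<in> Wh P K \<and> (\<forall>x\<in>frontier K. w x = v x) \<and>
    (\<forall>z\<in>Wh P K. (\<forall>x\<in>frontier K. z x = 0) \<longrightarrow> aH_block P K w z = 0))"

text \<open>The normal flux \<open>\<kappa>\<nabla>u \<cdot> n\<close> of \<open>u\<close> on the boundary of \<open>K\<close>, for the outward normal.\<close>
definition flux :: "dg_data \<Rightarrow> pt set \<Rightarrow> (pt \<Rightarrow> real) \<Rightarrow> pt \<Rightarrow> real"
  where "flux P K u = (THE g. g \<in> Wh_bd P K \<and>
    (\<forall>v\<in>Wh_bd P K. bd_integral K (\<lambda>x. g x * v x) = aH_block P K u (harmonic_ext P K v)))"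

text \<open>The flux on \<open>E\<close> with respect to the fixed normal of \<open>E\<close>, taken from each adjacent block.\<close>
definition edge_flux :: "dg_data \<Rightarrow> pt set \<Rightarrow> dgfun \<Rightarrow> dgfun"
  where "edge_flux P E u K x =
    (if points_out K E (edge_normal P E) then flux P K (u K) x else - flux P K (u K) x)"

definition aH :: "dg_data \<Rightarrow> dgfun \<Rightarrow> dgfun \<Rightarrow> real"
  where "aH P u v = (\<Sum>K\<in>coarse_mesh P. aH_block P K (u K) (v K))"

definition aDG :: "dg_data \<Rightarrow> dgfun \<Rightarrow> dgfun \<Rightarrow> real"
  where "aDG P u v = aH P u v
    - (\<Sum>E\<in>edges P. edge_integral E (\<lambda>x.
        avg P E (edge_flux P E u) x * jump P E v x + avg P E (edge_flux P E v) x * jump P E u x))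
    + (\<Sum>E\<in>edges P. penalty P / mesh_size P *
        edge_integral E (\<lambda>x. coeff_avg P E * jump P E u x * jump P E v x))"

definition normA :: "dg_data \<Rightarrow> dgfun \<Rightarrow> real"
  where "normA P u = sqrt (aDG P u u)"

text \<open>The \<open>L\<^sup>2\<close> product on the region, split over the blocks.\<close>
definition L2_prod :: "dg_data \<Rightarrow> (pt \<Rightarrow> real) \<Rightarrow> dgfun \<Rightarrow> real"
  where "L2_prod P f v = (\<Sum>K\<in>coarse_mesh P. LINT x|lebesgue_on K. f x * v K x)"

definition inverse_inequality :: "dg_data \<Rightarrow> real \<Rightarrow> bool"
  where "inverse_inequality P C \<longleftrightarrow> (\<forall>K\<in>coarse_mesh P. \<forall>v\<in>Wh_bd P K.
    aH_block P K (harmonic_ext P K v) (harmonic_ext P K v)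
      \<le> coeff_max P K * C\<^sup>2 / mesh_size P * bd_integral K (\<lambda>x. \<bar>v x\<bar>\<^sup>2))"

text \<open>Neighborhoods are indexed by the coarse nodes themselves.\<close>
definition omega :: "dg_data \<Rightarrow> pt \<Rightarrow> pt set"
  where "omega P z = \<Union>{K \<in> coarse_mesh P. z \<in> vertices K}"

definition omega_blocks :: "dg_data \<Rightarrow> pt \<Rightarrow> pt set set"
  where "omega_blocks P z = {K \<in> coarse_mesh P. K \<subseteq> omega P z}"

text \<open>An edge in the interior of a neighborhood may have endpoints on its boundary.\<close>
definition omega_edges :: "dg_data \<Rightarrow> pt \<Rightarrow> pt set set"
  where "omega_edges P z = {E \<in> edges P. rel_interior E \<subseteq> interior (omega P z)}"

definition Vomega :: "dg_data \<Rightarrow> pt \<Rightarrow> dgfun set"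
  where "Vomega P z = {v \<in> VDG P. \<forall>K. K \<notin> omega_blocks P z \<longrightarrow> v K = 0}"

definition Vomega0 :: "dg_data \<Rightarrow> pt \<Rightarrow> dgfun set"
  where "Vomega0 P z =
    {v \<in> Vomega P z. \<forall>K\<in>omega_blocks P z. \<forall>x\<in>K \<inter> frontier (omega P z). v K x = 0}"

text \<open>
  Lipschitz continuity is the regularity under which the gradients of the partition of unity
  functions and of their products with finite element functions are square integrable; it holds
  for every continuous piecewise bilinear function. The almost everywhere differentiability of
  a Lipschitz function is Rademacher's theorem and hence no further restriction; it is listed
  because that theorem is not available in the library.
\<close>
definition partition_of_unity :: "dg_data \<Rightarrow> bool"
  where "partition_of_unity P \<longleftrightarrow> (\<forall>K\<in>coarse_mesh P.
    (\<forall>y\<in>vertices K.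
      (\<exists>C. C-lipschitz_on K (pou P K y)) \<and>
      (AE x in lebesgue_on K. pou P K y differentiable (at x)) \<and>
      (\<forall>x\<in>K. 0 \<le> pou P K y x) \<and>
      pou P K y y = 1 \<and> (\<forall>y'\<in>vertices K - {y}. pou P K y y' = 0)) \<and>
    (\<forall>x\<in>K. (\<Sum>y\<in>vertices K. pou P K y x) = 1))"

text \<open>\<open>\<chi>\<^sub>i\<^sup>K v\<close>, supported in \<open>K\<close>, where \<open>z\<close> is the \<open>i\<close>-th node.\<close>
definition chi_mult :: "dg_data \<Rightarrow> pt \<Rightarrow> pt set \<Rightarrow> dgfun \<Rightarrow> dgfun"
  where "chi_mult P z K v = (\<lambda>K' x. if K' = K then pou P K z x * v K x else 0)"

definition aomega :: "dg_data \<Rightarrow> pt \<Rightarrow> dgfun \<Rightarrow> dgfun \<Rightarrow> real"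
  where "aomega P z u v = (\<Sum>K\<in>omega_blocks P z. aH_block P K (u K) (v K))
    + (\<Sum>E\<in>omega_edges P z. penalty P / mesh_size P *
        edge_integral E (\<lambda>x. coeff_avg P E * jump P E u x * jump P E v x))"

definition norm_omega :: "dg_data \<Rightarrow> pt \<Rightarrow> dgfun \<Rightarrow> real"
  where "norm_omega P z v = sqrt (aomega P z v v)"

definition somega :: "dg_data \<Rightarrow> pt \<Rightarrow> dgfun \<Rightarrow> dgfun \<Rightarrow> real"
  where "somega P z u v =
    (\<Sum>K\<in>omega_blocks P z.
        LINT x|lebesgue_on K. kappa P x * (norm (grad (pou P K z) x))\<^sup>2 * u K x * v K x)
    + (\<Sum>E\<in>omega_edges P z. penalty P / mesh_size P *
        edge_integral E (\<lambda>x. coeff_avg P E * (jump P E (\<lambda>K. pou P K z) x)\<^sup>2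
          * avg P E u x * avg P E v x))"

text \<open>An infinite eigenvalue belongs to the eigenfunctions in the kernel of \<open>somega\<close>.\<close>
definition eigenpair :: "dg_data \<Rightarrow> pt \<Rightarrow> ereal \<Rightarrow> dgfun \<Rightarrow> bool"
  where "eigenpair P z l \<psi> \<longleftrightarrow> \<psi> \<in> Vomega P z \<and> \<psi> \<noteq> 0 \<and>
    ((\<exists>r. l = ereal r \<and> (\<forall>v\<in>Vomega P z. aomega P z \<psi> v = r * somega P z \<psi> v)) \<or>
     (l = \<infinity> \<and> (\<forall>v\<in>Vomega P z. somega P z \<psi> v = 0)))"

text \<open>The eigenvalues are counted with multiplicity, so the eigenfunctions form a basis; they
  are numbered from 1 to the dimension of the local space.\<close>
definition eigensystem :: "dg_data \<Rightarrow> pt \<Rightarrow> (nat \<Rightarrow> ereal) \<Rightarrow> (nat \<Rightarrow> dgfun) \<Rightarrow> bool"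
  where "eigensystem P z lam \<psi> \<longleftrightarrow>
    (let I = {1..dgv.dim (Vomega P z)} in
      (\<forall>k\<in>I. eigenpair P z (lam k) (\<psi> k)) \<and> mono_on I lam \<and>
      inj_on \<psi> I \<and> dgv.independent (\<psi> ` I) \<and> dgv.span (\<psi> ` I) = Vomega P z)"

definition initial_space :: "dg_data \<Rightarrow> (pt \<Rightarrow> nat) \<Rightarrow> (pt \<Rightarrow> nat \<Rightarrow> dgfun) \<Rightarrow> dgfun set"
  where "initial_space P L \<psi> = dgv.span
    {chi_mult P z K (\<psi> z k) | z k K. z \<in> nodes P \<and> 1 \<le> k \<and> k \<le> L z \<and> K \<in> omega_blocks P z}"

definition residual :: "dg_data \<Rightarrow> (pt \<Rightarrow> real) \<Rightarrow> dgfun \<Rightarrow> dgfun \<Rightarrow> real"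
  where "residual P f u v = L2_prod P f v - aDG P u v"

definition mod_residual :: "dg_data \<Rightarrow> (pt \<Rightarrow> real) \<Rightarrow> dgfun \<Rightarrow> pt \<Rightarrow> dgfun \<Rightarrow> real"
  where "mod_residual P f u z v = (\<Sum>K\<in>omega_blocks P z.
    L2_prod P f (chi_mult P z K v) - aDG P u (chi_mult P z K v))"

text \<open>The inserted 0 only matters when no function has nonzero norm, e.g. if the local space
  \<open>Vomega0\<close> is trivial.\<close>
definition residual_norm :: "dg_data \<Rightarrow> (pt \<Rightarrow> real) \<Rightarrow> dgfun \<Rightarrow> pt \<Rightarrow> real"
  where "residual_norm P f u z = Sup (insert 0
    {\<bar>residual P f u v\<bar> / norm_omega P z v | v. v \<in> Vomega0 P z \<and> norm_omega P z v \<noteq> 0})"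

definition mod_residual_norm :: "dg_data \<Rightarrow> (pt \<Rightarrow> real) \<Rightarrow> dgfun \<Rightarrow> pt \<Rightarrow> real"
  where "mod_residual_norm P f u z = Sup (insert 0
    {\<bar>mod_residual P f u z v\<bar> / norm_omega P z (\<Sum>K\<in>omega_blocks P z. chi_mult P z K v) | v.
      v \<in> Vomega P z \<and> norm_omega P z (\<Sum>K\<in>omega_blocks P z. chi_mult P z K v) \<noteq> 0})"

end

theory Submission
  imports Defs
begin

text \<open>
  Fix an iterate \<open>u\<close> of the enrichment procedure, let \<open>e = uh - u\<close> be its error and let
  \<open>R v = (f, v) - aDG u v\<close> be its residual, so that \<open>R v = aDG e v\<close> on the finite element space.

  The residual bound. As the partition of unity functions of a block sum to 1, \<open>aDG e e = R e\<close> is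
  the sum over the coarse nodes \<open>z\<close> of the modified local residuals of \<open>e\<close>. The products of the
  partition of unity functions with the first \<open>L z\<close> eigenfunctions belong to every Galerkin space, so
  that \<open>e\<close> may be replaced near \<open>z\<close> by \<open>e - p\<close> for any \<open>p\<close> in the span of these eigenfunctions. The
  choice of \<open>p\<close> is the projection that is orthogonal for the form \<open>aomega + somega\<close>: the remainder is
  then orthogonal to the chosen eigenfunctions for both forms, its energy is at most that of \<open>e\<close>, and
  its \<open>somega\<close> part is at most its energy divided by the next eigenvalue (\<open>spectral_projection\<close>). By
  the product rules for gradients and for jumps, a factor from the partition of unity costs at most
  \<open>2 (aomega + somega)\<close> (\<open>cutoff_bound\<close>). The Cauchy--Schwarz inequality for the sum over the nodes,
  the finite overlap of the neighborhoods (\<open>overlap\<close>) and the coercivity of \<open>aDG\<close> with constant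
  \<open>a0\<close> (\<open>aDG_bounds\<close>) give the bound, even with 1 in place of \<open>a1\<close> (\<open>residual_estimate\<close>).

  The decrease. Galerkin solutions are best approximations in the A-norm, so the next error is at
  most that of \<open>u\<close> corrected by \<open>1/a1\<close> times the online function. This step gains \<open>1/a1\<close> times the
  squared norm of the local residual (\<open>online_decrease\<close>), and the factor \<open>a1\<close> that the residual bound
  has to spare makes this gain at least \<open>\<theta>\<close> times the squared error.

  Four points need care. The functions multiplied by the partition of unity are no finite element
  functions, so all forms, including the fluxes, are studied on the larger space of functions that
  are Lipschitz on every fine cell and differentiable almost everywhere. Fluxes and harmonic
  extensions are obtained from a Riesz representation for semidefinite forms on finitely generated
  spaces (\<open>riesz\<close>). The same lemma shows that the supremum in the modified residual norm is taken over a
  bounded set, provided that a product of zero energy is zero; this holds because a Lipschitz function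
  with almost everywhere vanishing gradient is constant (\<open>zero_gradient_imp_constant\<close>) and each
  partition of unity function vanishes at another vertex (\<open>cutoff_null\<close>). Finally, \<open>real_of_ereal (1 / 0) = 0\<close>,
  so an eigenvalue 0 would enter the bound as if it were infinite. The next eigenvalue is positive,
  since the functions of zero energy on a neighborhood are constant: the blocks around a node are connected through edges
  (\<open>omega_connected\<close>, \<open>higher_eigenvalue_pos\<close>).
\<close>

section \<open>Positive semidefinite forms and Riesz representation\<close>
text \<open>
  Forms with a kernel must be allowed: the local energy vanishes on constants, and the degenerate
  mass form may vanish on much more. The form is only constrained on the subspace \<open>V\<close>, because
  integrals of gradients are additive only where the integrands are integrable.
\<close>
locale psd_form = vector_space scale
  for scale :: "real \<Rightarrow> 'v::ab_group_add \<Rightarrow> 'v" +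
  fixes V :: "'v set" and b :: "'v \<Rightarrow> 'v \<Rightarrow> real"
  assumes subspace_V: "subspace V"
    and add_left: "\<lbrakk>u \<in> V; v \<in> V; w \<in> V\<rbrakk> \<Longrightarrow> b (u + v) w = b u w + b v w"
    and scale_left: "\<lbrakk>u \<in> V; v \<in> V\<rbrakk> \<Longrightarrow> b (scale c u) v = c * b u v"
    and sym: "\<lbrakk>u \<in> V; v \<in> V\<rbrakk> \<Longrightarrow> b u v = b v u"
    and nonneg: "u \<in> V \<Longrightarrow> 0 \<le> b u u"
begin

lemmas V_closed = subspace_add[OF subspace_V] subspace_diff[OF subspace_V]
  subspace_scale[OF subspace_V] subspace_0[OF subspace_V] subspace_sum[OF subspace_V]

lemma add_right: "\<lbrakk>u \<in> V; v \<in> V; w \<in> V\<rbrakk> \<Longrightarrow> b u (v + w) = b u v + b u w"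
  by (metis V_closed(1) add_left sym)

lemma scale_right: "\<lbrakk>u \<in> V; v \<in> V\<rbrakk> \<Longrightarrow> b u (scale c v) = c * b u v"
  by (metis V_closed(3) scale_left sym)

lemma zero_left: "v \<in> V \<Longrightarrow> b 0 v = 0"
  using scale_left[of 0 v 0] V_closed(4) by simp

lemma zero_right: "v \<in> V \<Longrightarrow> b v 0 = 0"
  using zero_left sym V_closed(4) by metis

lemma diff_left: "\<lbrakk>u \<in> V; v \<in> V; w \<in> V\<rbrakk> \<Longrightarrow> b (u - v) w = b u w - b v w"
  using add_left[of "u - v" v w] V_closed(2) by simp

lemma sum_left: "\<lbrakk>\<And>i. i \<in> I \<Longrightarrow> u i \<in> V; w \<in> V\<rbrakk> \<Longrightarrow> b (sum u I) w = (\<Sum>i\<in>I. b (u i) w)"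
  by (induction I rule: infinite_finite_induct) (auto simp: zero_left add_left V_closed)

lemma sum_right: "\<lbrakk>\<And>i. i \<in> I \<Longrightarrow> u i \<in> V; w \<in> V\<rbrakk> \<Longrightarrow> b w (sum u I) = (\<Sum>i\<in>I. b w (u i))"
  by (induction I rule: infinite_finite_induct) (auto simp: zero_right add_right V_closed)

lemma expand_square:
  assumes "u \<in> V" "v \<in> V"
  shows "b (u + scale t v) (u + scale t v) = b u u + 2 * t * b u v + t\<^sup>2 * b v v"
  using assms sym[OF assms]
  by (simp add: add_left add_right scale_left scale_right V_closed algebra_simps power2_eq_square)

lemma cauchy_schwarz:
  assumes "u \<in> V" "v \<in> V"
  shows "(b u v)\<^sup>2 \<le> b u u * b v v"
proof (cases "b v v = 0")
  case True
  have "b u v = 0"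
  proof (rule ccontr)
    assume ne: "b u v \<noteq> 0"
    \<comment> \<open>At this \<open>t\<close> the value \<open>b u u + 2 t b u v\<close> of the form at \<open>u + t v\<close> is -1.\<close>
    define t where "t = - (b u u + 1) / (2 * b u v)"
    have "0 \<le> b (u + scale t v) (u + scale t v)"
      using assms by (intro nonneg V_closed)
    then show False
      using True ne nonneg[OF assms(1)] by (simp add: expand_square assms t_def field_simps)
  qed
  then show ?thesis
    by (simp add: True)
next
  case False
  then have pos: "b v v > 0"
    using nonneg[of v] assms by simp
  define t where "t = - b u v / b v v"
  have "0 \<le> b (u + scale t v) (u + scale t v)"
    using assms by (intro nonneg V_closed)
  also have "\<dots> = b u u - (b u v)\<^sup>2 / b v v"
    using pos by (simp only: expand_square[OF assms] t_def) (simp add: power2_eq_square field_simps)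
  finally show ?thesis
    using pos by (simp add: field_simps)
qed

lemma null_orthogonal: "\<lbrakk>u \<in> V; v \<in> V; b u u = 0\<rbrakk> \<Longrightarrow> b u v = 0"
  using cauchy_schwarz[of u v] by simp

lemma orthogonal_to_span:
  assumes "w \<in> V" "B \<subseteq> V" "\<And>v. v \<in> B \<Longrightarrow> b w v = 0" "v \<in> span B"
  shows "b w v = 0"
proof -
  have "subspace {v \<in> V. b w v = 0}"
    using assms(1) by (auto simp: subspace_def zero_right add_right scale_right V_closed)
  then have "span B \<subseteq> {v \<in> V. b w v = 0}"
    using assms(2,3) by (intro span_minimal) auto
  then show ?thesis
    using assms(4) by auto
qed

text \<open>
  On a finitely generated space a linear functional that vanishes on the kernel of the form is
  represented by the form. The induction adds one generator at a time, made orthogonal to the earlier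
  ones by its representation over them; if the orthogonalized generator is null, then the functional
  vanishes on it and the representative need not change.
\<close>
lemma riesz:
  assumes "finite B" "B \<subseteq> V"
    and "\<And>u v. \<lbrakk>u \<in> span B; v \<in> span B\<rbrakk> \<Longrightarrow> l (u + v) = l u + l v"
    and "\<And>c v. v \<in> span B \<Longrightarrow> l (scale c v) = c * l v"
    and "\<And>v. \<lbrakk>v \<in> span B; b v v = 0\<rbrakk> \<Longrightarrow> l v = (0::real)"
  shows "\<exists>g\<in>span B. \<forall>v\<in>span B. b g v = l v"
  using assms
proof (induction B arbitrary: l rule: finite_induct)
  case empty
  have "l 0 = 0"
    using empty.prems(3)[of 0 0] by (simp add: span_zero)
  then show ?case
    using zero_left[of 0] V_closed(4) by auto
next
  case (insert x B)
  have BV: "B \<subseteq> V" and x: "x \<in> V"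
    using insert.prems by auto
  have spV: "span (insert x B) \<subseteq> V" "span B \<subseteq> V"
    using insert.prems(1) BV subspace_V by (intro span_minimal; auto)+
  have mono: "span B \<subseteq> span (insert x B)"
    by (intro span_mono) auto
  obtain p where p: "p \<in> span B" "\<forall>v\<in>span B. b p v = b x v"
  proof -
    have "\<exists>p\<in>span B. \<forall>v\<in>span B. b p v = b x v"
    proof (intro insert.IH BV)
      show "b x v = 0" if "v \<in> span B" "b v v = 0" for v
        using that spV x null_orthogonal[of v x] sym[of x v] by auto
    qed (use spV x in \<open>auto simp: add_right scale_right subset_iff\<close>)
    then show ?thesis using that by blast
  qed
  obtain g where g: "g \<in> span B" "\<forall>v\<in>span B. b g v = l v"
  proof -
    have "\<exists>g\<in>span B. \<forall>v\<in>span B. b g v = l v"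
      using insert.prems(2-4) mono by (intro insert.IH BV) (simp_all add: subset_iff)
    then show ?thesis using that by blast
  qed
  define y where "y = x - p"
  have y: "y \<in> span (insert x B)"
    unfolding y_def using p(1) mono by (intro span_diff[OF span_base]) blast+
  have yV: "y \<in> V" and pV: "p \<in> V" and gV: "g \<in> V"
    using y p(1) g(1) spV by auto
  have y_orth: "b y v = 0" if "v \<in> span B" for v
    using that p spV x pV by (simp add: y_def diff_left subset_iff)
  \<comment> \<open>If \<open>b y y = 0\<close> then also \<open>l y = 0\<close>, and \<open>\<beta> = 0\<close> is the right coefficient.\<close>
  define \<beta> where "\<beta> = l y / b y y"
  define h where "h = g + scale \<beta> y"
  have h: "h \<in> span (insert x B)"
    unfolding h_def using g(1) mono span_add[OF _ span_scale[OF y]] by blast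
  have ly: "\<beta> * b y y = l y"
    using insert.prems(4)[OF y] by (auto simp: \<beta>_def)
  have "b h v = l v" if v: "v \<in> span (insert x B)" for v
  proof -
    obtain c where c: "v - scale c x \<in> span B"
      using v span_breakdown_eq by blast
    define w where "w = v - scale c x + scale c p"
    have w: "w \<in> span B"
      unfolding w_def using c p(1) by (intro span_add span_scale)
    have vw: "v = w + scale c y"
      by (simp add: w_def y_def scale_right_diff_distrib)
    have wV: "w \<in> V" and wI: "w \<in> span (insert x B)"
      using w spV mono by auto
    have "b h v = b g w + c * b g y + \<beta> * (b y w + c * b y y)"
      unfolding h_def vw using gV yV wV
      by (simp add: add_left add_right scale_left scale_right V_closed algebra_simps)
    also have "\<dots> = l w + c * l y"
      using g(2) w y_orth[OF w] y_orth[OF g(1)] sym[OF gV yV] ly by (simp add: algebra_simps)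
    also have "\<dots> = l v"
      unfolding vw using insert.prems(2)[OF wI span_scale[OF y, of c]] insert.prems(3)[OF y] by simp
    finally show ?thesis .
  qed
  then show ?case
    using h by blast
qed

lemma projection:
  assumes "finite B" "B \<subseteq> V" "x \<in> V"
  shows "\<exists>p\<in>span B. \<forall>v\<in>span B. b (x - p) v = 0"
proof -
  have sp: "span B \<subseteq> V"
    using assms subspace_V by (auto intro: span_minimal[THEN subsetD])
  have "\<exists>p\<in>span B. \<forall>v\<in>span B. b p v = b x v"
  proof (intro riesz assms)
    show "b x v = 0" if "v \<in> span B" "b v v = 0" for v
      using that sp assms(3) null_orthogonal[of v x] sym[of x v] by auto
  qed (use sp assms(3) in \<open>auto simp: add_right scale_right subset_iff\<close>)
  then obtain p where p: "p \<in> span B" "\<forall>v\<in>span B. b p v = b x v" by blast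
  have "b (x - p) v = 0" if "v \<in> span B" for v
    using p that sp assms(3) by (simp add: diff_left subset_iff)
  with p(1) show ?thesis by blast
qed

lemma sum_orthogonal:
  assumes "finite I" "\<And>i. i \<in> I \<Longrightarrow> u i \<in> V"
    and "\<And>i j. \<lbrakk>i \<in> I; j \<in> I; i \<noteq> j\<rbrakk> \<Longrightarrow> b (u i) (u j) = 0"
  shows "b (sum u I) (sum u I) = (\<Sum>i\<in>I. b (u i) (u i))"
proof -
  have "b (sum u I) (sum u I) = (\<Sum>i\<in>I. \<Sum>j\<in>I. b (u i) (u j))"
    using assms(2) by (subst sum_left) (auto simp: V_closed sum_right intro!: sum.cong)
  also have "\<dots> = (\<Sum>i\<in>I. \<Sum>j\<in>I. if i = j then b (u i) (u i) else 0)"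
    using assms(3) by (intro sum.cong) auto
  also have "\<dots> = (\<Sum>i\<in>I. b (u i) (u i))"
    using assms(1) by simp
  finally show ?thesis .
qed

end

section \<open>Spectral projection for a pencil of forms\<close>
text \<open>
  The generalized eigenvalue problem \<open>a w v = \<mu> s w v\<close>. Regularity of the pencil is needed because a
  common null vector of both forms would be an eigenvector for every number, in particular for negative
  ones.
\<close>
locale psd_pencil = A: psd_form scale V a + S: psd_form scale V s
  for scale :: "real \<Rightarrow> 'v::ab_group_add \<Rightarrow> 'v" and V a s +
  assumes regular: "\<lbrakk>v \<in> V; a v v = 0; s v v = 0\<rbrakk> \<Longrightarrow> v = 0"
begin

definition eigenspace :: "ereal \<Rightarrow> 'v set" where
  "eigenspace \<mu> = {w \<in> V. (\<exists>r. \<mu> = ereal r \<and> (\<forall>v\<in>V. a w v = r * s w v)) \<or>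
    (\<mu> = \<infinity> \<and> (\<forall>v\<in>V. s w v = 0))}"

lemma subspace_eigenspace:
  assumes "eigenspace \<mu> \<noteq> {}"
  shows "A.subspace (eigenspace \<mu>)"
  using assms unfolding eigenspace_def A.subspace_def
  by (auto simp: A.add_left S.add_left A.scale_left S.scale_left A.V_closed A.zero_left S.zero_left
      algebra_simps)

text \<open>
  Symmetry gives \<open>\<mu> s w w' = a w w' = \<nu> s w w'\<close>, and \<open>s w w' = 0\<close> outright if one of the
  eigenvalues is infinite.
\<close>
lemma eigenspace_orthogonal:
  assumes "w \<in> eigenspace \<mu>" "w' \<in> eigenspace \<nu>" "\<mu> \<noteq> \<nu>"
  shows "a w w' = 0" "s w w' = 0"
proof -
  have V: "w \<in> V" "w' \<in> V"
    using assms by (auto simp: eigenspace_def)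
  then have "a w w' = a w' w" "s w w' = s w' w"
    using A.sym S.sym by auto
  then have "a w w' = 0 \<and> s w w' = 0"
    using assms V unfolding eigenspace_def by auto
  then show "a w w' = 0" "s w w' = 0" by auto
qed

lemma eigenvalue_nonneg:
  assumes "w \<in> eigenspace \<mu>" "w \<noteq> 0"
  shows "0 \<le> \<mu>"
proof -
  have V: "w \<in> V"
    using assms by (simp add: eigenspace_def)
  show ?thesis
  proof (cases \<mu>)
    case (real r)
    then have rw: "a w w = r * s w w"
      using assms V by (auto simp: eigenspace_def)
    then have "s w w > 0"
      using regular[OF V] S.nonneg[OF V] assms(2) by (cases "s w w = 0") auto
    with rw A.nonneg[OF V] have "0 \<le> r"
      by (simp add: zero_le_mult_iff)
    with real show ?thesis by simp
  qed (use assms in \<open>auto simp: eigenspace_def\<close>)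
qed

lemma eigenspace_zero_null: "w \<in> eigenspace 0 \<Longrightarrow> a w w = 0"
  by (auto simp: eigenspace_def)

lemma psd_form_sum: "psd_form scale V (\<lambda>u v. a u v + s u v)"
  by unfold_locales
    (auto simp: A.subspace_V A.add_left S.add_left A.scale_left S.scale_left A.sym S.sym
      A.nonneg S.nonneg algebra_simps)

text \<open>
  The given eigenvectors need not be orthogonal within an eigenspace, and \<open>L\<close> may cut through a
  multiple eigenvalue. Deleting the first \<open>L\<close> terms of the expansion of \<open>e\<close> could therefore increase
  the energy, and the projection orthogonal for \<open>a + s\<close> is used instead. The remainder \<open>w\<close> is
  orthogonal for both forms to the first \<open>L\<close> eigenvectors, hence has no component with an eigenvalue
  below \<open>lam (L + 1)\<close>, and its components for the distinct larger eigenvalues are mutually orthogonal.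
\<close>
lemma spectral_projection:
  fixes N L :: nat
  assumes eig: "\<And>k. k \<in> {1..N} \<Longrightarrow> \<psi> k \<in> eigenspace (lam k)"
    and nz: "\<And>k. k \<in> {1..N} \<Longrightarrow> \<psi> k \<noteq> 0"
    and mono: "mono_on {1..N} lam"
    and span: "A.span (\<psi> ` {1..N}) = V"
    and L: "L + 1 \<le> N" and pos: "0 < lam (L + 1)"
    and e: "e \<in> V"
  shows "\<exists>p \<in> A.span (\<psi> ` {1..L}). a (e - p) (e - p) \<le> a e e \<and>
    s (e - p) (e - p) \<le> real_of_ereal (1 / lam (L + 1)) * a (e - p) (e - p)"
proof -
  interpret B: psd_form scale V "\<lambda>u v. a u v + s u v"
    by (rule psd_form_sum)
  have \<psi>V: "\<psi> k \<in> V" if "k \<in> {1..N}" for k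
    using eig[OF that] by (simp add: eigenspace_def)
  have nonneg: "0 \<le> lam k" if "k \<in> {1..N}" for k
    using eigenvalue_nonneg eig nz that by blast
  have sub: "\<psi> ` {1..L} \<subseteq> V"
    using \<psi>V L by auto
  obtain p where p: "p \<in> A.span (\<psi> ` {1..L})"
    and orth: "\<forall>v\<in>A.span (\<psi> ` {1..L}). a (e - p) v + s (e - p) v = 0"
    using B.projection[OF _ sub e] by auto
  define w where "w = e - p"
  have pV: "p \<in> V"
    using p sub A.subspace_V A.span_minimal by blast
  have wV: "w \<in> V"
    unfolding w_def using e pV by (rule A.V_closed)
  have sum0: "a w (\<psi> k) + s w (\<psi> k) = 0" if "k \<in> {1..L}" for k
    using orth that unfolding w_def by (meson A.span_base imageI)
  \<comment> \<open>Orthogonality for \<open>a + s\<close> reads \<open>(r + 1) s w (\<psi> k) = 0\<close> for a finite eigenvalue \<open>r \<ge> 0\<close>, and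
    \<open>a w (\<psi> k) = 0\<close> for an infinite one.\<close>
  have both0: "a w (\<psi> k) = 0 \<and> s w (\<psi> k) = 0" if k: "k \<in> {1..L}" for k
  proof -
    have kN: "k \<in> {1..N}" using k L by auto
    have c: "a w (\<psi> k) = a (\<psi> k) w" "s w (\<psi> k) = s (\<psi> k) w"
      using A.sym S.sym wV \<psi>V[OF kN] by auto
    consider r where "lam k = ereal r" "a (\<psi> k) w = r * s (\<psi> k) w"
      | "s (\<psi> k) w = 0"
      using eig[OF kN] wV by (auto simp: eigenspace_def)
    then show ?thesis
    proof cases
      case 1
      then have "(r + 1) * s (\<psi> k) w = 0" "r \<ge> 0"
        using sum0[OF k] nonneg[OF kN] c by (auto simp: algebra_simps)
      then show ?thesis using 1 c by auto
    next
      case 2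
      then show ?thesis using sum0[OF k] c by auto
    qed
  qed
  have a_wp: "a w p = 0"
    by (rule A.orthogonal_to_span[OF wV sub _ p]) (use both0 in blast)
  have "a e e = a (w + p) (w + p)"
    by (simp add: w_def)
  also have "\<dots> = a w w + a p p"
    using wV pV a_wp A.sym[OF wV pV] by (simp add: A.add_left A.add_right A.V_closed)
  finally have energy: "a w w \<le> a e e"
    using A.nonneg[OF pV] by simp
  define c where "c = real_of_ereal (1 / lam (L + 1))"
  \<comment> \<open>The components of \<open>w\<close> with a smaller eigenvalue only involve indices up to \<open>L\<close>; their sum \<open>w1\<close>
    is orthogonal to \<open>w\<close> and to the rest of \<open>w\<close>, hence to itself.\<close>
  define lo where "lo = {k \<in> {1..N}. lam k < lam (L + 1)}"
  define hi where "hi = {k \<in> {1..N}. \<not> lam k < lam (L + 1)}"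
  obtain u where u: "w = (\<Sum>k\<in>{1..N}. u k)" and uE: "\<And>k. k \<in> {1..N} \<Longrightarrow> u k \<in> eigenspace (lam k)"
    and uspan: "\<And>k. k \<in> {1..N} \<Longrightarrow> u k \<in> A.span {\<psi> k}"
  proof -
    have "\<exists>u. w = (\<Sum>k\<in>{1..N}. u k) \<and> (\<forall>k\<in>{1..N}. u k \<in> A.span {\<psi> k})"
    proof -
      have "w \<in> A.span (\<psi> ` {1..N})" using wV span by simp
      then show ?thesis
      proof (induction rule: A.span_induct_alt)
        case base
        then show ?case by (intro exI[of _ "\<lambda>_. 0"]) (auto simp: A.span_zero)
      next
        case (step d x y)
        then obtain u k where u: "y = (\<Sum>k\<in>{1..N}. u k)" "\<forall>k\<in>{1..N}. u k \<in> A.span {\<psi> k}"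
          and k: "k \<in> {1..N}" "x = \<psi> k" by auto
        have "scale d x + y = (\<Sum>i\<in>{1..N}. (if i = k then scale d x else 0) + u i)"
          unfolding u sum.distrib using k by simp
        moreover have "(if i = k then scale d x else 0) + u i \<in> A.span {\<psi> i}" if "i \<in> {1..N}" for i
        proof (intro A.span_add)
          show "(if i = k then scale d x else 0) \<in> A.span {\<psi> i}"
            using k A.span_scale[OF A.span_base, of "\<psi> k" "{\<psi> k}" d] by (simp add: A.span_zero)
          show "u i \<in> A.span {\<psi> i}"
            using u that by blast
        qed
        ultimately show ?case by blast
      qed
    qed
    then obtain u where u: "w = (\<Sum>k\<in>{1..N}. u k)" "\<forall>k\<in>{1..N}. u k \<in> A.span {\<psi> k}" by blast
    have "u k \<in> eigenspace (lam k)" if "k \<in> {1..N}" for k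
    proof -
      have "A.span {\<psi> k} \<subseteq> eigenspace (lam k)"
        using eig[OF that] by (intro A.span_minimal subspace_eigenspace) auto
      then show ?thesis using u that by auto
    qed
    then show ?thesis using that u by blast
  qed
  have uV: "u k \<in> V" if "k \<in> {1..N}" for k
    using uE[OF that] unfolding eigenspace_def by blast
  define w1 where "w1 = sum u lo"
  define w2 where "w2 = sum u hi"
  have w12: "w = w1 + w2"
  proof -
    have "{1..N} = lo \<union> hi" "lo \<inter> hi = {}" "finite lo" "finite hi"
      by (auto simp: lo_def hi_def)
    then show ?thesis unfolding u w1_def w2_def by (simp add: sum.union_disjoint)
  qed
  have w1V: "w1 \<in> V" and w2V: "w2 \<in> V"
    unfolding w1_def w2_def by (auto intro!: A.V_closed(5) uV simp: lo_def hi_def)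
  have cross: "a (u i) (u j) = 0 \<and> s (u i) (u j) = 0"
    if "i \<in> {1..N}" "j \<in> {1..N}" "lam i \<noteq> lam j" for i j
    using eigenspace_orthogonal uE that by blast
  have "a w1 w2 = (\<Sum>i\<in>lo. \<Sum>j\<in>hi. a (u i) (u j))"
    unfolding w1_def using uV w2V
    by (subst A.sum_left) (auto simp: w2_def lo_def hi_def intro!: sum.cong A.sum_right)
  also have "\<dots> = 0"
    using cross by (intro sum.neutral ballI) (auto simp: lo_def hi_def)
  finally have a12: "a w1 w2 = 0" .
  have "s w1 w2 = (\<Sum>i\<in>lo. \<Sum>j\<in>hi. s (u i) (u j))"
    unfolding w1_def using uV w2V
    by (subst S.sum_left) (auto simp: w2_def lo_def hi_def intro!: sum.cong S.sum_right)
  also have "\<dots> = 0"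
    using cross by (intro sum.neutral ballI) (auto simp: lo_def hi_def)
  finally have s12: "s w1 w2 = 0" .
  have low: "k \<in> {1..L}" if "k \<in> lo" for k
  proof (rule ccontr)
    assume "k \<notin> {1..L}"
    then have "lam (L + 1) \<le> lam k"
      using that L by (intro mono_onD[OF mono]) (auto simp: lo_def)
    then show False using that by (auto simp: lo_def)
  qed
  have "w1 \<in> A.span (\<psi> ` {1..L})"
    unfolding w1_def
  proof (rule A.span_sum)
    fix k assume k: "k \<in> lo"
    then have "A.span {\<psi> k} \<subseteq> A.span (\<psi> ` {1..L})"
      using low by (intro A.span_mono) auto
    then show "u k \<in> A.span (\<psi> ` {1..L})"
      using uspan k by (auto simp: lo_def)
  qed
  then have "a w w1 = 0" "s w w1 = 0"
    by (rule A.orthogonal_to_span[OF wV sub, rotated] S.orthogonal_to_span[OF wV sub, rotated],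
        use both0 in blast)+
  moreover have "a w w1 = a w1 w1" "s w w1 = s w1 w1"
    unfolding w12 using w1V w2V a12 s12 A.sym[OF w1V w2V] S.sym[OF w1V w2V]
    by (simp_all add: A.add_left S.add_left)
  ultimately have "w1 = 0"
    using regular w1V by simp
  then have ww2: "w = w2"
    using w12 by simp
  \<comment> \<open>The components of equal eigenvalue are collected, so that different ones are orthogonal.\<close>
  define M where "M = lam ` hi"
  define v where "v \<mu> = sum u {k \<in> hi. lam k = \<mu>}" for \<mu>
  have vV: "v \<mu> \<in> V" for \<mu>
    unfolding v_def by (auto intro!: A.V_closed(5) uV simp: hi_def)
  have vE: "v \<mu> \<in> eigenspace \<mu>" if \<mu>: "\<mu> \<in> M" for \<mu>
  proof -
    obtain k where "k \<in> {1..N}" "lam k = \<mu>"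
      using \<mu> unfolding M_def hi_def by blast
    then have "A.subspace (eigenspace \<mu>)"
      using uE by (intro subspace_eigenspace) auto
    then show ?thesis
      unfolding v_def using uE by (intro A.subspace_sum) (auto simp: hi_def)
  qed
  have finM: "finite M"
    by (simp add: M_def hi_def)
  have w2M: "w2 = (\<Sum>\<mu>\<in>M. v \<mu>)"
    unfolding w2_def v_def M_def by (rule sum.image_gen) (simp add: hi_def)
  have bound: "s (v \<mu>) (v \<mu>) \<le> c * a (v \<mu>) (v \<mu>)" if \<mu>: "\<mu> \<in> M" for \<mu>
  proof -
    have ge: "lam (L + 1) \<le> \<mu>"
      using \<mu> by (auto simp: M_def hi_def)
    have c0: "c \<ge> 0"
      unfolding c_def using pos by (cases "lam (L + 1)") (auto simp: one_ereal_def divide_ereal_def)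
    consider r where "\<mu> = ereal r" "a (v \<mu>) (v \<mu>) = r * s (v \<mu>) (v \<mu>)"
      | "s (v \<mu>) (v \<mu>) = 0"
      using vE[OF \<mu>] vV[of \<mu>] by (auto simp: eigenspace_def)
    then show ?thesis
    proof cases
      case 1
      then obtain l where l: "lam (L + 1) = ereal l"
        using ge pos by (cases "lam (L + 1)") auto
      have lr: "0 < l" "l \<le> r"
        using l pos ge 1 by auto
      have cl: "c = 1 / l"
        using l lr by (simp add: c_def one_ereal_def)
      have "c * r \<ge> 1"
        unfolding cl using lr by simp
      then have "s (v \<mu>) (v \<mu>) * 1 \<le> s (v \<mu>) (v \<mu>) * (c * r)"
        using S.nonneg[OF vV] by (rule mult_left_mono)
      then show ?thesis
        using 1 by (simp add: algebra_simps)
    next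
      case 2
      then show ?thesis using c0 A.nonneg[OF vV] by simp
    qed
  qed
  have orthv: "a (v \<mu>) (v \<nu>) = 0" "s (v \<mu>) (v \<nu>) = 0"
    if "\<mu> \<in> M" "\<nu> \<in> M" "\<mu> \<noteq> \<nu>" for \<mu> \<nu>
    using eigenspace_orthogonal[OF vE[OF that(1)] vE[OF that(2)] that(3)] by auto
  have "s w w = (\<Sum>\<mu>\<in>M. s (v \<mu>) (v \<mu>))"
    unfolding ww2 w2M by (intro S.sum_orthogonal finM vV orthv)
  also have "\<dots> \<le> (\<Sum>\<mu>\<in>M. c * a (v \<mu>) (v \<mu>))"
    using bound by (rule sum_mono)
  also have "\<dots> = c * a w w"
    unfolding ww2 w2M sum_distrib_left[symmetric]
    by (intro arg_cong[where f = "(*) c"] A.sum_orthogonal[symmetric] finM vV orthv)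
  finally show ?thesis
    using p energy unfolding w_def c_def by blast
qed

end

section \<open>Gradients of Lipschitz functions in the plane\<close>
lemma AE_lebesgue_on_iff:
  fixes K :: "pt set"
  assumes "K \<in> sets lebesgue"
  shows "(AE x in lebesgue_on K. Q x) \<longleftrightarrow> negligible {x \<in> K. \<not> Q x}"
proof -
  have "(AE x in lebesgue_on K. Q x) \<longleftrightarrow> (AE x in lebesgue. x \<in> K \<longrightarrow> Q x)"
    using assms by (intro AE_restrict_space_iff) auto
  also have "\<dots> \<longleftrightarrow> negligible {x \<in> K. \<not> Q x}"
    by (auto simp: eventually_ae_filter_negligible elim: negligible_subset)
  finally show ?thesis .
qed

lemma gderiv_unique:
  assumes "GDERIV u x :> g" "GDERIV u x :> g'"
  shows "g = g'"
proof -
  have "(\<lambda>h. h \<bullet> g) = (\<lambda>h. h \<bullet> g')"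
    using assms unfolding gderiv_def by (rule has_derivative_unique)
  then show ?thesis
    by (metis vector_eq_ldot)
qed

lemma grad_eqI: "GDERIV u x :> g \<Longrightarrow> grad u x = g"
  unfolding grad_def using gderiv_unique by blast

lemma gderiv_grad:
  fixes u :: "pt \<Rightarrow> real"
  assumes "u differentiable (at x)"
  shows "GDERIV u x :> grad u x"
proof -
  obtain f' where f': "(u has_derivative f') (at x)"
    using assms by (auto simp: differentiable_def)
  then have "linear f'"
    by (rule has_derivative_linear)
  then have "f' = (\<lambda>h. h \<bullet> adjoint f' 1)"
    by (simp add: adjoint_works)
  then have "GDERIV u x :> adjoint f' 1"
    using f' unfolding gderiv_def by metis
  then show ?thesis
    using grad_eqI by metis
qed

lemma has_derivative_vec:
  fixes f :: "'a::real_normed_vector \<Rightarrow> real^'n"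
  assumes "\<And>m. ((\<lambda>x. f x $ m) has_derivative (\<lambda>h. f' h $ m)) (at x within S)"
  shows "(f has_derivative f') (at x within S)"
proof -
  have "((\<lambda>x. f x \<bullet> i) has_derivative (\<lambda>h. f' h \<bullet> i)) (at x within S)" if "i \<in> Basis" for i
  proof -
    obtain m where "i = axis m 1"
      using \<open>i \<in> Basis\<close> by (auto simp: Basis_vec_def)
    then show ?thesis
      using assms[of m] by (simp add: inner_axis)
  qed
  then show ?thesis
    by (subst has_derivative_componentwise_within) blast
qed

lemma two_indices: "\<exists>j. j \<noteq> i \<and> (\<forall>k. k = i \<or> k = j)"
  for i :: 2
proof (cases "i = 1")
  case True
  then show ?thesis
    using exhaust_2 by (intro exI[of _ 2]) auto
next
  case False
  then show ?thesis
    using exhaust_2 by (intro exI[of _ 1]) auto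
qed

text \<open>
  Replace the \<open>i\<close>-th coordinate of \<open>x\<close> by \<open>u x\<close>. This map \<open>F\<close> is Lipschitz, so it maps the exceptional
  null set to a null set, and where the gradient of \<open>u\<close> vanishes its derivative is singular, so that by
  Sard's theorem the whole image is a null set. If \<open>u\<close> increased from \<open>x\<close> to \<open>y\<close> along the \<open>i\<close>-th
  direction, then by continuity it would do so along all nearby parallel lines, and by the intermediate
  value theorem the image would contain an open box.
\<close>
lemma coordinate_line_le:
  fixes u :: "pt \<Rightarrow> real"
  assumes ne: "box a b \<noteq> {}" and lip: "C-lipschitz_on (cbox a b) u"
    and ae: "AE x in lebesgue_on (cbox a b). GDERIV u x :> 0"
    and ij: "j \<noteq> i" "\<And>k. k = i \<or> k = j"
    and x: "x \<in> cbox a b" and y: "y \<in> cbox a b" and xy: "x $ j = y $ j"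
  shows "u y \<le> u x"
proof (rule ccontr)
  assume "\<not> u y \<le> u x"
  define q where "q s t = (\<chi> k. if k = i then s else t)" for s t :: real
  define F where "F = (\<lambda>x. q (u x) (x $ j))"
  define S where "S = {x \<in> cbox a b. GDERIV u x :> 0}"
  have q[simp]: "q s t $ i = s" "q s t $ j = t" for s t
    using ij(1) by (auto simp: q_def)
  have q_eq: "q (p $ i) (p $ j) = p" for p
    unfolding vec_eq_iff using ij(2) q by metis
  have q_diff: "norm (q s t - q s' t') \<le> \<bar>s - s'\<bar> + \<bar>t - t'\<bar>" for s t s' t'
  proof -
    have "norm (q s t - q s' t') \<le> (\<Sum>k\<in>UNIV. \<bar>(q s t - q s' t') $ k\<bar>)"
      by (rule norm_le_l1_cart)
    also have "\<dots> = (\<Sum>k\<in>{i, j}. \<bar>(q s t - q s' t') $ k\<bar>)"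
      using ij(2) by (intro sum.cong) auto
    also have "\<dots> = \<bar>s - s'\<bar> + \<bar>t - t'\<bar>"
      using ij(1) by simp
    finally show ?thesis .
  qed
  have q_cbox: "q s t \<in> cbox a b \<longleftrightarrow> a $ i \<le> s \<and> s \<le> b $ i \<and> a $ j \<le> t \<and> t \<le> b $ j" for s t
    unfolding mem_box_cart using ij(2) q by metis
  have C: "C \<ge> 0"
    using lip by (rule lipschitz_on_nonneg)
  have lipu: "\<bar>u p - u p'\<bar> \<le> C * norm (p - p')" if "p \<in> cbox a b" "p' \<in> cbox a b" for p p'
    using lipschitz_onD[OF lip that] by (simp add: dist_norm)
  have "negligible (F ` S)"
  proof (rule baby_Sard)
    fix p assume p: "p \<in> S"
    define f' where "f' = (\<lambda>h::pt. q 0 (h $ j))"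
    have u': "(u has_derivative (\<lambda>h. 0)) (at p within S)"
      using p unfolding S_def gderiv_def by (auto intro: has_derivative_at_withinI)
    show "(F has_derivative f') (at p within S)"
    proof (rule has_derivative_vec)
      fix m
      have "bounded_linear (\<lambda>h::pt. h $ j)"
        by (rule bounded_linear_vec_nth)
      then have "((\<lambda>x::pt. x $ j) has_derivative (\<lambda>h. h $ j)) (at p within S)"
        by (rule bounded_linear_imp_has_derivative)
      then show "((\<lambda>x. F x $ m) has_derivative (\<lambda>h. f' h $ m)) (at p within S)"
        using u' ij(2)[of m] ij(1) by (auto simp: F_def f'_def)
    qed
    have "row i (matrix f') = 0"
      by (simp add: row_def matrix_def f'_def vec_eq_iff)
    then have "det (matrix f') = 0"
      by (rule det_zero_row)
    then show "rank (matrix f') < CARD(2)"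
      by (simp add: det_eq_0_rank)
  qed simp
  moreover have "negligible (F ` (cbox a b - S))"
  proof (rule negligible_locally_Lipschitz_image)
    show "negligible (cbox a b - S)"
      using ae by (subst (asm) AE_lebesgue_on_iff) (auto simp: S_def set_diff_eq elim: negligible_subset)
    show "\<exists>T B. open T \<and> p \<in> T \<and> (\<forall>p'\<in>(cbox a b - S) \<inter> T. norm (F p' - F p) \<le> B * norm (p' - p))"
      if "p \<in> cbox a b - S" for p
    proof (intro exI[of _ UNIV] exI[of _ "C + 1"] conjI ballI)
      fix p' assume "p' \<in> (cbox a b - S) \<inter> UNIV"
      then have "norm (F p' - F p) \<le> C * norm (p' - p) + \<bar>p' $ j - p $ j\<bar>"
        using q_diff[of "u p'" "p' $ j" "u p" "p $ j"] lipu[of p' p] that by (auto simp: F_def)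
      also have "\<bar>p' $ j - p $ j\<bar> \<le> norm (p' - p)"
        using component_le_norm_cart[of "p' - p" j] by simp
      finally show "norm (F p' - F p) \<le> (C + 1) * norm (p' - p)"
        by (simp add: algebra_simps)
    qed auto
  qed simp
  ultimately have "negligible (F ` S \<union> F ` (cbox a b - S))"
    by (rule negligible_Un)
  then have negF: "negligible (F ` cbox a b)"
    by (rule negligible_subset) auto
  \<comment> \<open>On lines at distance at most \<open>\<delta>\<close> the end values change by at most \<open>d\<close>, so that all values strictly
    between \<open>u x + d\<close> and \<open>u y - d = u x + 2 d\<close> are taken.\<close>
  define d where "d = (u y - u x) / 3"
  have d: "d > 0"
    using \<open>\<not> u y \<le> u x\<close> by (simp add: d_def)
  define \<delta> where "\<delta> = d / (C + 1)"
  have \<delta>: "\<delta> > 0" "C * \<delta> \<le> d"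
    using d C by (auto simp: \<delta>_def field_simps)
  define l where "l = max (a $ j) (x $ j - \<delta>)"
  define r where "r = min (b $ j) (x $ j + \<delta>)"
  have xb: "a $ i \<le> x $ i" "x $ i \<le> b $ i" "a $ j \<le> x $ j" "x $ j \<le> b $ j"
    "a $ i \<le> y $ i" "y $ i \<le> b $ i"
    using x y by (auto simp: mem_box_cart)
  have "a $ j < b $ j"
    using ne by (simp add: interval_ne_empty_cart(2))
  then have lr: "l < r"
    using xb \<delta> by (auto simp: l_def r_def)
  have "box (q (u x + d) l) (q (u y - d) r) \<subseteq> F ` cbox a b"
  proof
    fix p assume p: "p \<in> box (q (u x + d) l) (q (u y - d) r)"
    define c t where "c = p $ i" and "t = p $ j"
    have c: "u x + d < c" "c < u y - d" and t: "l < t" "t < r"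
      using p q unfolding mem_box_cart c_def t_def by metis+
    have tx: "\<bar>t - x $ j\<bar> \<le> \<delta>" "a $ j \<le> t" "t \<le> b $ j"
      using t by (auto simp: l_def r_def)
    have near: "\<bar>u (q (p $ i) t) - u p\<bar> \<le> d" if "p \<in> cbox a b" "p $ j = x $ j" for p
    proof -
      have "\<bar>u (q (p $ i) t) - u p\<bar> \<le> C * norm (q (p $ i) t - q (p $ i) (p $ j))"
      proof -
        have "q (p $ i) t \<in> cbox a b"
          using that tx unfolding q_cbox by (simp add: mem_box_cart)
        then show ?thesis
          unfolding q_eq using that(1) by (rule lipu)
      qed
      also have "\<dots> \<le> C * \<delta>"
        using q_diff[of "p $ i" t "p $ i" "p $ j"] tx C that by (intro mult_left_mono) auto
      finally show ?thesis using \<delta> by simp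
    qed
    define G where "G = closed_segment (q (x $ i) t) (q (y $ i) t)"
    have ends: "q (x $ i) t \<in> cbox a b" "q (y $ i) t \<in> cbox a b"
      using xb tx by (auto simp: q_cbox)
    have G: "G \<subseteq> cbox a b"
      unfolding G_def using ends by (intro closed_segment_subset) auto
    have "continuous_on G u"
      using lipschitz_on_continuous_on[OF lip] G continuous_on_subset by blast
    then have "connected (u ` G)"
      unfolding G_def by (intro connected_continuous_image) auto
    then have "{u (q (x $ i) t)..u (q (y $ i) t)} \<subseteq> u ` G"
      by (rule connected_contains_Icc) (auto simp: G_def)
    moreover have "c \<in> {u (q (x $ i) t)..u (q (y $ i) t)}"
      using near[OF x] near[OF y] xy c by auto
    ultimately obtain g where g: "g \<in> G" "u g = c" by auto
    have "g $ j = t"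
    proof -
      obtain v where "g = (1 - v) *\<^sub>R q (x $ i) t + v *\<^sub>R q (y $ i) t"
        using g(1) unfolding G_def closed_segment_def by blast
      then have "g $ j = (1 - v) * t + v * t"
        by simp
      then show ?thesis
        by (simp add: algebra_simps)
    qed
    then have "F g = q c t"
      using g by (simp add: F_def)
    also have "\<dots> = p"
      unfolding c_def t_def by (rule q_eq)
    finally show "p \<in> F ` cbox a b"
      using g G by blast
  qed
  then have "negligible (box (q (u x + d) l) (q (u y - d) r))"
    using negF negligible_subset by blast
  moreover have "u x + d < u y - d"
    using d by (simp add: d_def field_simps)
  then have "box (q (u x + d) l) (q (u y - d) r) \<noteq> {}"
    unfolding interval_ne_empty_cart(2) using ij(2) q lr by metis
  ultimately show False
    by (simp add: negligible_interval)
qed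

lemma zero_gradient_imp_constant:
  fixes u :: "pt \<Rightarrow> real"
  assumes "box a b \<noteq> {}" "C-lipschitz_on (cbox a b) u"
    and "AE x in lebesgue_on (cbox a b). GDERIV u x :> 0"
    and x: "x \<in> cbox a b" and y: "y \<in> cbox a b"
  shows "u x = u y"
proof -
  define i :: 2 where "i = 1"
  obtain j :: 2 where j: "j \<noteq> i \<and> (\<forall>k. k = i \<or> k = j)"
    using two_indices by blast
  then have ij: "j \<noteq> i" "\<And>k. k = i \<or> k = j"
    by simp_all
  define z where "z = (\<chi> k. if k = i then x $ i else y $ j)"
  have z: "z $ i = x $ i" "z $ j = y $ j"
    using ij by (auto simp: z_def)
  have zc: "z \<in> cbox a b"
    unfolding mem_box_cart(2)
  proof
    show "a $ k \<le> z $ k \<and> z $ k \<le> b $ k" for k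
      using ij(2)[of k] x y z by (auto simp: mem_box_cart(2))
  qed
  note line = coordinate_line_le[OF assms(1-3)]
  have ji: "i \<noteq> j" "\<And>k. k = j \<or> k = i"
    using ij by auto
  have "u x \<le> u z" "u z \<le> u x"
    by (rule line[OF ji zc x z(1)], rule line[OF ji x zc z(1)[symmetric]])
  moreover have "u y \<le> u z" "u z \<le> u y"
    by (rule line[OF ij zc y z(2)], rule line[OF ij y zc z(2)[symmetric]])
  ultimately show ?thesis by simp
qed

lemma borel_measurable_lebesgue_on_AE:
  fixes f g :: "pt \<Rightarrow> real"
  assumes K: "K \<in> sets lebesgue" and f: "f \<in> borel_measurable (lebesgue_on K)"
    and ae: "AE x in lebesgue_on K. f x = g x"
  shows "g \<in> borel_measurable (lebesgue_on K)"
proof -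
  have "AE x in lebesgue. (if x \<in> K then f x else 0) = (if x \<in> K then g x else 0)"
    using ae unfolding AE_lebesgue_on_iff[OF K] eventually_ae_filter_negligible
    by (intro exI[of _ "{x \<in> K. f x \<noteq> g x}"]) auto
  then have "(\<lambda>x. if x \<in> K then g x else 0) \<in> borel_measurable lebesgue"
    using f by (intro borel_measurable_AE[OF borel_measurable_if_I[OF f K]])
  then show ?thesis
    by (rule borel_measurable_if_D)
qed

text \<open>
  Partial derivatives of a map between Cartesian spaces are measurable on a set on which the map is
  differentiable; so \<open>u\<close> is restricted to its points of differentiability and repeated in every
  component.
\<close>
lemma grad_measurable:
  fixes u :: "pt \<Rightarrow> real"
  assumes K: "K \<in> sets lebesgue" and ae: "AE x in lebesgue_on K. u differentiable (at x)"
  shows "(\<lambda>x. grad u x $ k) \<in> borel_measurable (lebesgue_on K)"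
proof -
  define S where "S = {x \<in> K. u differentiable (at x)}"
  have neg: "negligible {x \<in> K. \<not> u differentiable (at x)}"
    using ae by (simp add: AE_lebesgue_on_iff[OF K])
  have "S = K - {x \<in> K. \<not> u differentiable (at x)}"
    by (auto simp: S_def)
  then have S: "S \<in> sets lebesgue"
    using K neg by (simp add: negligible_imp_sets sets.Diff)
  define f :: "pt \<Rightarrow> pt" where "f = (\<lambda>x. \<chi> m. u x)"
  have "(f has_derivative (\<lambda>h. \<chi> m. h \<bullet> grad u x)) (at x within S)" if "x \<in> S" for x
  proof (rule has_derivative_vec)
    fix m
    have "(u has_derivative (\<lambda>h. h \<bullet> grad u x)) (at x within S)"
      using that gderiv_grad[of u x] unfolding S_def gderiv_def
      by (blast intro: has_derivative_at_withinI)
    then show "((\<lambda>x. f x $ m) has_derivative (\<lambda>h. (\<chi> m. h \<bullet> grad u x) $ m)) (at x within S)"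
      by (simp add: f_def)
  qed
  then have "(\<lambda>x. matrix (\<lambda>h. (\<chi> m. h \<bullet> grad u x)::pt) $ k $ k) \<in> borel_measurable (lebesgue_on S)"
    by (rule borel_measurable_partial_derivatives[OF S])
  then have "(\<lambda>x. grad u x $ k) \<in> borel_measurable (lebesgue_on S)"
    by (simp add: matrix_def inner_axis')
  then have "(\<lambda>x. if x \<in> S then grad u x $ k else 0) \<in> borel_measurable (lebesgue_on K)"
    using S K by (subst borel_measurable_if_lebesgue_on) (auto simp: S_def)
  then show ?thesis
    by (rule borel_measurable_lebesgue_on_AE[OF K])
      (use ae in \<open>auto simp: S_def AE_lebesgue_on_iff[OF K] elim: negligible_subset\<close>)
qed

section \<open>Edges of rectangles\<close>
lemma rectangle_props:
  assumes "rectangle K"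
  shows "compact K" "closed K" "convex K" "connected K" "K \<noteq> {}" "interior K \<noteq> {}"
    "closure (interior K) = K" "K \<in> sets lebesgue" "negligible (frontier K)" "polyhedron K"
    "aff_dim K = 2"
proof -
  obtain a b where K: "K = cbox a b" "box a b \<noteq> {}"
    using assms by (auto simp: rectangle_def)
  show "compact K" "closed K" "convex K" "connected K" "K \<in> sets lebesgue" "polyhedron K"
    unfolding K by (auto intro: convex_connected)
  show "interior K \<noteq> {}"
    using K by (simp add: interior_cbox)
  then show "K \<noteq> {}"
    using interior_subset by blast
  show "closure (interior K) = K"
    using K by (simp add: interior_cbox closure_box)
  show "negligible (frontier K)"
    unfolding K by (intro negligible_convex_frontier) auto
  have "aff_dim K = int (DIM(pt))"
    using \<open>interior K \<noteq> {}\<close> aff_dim_nonempty_interior by blast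
  then show "aff_dim K = 2" by simp
qed

lemma all_two_indices:
  assumes "\<forall>k. k = i \<or> k = (j::2)"
  shows "(\<forall>k. Q k) \<longleftrightarrow> Q i \<and> Q j"
proof (intro iffI conjI allI)
  fix k
  assume "Q i \<and> Q j"
  then show "Q k"
    using assms[rule_format, of k] by auto
qed auto

lemma inner_two_indices:
  fixes g x :: pt
  assumes "\<forall>k. k = i \<or> k = (j::2)" "j \<noteq> i"
  shows "g \<bullet> x = g $ i * x $ i + g $ j * x $ j"
proof -
  have "g \<bullet> x = (\<Sum>k\<in>{i, j}. g $ k * x $ k)"
    unfolding inner_vec_def using assms by (intro sum.cong) auto
  then show ?thesis using assms by simp
qed

text \<open>
  An edge is a facet, so it consists of the maximizers of a linear functional. If both coefficients
  of the functional are nonzero, then its maximizer is a single corner.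
\<close>
lemma edge_of_cbox_iff:
  fixes a b :: pt
  assumes ne: "box a b \<noteq> {}"
  shows "E edge_of cbox a b \<longleftrightarrow> (\<exists>i c. (c = a $ i \<or> c = b $ i) \<and> E = {x \<in> cbox a b. x $ i = c})"
proof
  assume E: "E edge_of cbox a b"
  have dim: "aff_dim (cbox a b) = 2"
    using ne by (intro rectangle_props) (auto simp: rectangle_def)
  then have "E facet_of cbox a b"
    using E by (auto simp: facet_of_def edge_of_def)
  then obtain g c where g: "g \<noteq> 0" "cbox a b \<subseteq> {x. g \<bullet> x \<le> c}" "E = cbox a b \<inter> {x. g \<bullet> x = c}"
    using facet_of_polyhedron[of "cbox a b" E] by auto
  \<comment> \<open>A maximizer has an extremal value in every coordinate with a nonzero coefficient.\<close>
  define m where "m k = (if g $ k > 0 then b $ k else a $ k)" for k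
  have extremal: "x $ k = m k" if x: "x \<in> E" and k: "g $ k \<noteq> 0" for x k
  proof -
    obtain j where j: "j \<noteq> k" "\<forall>l. l = k \<or> l = j"
      using two_indices by blast
    define x' where "x' = (\<chi> l. if l = k then m k else x $ l)"
    have xb: "x \<in> cbox a b" "g \<bullet> x = c"
      using x g(3) by auto
    have "x' \<in> cbox a b"
      unfolding mem_box_cart(2)
    proof
      show "a $ l \<le> x' $ l \<and> x' $ l \<le> b $ l" for l
        using xb(1) by (auto simp: x'_def m_def mem_box_cart(2) intro: order_trans)
    qed
    then have "g \<bullet> x' \<le> g \<bullet> x"
      using g(2) xb by auto
    moreover have "g \<bullet> x' - g \<bullet> x = g $ k * (m k - x $ k)"
      using j by (simp add: inner_two_indices[OF j(2,1)] x'_def algebra_simps)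
    ultimately have "g $ k * (m k - x $ k) \<le> 0" by simp
    moreover have "a $ k \<le> x $ k" "x $ k \<le> b $ k"
      using xb(1) by (auto simp: mem_box_cart(2))
    ultimately show ?thesis
      using k by (cases "g $ k > 0") (auto simp: m_def mult_le_0_iff)
  qed
  have "E \<noteq> {}"
    using E by (auto simp: edge_of_def)
  then obtain x0 where x0: "x0 \<in> E" by blast
  obtain i where i: "g $ i \<noteq> 0"
    using g(1) by (auto simp: vec_eq_iff)
  obtain j where j: "j \<noteq> i" "\<forall>l. l = i \<or> l = j"
    using two_indices by blast
  have gj: "g $ j = 0"
  proof (rule ccontr)
    assume gj: "g $ j \<noteq> 0"
    have "x = x0" if "x \<in> E" for x
      unfolding vec_eq_iff
    proof
      fix k
      have "g $ k \<noteq> 0"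
        using j(2) i gj by (cases "k = i") auto
      then show "x $ k = x0 $ k"
        using extremal that x0 by simp
    qed
    then have "E \<subseteq> {x0}" by blast
    then have "aff_dim E \<le> 0"
      using aff_dim_subset[of E "{x0}"] by simp
    then show False
      using E by (simp add: edge_of_def)
  qed
  have "c = g $ i * m i"
    using x0 g(3) extremal[OF x0 i] gj by (simp add: inner_two_indices[OF j(2,1)])
  then have "E = {x \<in> cbox a b. x $ i = m i}"
    using g(3) gj i by (auto simp: inner_two_indices[OF j(2,1)])
  moreover have "m i = a $ i \<or> m i = b $ i"
    by (simp add: m_def)
  ultimately show "\<exists>i c. (c = a $ i \<or> c = b $ i) \<and> E = {x \<in> cbox a b. x $ i = c}"
    by blast
next
  assume "\<exists>i c. (c = a $ i \<or> c = b $ i) \<and> E = {x \<in> cbox a b. x $ i = c}"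
  then obtain i c where c: "c = a $ i \<or> c = b $ i" and E: "E = {x \<in> cbox a b. x $ i = c}"
    by blast
  obtain j where j: "j \<noteq> i" "\<forall>l. l = i \<or> l = j"
    using two_indices by blast
  have lt: "a $ k < b $ k" for k
    using ne by (simp add: interval_ne_empty_cart(2))
  have face: "E face_of cbox a b"
  proof (cases "c = b $ i")
    case True
    have "cbox a b \<inter> {x. axis i 1 \<bullet> x = b $ i} face_of cbox a b"
      by (rule face_of_Int_supporting_hyperplane_le) (auto simp: inner_axis' mem_box_cart(2))
    then show ?thesis
      unfolding E True by (simp add: inner_axis' Collect_conj_eq)
  next
    case False
    then have ca: "c = a $ i" using c by simp
    have "cbox a b \<inter> {x. axis i 1 \<bullet> x = a $ i} face_of cbox a b"
      by (rule face_of_Int_supporting_hyperplane_ge) (auto simp: inner_axis' mem_box_cart(2))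
    then show ?thesis
      unfolding E ca by (simp add: inner_axis' Collect_conj_eq)
  qed
  have dim: "aff_dim (cbox a b) = 2"
    using ne by (intro rectangle_props) (auto simp: rectangle_def)
  define p where "p s = (\<chi> k. if k = i then c else s)" for s
  have pE: "p s \<in> E" if "a $ j \<le> s" "s \<le> b $ j" for s
    unfolding E mem_Collect_eq mem_box_cart(2)
  proof (intro conjI allI)
    show "p s $ i = c" by (simp add: p_def)
    show "a $ k \<le> p s $ k" "p s $ k \<le> b $ k" for k
      using that c lt[of i] j(2)[rule_format, of k] j(1) by (auto simp: p_def)
  qed
  have "p (a $ j) $ j \<noteq> p (b $ j) $ j"
    using lt[of j] j(1) by (simp add: p_def)
  then have "p (a $ j) \<noteq> p (b $ j)"
    by metis
  then have "1 = aff_dim {p (a $ j), p (b $ j)}"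
    by (simp add: aff_dim_2)
  also have "\<dots> \<le> aff_dim E"
    using pE lt[of j] by (intro aff_dim_subset) auto
  finally have "1 \<le> aff_dim E" .
  moreover have "E \<noteq> cbox a b"
  proof
    assume "E = cbox a b"
    moreover have "a \<in> cbox a b" "b \<in> cbox a b"
      using lt by (auto simp: mem_box_cart(2) less_imp_le)
    ultimately have "a $ i = c" "b $ i = c"
      unfolding E by blast+
    then show False using lt[of i] by simp
  qed
  then have "aff_dim E < 2"
    using face_of_aff_dim_lt[OF _ face] dim by simp
  ultimately show "E edge_of cbox a b"
    using face by (simp add: edge_of_def)
qed

lemma edge_segment:
  assumes K: "rectangle K" and E: "E edge_of K"
  shows "E = closed_segment (interval_lowerbound E) (interval_upperbound E)"
    "interval_lowerbound E \<noteq> interval_upperbound E"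
proof -
  obtain a b where ab: "K = cbox a b" "box a b \<noteq> {}"
    using K by (auto simp: rectangle_def)
  obtain i c where c: "c = a $ i \<or> c = b $ i" and Ei: "E = {x \<in> cbox a b. x $ i = c}"
    using E ab edge_of_cbox_iff by blast
  obtain j where j: "j \<noteq> i" "\<forall>l. l = i \<or> l = j"
    using two_indices by blast
  have lt: "a $ k < b $ k" for k
    using ab by (simp add: interval_ne_empty_cart(2))
  define p where "p s = (\<chi> k. if k = i then c else s)" for s
  have p[simp]: "p s $ i = c" "p s $ j = s" for s
    using j by (auto simp: p_def)
  have veq: "x = y \<longleftrightarrow> x $ i = y $ i \<and> x $ j = y $ j" for x y :: pt
    unfolding vec_eq_iff by (rule all_two_indices[OF j(2)])
  have cb: "x \<in> cbox l r \<longleftrightarrow> l $ i \<le> x $ i \<and> x $ i \<le> r $ i \<and> l $ j \<le> x $ j \<and> x $ j \<le> r $ j"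
    for x l r :: pt
    unfolding mem_box_cart(2) by (subst all_two_indices[OF j(2)]) simp
  have Ebox: "E = cbox (p (a $ j)) (p (b $ j))"
    unfolding Ei using c lt[of i] by (auto simp: cb)
  have "cbox (p (a $ j)) (p (b $ j)) \<noteq> {}"
  proof -
    have "p (a $ j) \<in> cbox (p (a $ j)) (p (b $ j))"
      using lt[of j] by (simp add: cb)
    then show ?thesis by blast
  qed
  then have lb: "interval_lowerbound E = p (a $ j)" "interval_upperbound E = p (b $ j)"
    unfolding Ebox by auto
  have "p (a $ j) $ j \<noteq> p (b $ j) $ j"
    using lt[of j] by simp
  then show "interval_lowerbound E \<noteq> interval_upperbound E"
    unfolding lb by metis
  show "E = closed_segment (interval_lowerbound E) (interval_upperbound E)"
    unfolding lb
  proof (intro equalityI subsetI)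
    fix x assume x: "x \<in> E"
    then have xi: "x $ i = c" "a $ j \<le> x $ j" "x $ j \<le> b $ j"
      by (auto simp: Ei mem_box_cart(2))
    define u where "u = (x $ j - a $ j) / (b $ j - a $ j)"
    have u: "0 \<le> u" "u \<le> 1" "x $ j = a $ j + u * (b $ j - a $ j)"
      using xi lt[of j] by (auto simp: u_def field_simps)
    have "x = (1 - u) *\<^sub>R p (a $ j) + u *\<^sub>R p (b $ j)"
      using xi u(3) by (simp add: veq algebra_simps)
    then show "x \<in> closed_segment (p (a $ j)) (p (b $ j))"
      using u by (auto simp: closed_segment_def)
  next
    fix x assume "x \<in> closed_segment (p (a $ j)) (p (b $ j))"
    moreover have "p (a $ j) \<in> E" "p (b $ j) \<in> E"
      unfolding Ebox using lt[of j] by (auto simp: cb)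
    moreover have "convex E"
      unfolding Ebox by simp
    ultimately show "x \<in> E"
      using closed_segment_subset by blast
  qed
qed

lemma frontier_eq_Union_edges:
  assumes "rectangle K"
  shows "frontier K = \<Union>{E. E edge_of K}"
proof -
  note R = rectangle_props[OF assms]
  have "frontier K = rel_frontier K"
    using R(6) by (metis frontier_def rel_frontier_def rel_interior_nonempty_interior)
  also have "\<dots> = \<Union>{E. E facet_of K}"
    by (rule rel_frontier_of_polyhedron[OF R(10)])
  also have "{E. E facet_of K} = {E. E edge_of K}"
    using R(11) by (auto simp: facet_of_def edge_of_def)
  finally show ?thesis .
qed

lemma finite_edges: "rectangle K \<Longrightarrow> finite {E. E edge_of K}"
  using finite_polyhedron_faces[OF rectangle_props(10)]
  by (rule rev_finite_subset) (auto simp: edge_of_def)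

section \<open>Integrals over an edge\<close>
text \<open>
  The edge integral runs along the segment between the least and the greatest corner, so it is an
  integral over the whole edge only for sets that are such a segment.
\<close>
definition is_edge :: "pt set \<Rightarrow> bool"
  where "is_edge E \<longleftrightarrow> E = closed_segment (interval_lowerbound E) (interval_upperbound E) \<and>
    interval_lowerbound E \<noteq> interval_upperbound E"

lemma is_edgeI: "rectangle K \<Longrightarrow> E edge_of K \<Longrightarrow> is_edge E"
  using edge_segment by (simp add: is_edge_def)

definition edge_path :: "pt set \<Rightarrow> real \<Rightarrow> pt"
  where "edge_path E t = interval_lowerbound E + t *\<^sub>R (interval_upperbound E - interval_lowerbound E)"

definition edge_length :: "pt set \<Rightarrow> real"
  where "edge_length E = norm (interval_upperbound E - interval_lowerbound E)"

lemma edge_integral_eq: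
  "edge_integral E g = edge_length E * (LINT t|lebesgue_on {0..1}. g (edge_path E t))"
  by (simp add: edge_integral_def edge_path_def edge_length_def Let_def)

context
  fixes E assumes E: "is_edge E"
begin

lemma edge_length_pos: "edge_length E > 0"
  using E by (auto simp: is_edge_def edge_length_def)

lemma edge_path_image: "edge_path E ` {0..1} = E"
proof -
  have "edge_path E ` {0..1} = closed_segment (interval_lowerbound E) (interval_upperbound E)"
    unfolding closed_segment_image_interval edge_path_def
    by (intro image_cong) (auto simp: algebra_simps)
  then show ?thesis
    using E by (simp add: is_edge_def)
qed

lemma edge_path_in: "t \<in> {0..1} \<Longrightarrow> edge_path E t \<in> E"
  using edge_path_image by blast

lemma edge_integrand_continuous:
  assumes "continuous_on E g"
  shows "continuous_on {0..1} (\<lambda>t. g (edge_path E t))"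
proof (rule continuous_on_compose2[OF assms])
  show "continuous_on {0..1} (edge_path E)"
    unfolding edge_path_def by (intro continuous_intros)
  show "edge_path E ` {0..1} \<subseteq> E"
    by (simp add: edge_path_image)
qed

lemma edge_integrand_integrable:
  fixes g :: "pt \<Rightarrow> real"
  assumes "continuous_on E g"
  shows "integrable (lebesgue_on {0..1}) (\<lambda>t. g (edge_path E t))"
  by (rule continuous_imp_integrable_real[OF edge_integrand_continuous[OF assms]])

lemma edge_integral_add:
  assumes "continuous_on E g" "continuous_on E h"
  shows "edge_integral E (\<lambda>x. g x + h x) = edge_integral E g + edge_integral E h"
  using assms[THEN edge_integrand_integrable] by (simp add: edge_integral_eq distrib_left)

lemma edge_integral_diff:
  assumes "continuous_on E g" "continuous_on E h"
  shows "edge_integral E (\<lambda>x. g x - h x) = edge_integral E g - edge_integral E h"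
  using assms[THEN edge_integrand_integrable] by (simp add: edge_integral_eq right_diff_distrib)

lemma edge_integral_cmult: "edge_integral E (\<lambda>x. c * g x) = c * edge_integral E g"
  by (simp add: edge_integral_eq)

lemma edge_integral_cong:
  assumes "\<And>x. x \<in> E \<Longrightarrow> g x = h x"
  shows "edge_integral E g = edge_integral E h"
  unfolding edge_integral_eq
  by (intro arg_cong[where f = "(*) (edge_length E)"] Bochner_Integration.integral_cong)
    (auto intro!: assms edge_path_in)

lemma edge_integral_nonneg:
  assumes "\<And>x. x \<in> E \<Longrightarrow> 0 \<le> g x"
  shows "0 \<le> edge_integral E g"
  unfolding edge_integral_eq using edge_length_pos
  by (intro mult_nonneg_nonneg Bochner_Integration.integral_nonneg) (auto intro!: assms edge_path_in)

lemma edge_integral_mono: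
  assumes "continuous_on E g" "continuous_on E h" "\<And>x. x \<in> E \<Longrightarrow> g x \<le> h x"
  shows "edge_integral E g \<le> edge_integral E h"
  using edge_integral_nonneg[of "\<lambda>x. h x - g x"] edge_integral_diff[OF assms(2,1)] assms(3) by simp

lemma edge_integral_zero_imp:
  assumes g: "continuous_on E g" and nn: "\<And>x. x \<in> E \<Longrightarrow> 0 \<le> g x"
    and z: "edge_integral E g = 0" and x: "x \<in> E"
  shows "g x = 0"
proof -
  let ?h = "\<lambda>t. g (edge_path E t)"
  have "(LINT t|lebesgue_on {0..1}. ?h t) = 0"
    using z edge_length_pos by (simp add: edge_integral_eq)
  then have "integral {0..1} ?h = 0"
    using lebesgue_integral_eq_integral[OF edge_integrand_integrable[OF g]] by simp
  then have "\<forall>t\<in>{0..1}. ?h t = 0"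
    using integral_eq_0_iff[OF edge_integrand_continuous[OF g]] nn edge_path_in by simp
  moreover obtain t where "t \<in> {0..1}" "x = edge_path E t"
    using x edge_path_image by blast
  ultimately show ?thesis by simp
qed

end

section \<open>Piecewise Lipschitz functions on a block\<close>
definition fscale :: "real \<Rightarrow> (pt \<Rightarrow> real) \<Rightarrow> pt \<Rightarrow> real"
  where "fscale c u = (\<lambda>x. c * u x)"

interpretation fsp: vector_space fscale
  by unfold_locales (auto simp: fscale_def fun_eq_iff algebra_simps)

lemma fsp_finite_basis:
  assumes "finite B0" "S \<subseteq> fsp.span B0" "fsp.subspace S"
  obtains B where "finite B" "B \<subseteq> S" "fsp.span B = S"
proof -
  obtain B where B: "B \<subseteq> S" "fsp.independent B" "S \<subseteq> fsp.span B"
    using fsp.maximal_independent_subset by blast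
  then have "finite B"
    using fsp.independent_span_bound[OF assms(1) B(2)] assms(2) by blast
  moreover have "fsp.span B = S"
    using B(3) fsp.span_minimal[OF B(1) assms(3)] by blast
  ultimately show ?thesis
    using that B(1) by blast
qed

lemma fscale_apply [simp]: "fscale c u x = c * u x"
  by (simp add: fscale_def)

lemma grad_add:
  assumes "u differentiable (at x)" "v differentiable (at x)"
  shows "grad (u + v) x = grad u x + grad v x" "(u + v) differentiable (at x)"
proof -
  have *: "u + v = (\<lambda>y. u y + v y)" by (simp add: fun_eq_iff)
  show "grad (u + v) x = grad u x + grad v x"
    unfolding * using assms[THEN gderiv_grad] by (intro grad_eqI GDERIV_add)
  show "(u + v) differentiable (at x)"
    unfolding * using assms by (rule differentiable_add)
qed

lemma grad_mult:
  assumes "u differentiable (at x)" "v differentiable (at x)"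
  shows "grad (\<lambda>y. u y * v y) x = u x *\<^sub>R grad v x + v x *\<^sub>R grad u x"
    "(\<lambda>y. u y * v y) differentiable (at x)"
  using assms[THEN gderiv_grad] assms by (auto intro!: grad_eqI GDERIV_mult differentiable_mult)

lemma grad_fscale:
  assumes "u differentiable (at x)"
  shows "grad (fscale c u) x = c *\<^sub>R grad u x" "fscale c u differentiable (at x)"
proof -
  have "grad (\<lambda>y. c * u y) x = c *\<^sub>R grad u x + u x *\<^sub>R grad (\<lambda>y. c) x"
    using assms by (intro grad_mult) auto
  then show "grad (fscale c u) x = c *\<^sub>R grad u x"
    by (simp add: fscale_def grad_eqI[OF GDERIV_const])
  show "fscale c u differentiable (at x)"
    unfolding fscale_def using assms by (intro differentiable_mult) auto
qed

text \<open>
  The difference quotient in the direction of the gradient is at most \<open>C\<close>, and its limit is the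
  norm of the gradient.
\<close>
lemma lipschitz_gradient_bound:
  fixes u :: "pt \<Rightarrow> real"
  assumes lip: "C-lipschitz_on S u" and x: "x \<in> interior S" and d: "u differentiable (at x)"
  shows "norm (grad u x) \<le> C"
proof (rule field_le_epsilon)
  fix e :: real assume e: "0 < e"
  define g where "g = grad u x"
  have "(u has_derivative (\<lambda>h. h \<bullet> g)) (at x)"
    using gderiv_grad[OF d] by (simp add: gderiv_def g_def)
  then obtain r where r: "r > 0"
    and bound: "\<And>y. norm (y - x) < r \<Longrightarrow> norm (u y - u x - (y - x) \<bullet> g) \<le> e * norm (y - x)"
    unfolding has_derivative_at_alt using e by blast
  obtain s where s: "s > 0" "ball x s \<subseteq> S"
    using x mem_interior by blast
  show "norm (grad u x) \<le> C + e"
  proof (cases "g = 0")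
    case True
    then show ?thesis
      using e lipschitz_on_nonneg[OF lip] by (simp add: g_def)
  next
    case False
    define t where "t = min r s / 2 / norm g"
    have t: "t > 0" "t * norm g < r" "t * norm g < s"
      using False r s by (auto simp: t_def min_def field_simps)
    define y where "y = x + t *\<^sub>R g"
    have yx: "y - x = t *\<^sub>R g" "norm (y - x) = t * norm g"
      using t by (simp_all add: y_def)
    have "y \<in> S" "x \<in> S"
      using s t yx by (auto simp: dist_norm norm_minus_commute subset_iff)
    then have "\<bar>u y - u x\<bar> \<le> C * (t * norm g)"
      using lipschitz_onD[OF lip, of y x] yx(2) by (simp add: dist_norm)
    moreover have "\<bar>u y - u x - t * (norm g)\<^sup>2\<bar> \<le> e * (t * norm g)"
      using bound[of y] yx t by (simp add: power2_norm_eq_inner)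
    ultimately have "t * (norm g)\<^sup>2 \<le> (C + e) * (t * norm g)"
      by (simp add: algebra_simps)
    then have "(t * norm g) * norm g \<le> (t * norm g) * (C + e)"
      by (simp add: power2_eq_square algebra_simps)
    then show ?thesis
      using t False unfolding g_def[symmetric] by simp
  qed
qed

lemma lipschitz_on_mult:
  fixes u v :: "pt \<Rightarrow> real"
  assumes "C-lipschitz_on S u" "D-lipschitz_on S v"
    and "\<And>x. x \<in> S \<Longrightarrow> \<bar>u x\<bar> \<le> A" "\<And>x. x \<in> S \<Longrightarrow> \<bar>v x\<bar> \<le> B" "0 \<le> A" "0 \<le> B"
  shows "(A * D + B * C)-lipschitz_on S (\<lambda>x. u x * v x)"
proof (rule lipschitz_onI)
  note C = lipschitz_on_nonneg[OF assms(1)] lipschitz_on_nonneg[OF assms(2)]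
  show "0 \<le> A * D + B * C"
    using C assms by simp
  fix x y assume xy: "x \<in> S" "y \<in> S"
  have "\<bar>u x * v x - u y * v y\<bar> = \<bar>u x * (v x - v y) + v y * (u x - u y)\<bar>"
    by (simp add: algebra_simps)
  also have "\<dots> \<le> \<bar>u x\<bar> * \<bar>v x - v y\<bar> + \<bar>v y\<bar> * \<bar>u x - u y\<bar>"
    using abs_triangle_ineq[of "u x * (v x - v y)" "v y * (u x - u y)"] by (simp add: abs_mult)
  also have "\<dots> \<le> A * (D * dist x y) + B * (C * dist x y)"
    using lipschitz_onD[OF assms(1) xy] lipschitz_onD[OF assms(2) xy] assms xy C
    by (intro add_mono mult_mono) (auto simp: dist_real_def)
  finally show "dist (u x * v x) (u y * v y) \<le> (A * D + B * C) * dist x y"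
    by (simp add: dist_real_def algebra_simps)
qed

definition lipschitz_fun :: "pt set \<Rightarrow> (pt \<Rightarrow> real) \<Rightarrow> bool"
  where "lipschitz_fun S u \<longleftrightarrow> (\<exists>C. C-lipschitz_on S u)"

lemma lipschitz_fun_const: "lipschitz_fun S (\<lambda>x. c)"
  unfolding lipschitz_fun_def by (rule exI[of _ 0]) (simp add: lipschitz_on_def)

lemma lipschitz_fun_add:
  "lipschitz_fun S u \<Longrightarrow> lipschitz_fun S v \<Longrightarrow> lipschitz_fun S (\<lambda>x. u x + v x)"
  unfolding lipschitz_fun_def using lipschitz_on_add by blast

lemma lipschitz_fun_continuous: "lipschitz_fun S u \<Longrightarrow> continuous_on S u"
  unfolding lipschitz_fun_def using lipschitz_on_continuous_on by blast

lemma lipschitz_fun_subset: "lipschitz_fun S u \<Longrightarrow> T \<subseteq> S \<Longrightarrow> lipschitz_fun T u"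
  unfolding lipschitz_fun_def using lipschitz_on_subset by blast

lemma lipschitz_fun_cong:
  "(\<And>x. x \<in> S \<Longrightarrow> u x = v x) \<Longrightarrow> lipschitz_fun S u \<longleftrightarrow> lipschitz_fun S v"
  unfolding lipschitz_fun_def by (metis lipschitz_on_transform)

lemma continuous_bounded:
  fixes u :: "pt \<Rightarrow> real"
  assumes "compact S" "continuous_on S u"
  obtains A where "0 \<le> A" "\<And>x. x \<in> S \<Longrightarrow> \<bar>u x\<bar> \<le> A"
proof -
  have "bounded (u ` S)"
    using assms compact_continuous_image compact_imp_bounded by blast
  then obtain A where "\<And>x. x \<in> S \<Longrightarrow> \<bar>u x\<bar> \<le> A"
    unfolding bounded_iff by auto
  then show ?thesis
    by (intro that[of "max A 0"]) force+
qed

lemma lipschitz_fun_mult: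
  assumes "compact S" "lipschitz_fun S u" "lipschitz_fun S v"
  shows "lipschitz_fun S (\<lambda>x. u x * v x)"
proof -
  obtain C D where CD: "C-lipschitz_on S u" "D-lipschitz_on S v"
    using assms by (auto simp: lipschitz_fun_def)
  obtain A where A: "0 \<le> A" "\<And>x. x \<in> S \<Longrightarrow> \<bar>u x\<bar> \<le> A"
    using continuous_bounded[OF assms(1) lipschitz_fun_continuous[OF assms(2)]] by blast
  obtain B where B: "0 \<le> B" "\<And>x. x \<in> S \<Longrightarrow> \<bar>v x\<bar> \<le> B"
    using continuous_bounded[OF assms(1) lipschitz_fun_continuous[OF assms(3)]] by blast
  show ?thesis
    unfolding lipschitz_fun_def using lipschitz_on_mult[OF CD A(2) B(2) A(1) B(1)] by blast
qed

lemma lipschitz_fun_sum: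
  "(\<And>i. i \<in> I \<Longrightarrow> lipschitz_fun S (u i)) \<Longrightarrow> lipschitz_fun S (\<lambda>x. \<Sum>i\<in>I. u i x)"
  by (induction I rule: infinite_finite_induct) (auto intro: lipschitz_fun_const lipschitz_fun_add)

lemma lipschitz_fun_power:
  assumes "compact S" "lipschitz_fun S u"
  shows "lipschitz_fun S (\<lambda>x. u x ^ n)"
  by (induction n) (auto intro: lipschitz_fun_const lipschitz_fun_mult assms)

lemma lipschitz_fun_component: "lipschitz_fun S (\<lambda>x. x $ i)"
proof -
  have "1-lipschitz_on S (\<lambda>x. x $ i)"
    by (rule lipschitz_onI) (auto simp: dist_vec_nth_le)
  then show ?thesis unfolding lipschitz_fun_def by blast
qed

definition polynomial2 :: "nat \<Rightarrow> (nat \<Rightarrow> nat \<Rightarrow> real) \<Rightarrow> pt \<Rightarrow> real"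
  where "polynomial2 r c x = (\<Sum>i\<le>r. \<Sum>j\<le>r. c i j * (x$1) ^ i * (x$2) ^ j)"

lemma lipschitz_polynomial2:
  assumes "compact S"
  shows "lipschitz_fun S (polynomial2 r c)"
proof -
  have "lipschitz_fun S (\<lambda>x. \<Sum>i\<le>r. \<Sum>j\<le>r. c i j * (x$1) ^ i * (x$2) ^ j)"
    by (intro lipschitz_fun_sum lipschitz_fun_mult lipschitz_fun_power lipschitz_fun_component
        lipschitz_fun_const assms)
  then show ?thesis
    by (simp add: polynomial2_def[abs_def])
qed

lemma differentiable_component: "(\<lambda>x::pt. x $ i) differentiable (at x)"
  by (rule bounded_linear_imp_differentiable) (rule bounded_linear_vec_nth)

lemma differentiable_polynomial2: "polynomial2 r c differentiable (at x)"
proof -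
  have "(\<lambda>x::pt. \<Sum>i\<le>r. \<Sum>j\<le>r. c i j * (x$1) ^ i * (x$2) ^ j) differentiable (at x)"
    by (intro differentiable_sum differentiable_mult differentiable_power differentiable_const
        differentiable_component ballI) auto
  then show ?thesis
    by (simp add: polynomial2_def[abs_def])
qed

locale block =
  fixes K :: "pt set" and T :: "pt set set" and \<kappa> :: "pt \<Rightarrow> real"
  assumes rectK: "rectangle K" and finT: "finite T" and rectT: "\<tau> \<in> T \<Longrightarrow> rectangle \<tau>"
    and union: "\<Union>T = K"
    and \<kappa>_meas: "\<kappa> \<in> borel_measurable (lebesgue_on K)"
    and \<kappa>_bdd: "bounded (\<kappa> ` K)" and \<kappa>_ge1: "x \<in> K \<Longrightarrow> 1 \<le> \<kappa> x"
begin

lemmas rect = rectangle_props[OF rectK]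

text \<open>
  \<open>H\<close> is the space on which the energy is a semidefinite form. It contains the finite element
  functions as well as their products with the partition of unity functions. Asking for Lipschitz
  continuity on each fine cell only, and not on \<open>K\<close>, makes membership of the former immediate.
\<close>
definition H :: "(pt \<Rightarrow> real) set"
  where "H = {u. continuous_on K u \<and> (\<forall>\<tau>\<in>T. lipschitz_fun \<tau> u) \<and>
    (AE x in lebesgue_on K. u differentiable (at x))}"

definition energy :: "(pt \<Rightarrow> real) \<Rightarrow> (pt \<Rightarrow> real) \<Rightarrow> real"
  where "energy u v = (LINT x|lebesgue_on K. \<kappa> x * (grad u x \<bullet> grad v x))"

lemma AE_differentiable: "u \<in> H \<Longrightarrow> AE x in lebesgue_on K. u differentiable (at x)"
  by (simp add: H_def)

lemma AE_interior: "AE x in lebesgue_on K. \<exists>\<tau>\<in>T. x \<in> interior \<tau>"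
proof -
  have "{x \<in> K. \<not> (\<exists>\<tau>\<in>T. x \<in> interior \<tau>)} \<subseteq> (\<Union>\<tau>\<in>T. frontier \<tau>)"
    using union closure_subset by (fastforce simp: frontier_def)
  moreover have "negligible (\<Union>\<tau>\<in>T. frontier \<tau>)"
    using finT rectT rectangle_props(9) by (intro negligible_Union) auto
  ultimately show ?thesis
    by (simp add: AE_lebesgue_on_iff[OF rect(8)] negligible_subset)
qed

lemma H_add: "u \<in> H \<Longrightarrow> v \<in> H \<Longrightarrow> u + v \<in> H"
  unfolding H_def
  by (auto simp: plus_fun_def intro!: continuous_intros lipschitz_fun_add)

lemma H_mult: "u \<in> H \<Longrightarrow> v \<in> H \<Longrightarrow> (\<lambda>x. u x * v x) \<in> H"
  unfolding H_def using rectT rectangle_props(1)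
  by (auto intro!: continuous_intros lipschitz_fun_mult)

lemma H_const: "(\<lambda>x. c) \<in> H"
  by (simp add: H_def lipschitz_fun_const)

lemma H_zero: "0 \<in> H"
  using H_const[of 0] by (simp add: zero_fun_def)

lemma H_fscale: "u \<in> H \<Longrightarrow> fscale c u \<in> H"
  unfolding fscale_def by (intro H_mult H_const)

lemma subspace_H: "fsp.subspace H"
  by (simp add: fsp.subspace_def H_zero H_add H_fscale)

lemma H_continuous: "u \<in> H \<Longrightarrow> continuous_on K u"
  by (simp add: H_def)

lemma gradient_bounded:
  assumes "u \<in> H"
  obtains B where "0 \<le> B" "AE x in lebesgue_on K. norm (grad u x) \<le> B"
proof -
  have "\<forall>\<tau>\<in>T. \<exists>C. C-lipschitz_on \<tau> u"
    using assms by (auto simp: H_def lipschitz_fun_def)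
  then obtain C where C: "\<And>\<tau>. \<tau> \<in> T \<Longrightarrow> (C \<tau>)-lipschitz_on \<tau> u"
    by metis
  define B where "B = (\<Sum>\<tau>\<in>T. C \<tau>)"
  have nn: "0 \<le> C \<tau>" if "\<tau> \<in> T" for \<tau>
    using C[OF that] lipschitz_on_nonneg by blast
  have "AE x in lebesgue_on K. norm (grad u x) \<le> B"
    using AE_interior AE_differentiable[OF assms]
  proof eventually_elim
    case (elim x)
    then obtain \<tau> where \<tau>: "\<tau> \<in> T" "x \<in> interior \<tau>" by blast
    then have "norm (grad u x) \<le> C \<tau>"
      using elim C lipschitz_gradient_bound by blast
    also have "\<dots> \<le> B"
      unfolding B_def using \<tau> finT nn by (intro member_le_sum) auto
    finally show ?case .
  qed
  moreover have "0 \<le> B"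
    unfolding B_def using nn by (rule sum_nonneg)
  ultimately show ?thesis using that by blast
qed

lemma grad_component_measurable: "u \<in> H \<Longrightarrow> (\<lambda>x. grad u x $ k) \<in> borel_measurable (lebesgue_on K)"
  by (intro grad_measurable rect AE_differentiable)

lemma grad_inner_measurable:
  assumes "u \<in> H" "v \<in> H"
  shows "(\<lambda>x. grad u x \<bullet> grad v x) \<in> borel_measurable (lebesgue_on K)"
  unfolding inner_vec_def using assms
  by (auto intro!: borel_measurable_sum borel_measurable_times grad_component_measurable)

lemma continuous_measurable:
  fixes g :: "pt \<Rightarrow> real"
  shows "continuous_on K g \<Longrightarrow> g \<in> borel_measurable (lebesgue_on K)"
  using rect(8) by (intro continuous_imp_measurable_on_sets_lebesgue)

lemma \<kappa>_bound: obtains A where "0 \<le> A" "\<And>x. x \<in> K \<Longrightarrow> \<bar>\<kappa> x\<bar> \<le> A"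
proof -
  obtain A where "\<And>x. x \<in> K \<Longrightarrow> \<bar>\<kappa> x\<bar> \<le> A"
    using \<kappa>_bdd unfolding bounded_iff by auto
  then show ?thesis
    by (intro that[of "max A 0"]) force+
qed

lemma finite_measure_K: "finite_measure (lebesgue_on K)"
  using rect(1) by (intro finite_measure_lebesgue_on lmeasurable_compact)

lemma integrable_weighted_gradients:
  assumes u: "u \<in> H" and v: "v \<in> H" and g: "continuous_on K g"
  shows "integrable (lebesgue_on K) (\<lambda>x. \<kappa> x * (grad u x \<bullet> grad v x) * g x)"
proof -
  obtain A where A: "0 \<le> A" "\<And>x. x \<in> K \<Longrightarrow> \<bar>\<kappa> x\<bar> \<le> A"
    using \<kappa>_bound by blast
  obtain B where B: "0 \<le> B" "AE x in lebesgue_on K. norm (grad u x) \<le> B"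
    using gradient_bounded[OF u] by blast
  obtain C where C: "0 \<le> C" "AE x in lebesgue_on K. norm (grad v x) \<le> C"
    using gradient_bounded[OF v] by blast
  obtain D where D: "0 \<le> D" "\<And>x. x \<in> K \<Longrightarrow> \<bar>g x\<bar> \<le> D"
    using continuous_bounded[OF rect(1) g] by blast
  have "AE x in lebesgue_on K. x \<in> K"
    by (rule AE_I2) simp
  with B(2) C(2) have "AE x in lebesgue_on K. norm (\<kappa> x * (grad u x \<bullet> grad v x) * g x) \<le> A * (B * C) * D"
  proof eventually_elim
    case (elim x)
    have "\<bar>grad u x \<bullet> grad v x\<bar> \<le> norm (grad u x) * norm (grad v x)"
      by (rule Cauchy_Schwarz_ineq2)
    also have "\<dots> \<le> B * C"
      using elim B C by (intro mult_mono) auto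
    finally have "\<bar>\<kappa> x\<bar> * \<bar>grad u x \<bullet> grad v x\<bar> * \<bar>g x\<bar> \<le> A * (B * C) * D"
      using elim A B C D by (intro mult_mono) auto
    then show ?case by (simp add: abs_mult)
  qed
  then show ?thesis
    by (rule finite_measure.integrable_const_bound[OF finite_measure_K])
      (intro borel_measurable_times \<kappa>_meas grad_inner_measurable u v continuous_measurable g)
qed

lemma integrable_energy:
  "u \<in> H \<Longrightarrow> v \<in> H \<Longrightarrow> integrable (lebesgue_on K) (\<lambda>x. \<kappa> x * (grad u x \<bullet> grad v x))"
  using integrable_weighted_gradients[of u v "\<lambda>x. 1"] by simp

lemma AE_K: "AE x in lebesgue_on K. x \<in> K"
  by (rule AE_I2) simp

lemma psd_form_energy: "psd_form fscale H energy"
proof unfold_locales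
  show "fsp.subspace H" by (rule subspace_H)
  show "energy (u + v) w = energy u w + energy v w" if uvw: "u \<in> H" "v \<in> H" "w \<in> H" for u v w
  proof -
    have "energy (u + v) w = (LINT x|lebesgue_on K. \<kappa> x * (grad u x \<bullet> grad w x) + \<kappa> x * (grad v x \<bullet> grad w x))"
      unfolding energy_def
    proof (rule integral_cong_AE)
      show "AE x in lebesgue_on K. \<kappa> x * (grad (u + v) x \<bullet> grad w x) =
          \<kappa> x * (grad u x \<bullet> grad w x) + \<kappa> x * (grad v x \<bullet> grad w x)"
        using AE_differentiable[OF uvw(1)] AE_differentiable[OF uvw(2)]
        by eventually_elim (simp add: grad_add inner_add_left algebra_simps)
    qed (use uvw in \<open>auto intro!: borel_measurable_integrable integrable_energy H_add
          Bochner_Integration.integrable_add\<close>)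
    then show ?thesis
      using uvw by (simp add: energy_def integrable_energy)
  qed
  show "energy (fscale c u) v = c * energy u v" if uv: "u \<in> H" "v \<in> H" for u v c
  proof -
    have "energy (fscale c u) v = (LINT x|lebesgue_on K. c * (\<kappa> x * (grad u x \<bullet> grad v x)))"
      unfolding energy_def
    proof (rule integral_cong_AE)
      show "AE x in lebesgue_on K. \<kappa> x * (grad (fscale c u) x \<bullet> grad v x) =
          c * (\<kappa> x * (grad u x \<bullet> grad v x))"
        using AE_differentiable[OF uv(1)]
        by eventually_elim (simp add: grad_fscale)
    qed (use uv in \<open>auto intro!: borel_measurable_integrable integrable_energy H_fscale
          Bochner_Integration.integrable_mult_right\<close>)
    then show ?thesis
      by (simp add: energy_def)
  qed
  show "energy u v = energy v u" for u v
    by (simp add: energy_def inner_commute)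
  show "0 \<le> energy u u" for u
    unfolding energy_def using \<kappa>_ge1
    by (intro Bochner_Integration.integral_nonneg mult_nonneg_nonneg)
      (auto intro: order_trans[OF zero_le_one])
qed

sublocale E: psd_form fscale H energy
  by (rule psd_form_energy)

text \<open>
  The gradient vanishes almost everywhere, so \<open>u\<close> is constant on each of the finitely many fine
  cells. A continuous function with finitely many values is constant on the connected set \<open>K\<close>.
\<close>
lemma energy_zero_imp_constant:
  assumes u: "u \<in> H" and z: "energy u u = 0" and x: "x \<in> K" and y: "y \<in> K"
  shows "u x = u y"
proof -
  have "AE x in lebesgue_on K. 0 \<le> \<kappa> x * (grad u x \<bullet> grad u x)"
    using AE_K by eventually_elim (use \<kappa>_ge1 in \<open>force intro!: mult_nonneg_nonneg\<close>)
  then have "AE x in lebesgue_on K. \<kappa> x * (grad u x \<bullet> grad u x) = 0"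
    using z integral_nonneg_eq_0_iff_AE[OF integrable_energy[OF u u]] by (simp add: energy_def)
  with AE_K AE_differentiable[OF u] have AE0: "AE x in lebesgue_on K. GDERIV u x :> 0"
  proof eventually_elim
    case (elim x)
    then have "grad u x = 0"
      using \<kappa>_ge1[of x] by auto
    then show ?case
      using gderiv_grad elim by metis
  qed
  have const: "u p = u q" if \<tau>: "\<tau> \<in> T" "p \<in> \<tau>" "q \<in> \<tau>" for \<tau> p q
  proof -
    obtain a b where ab: "\<tau> = cbox a b" "box a b \<noteq> {}"
      using rectT[OF \<tau>(1)] by (auto simp: rectangle_def)
    obtain C where C: "C-lipschitz_on (cbox a b) u"
      using u \<tau>(1) ab by (auto simp: H_def lipschitz_fun_def)
    have "cbox a b \<subseteq> K"
      using \<tau>(1) ab union by blast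
    then have "AE x in lebesgue_on (cbox a b). GDERIV u x :> 0"
      using AE0 rect(8) by (auto simp: AE_lebesgue_on_iff elim!: negligible_subset)
    then show ?thesis
      using zero_gradient_imp_constant[OF ab(2) C] \<tau> ab by blast
  qed
  have "u ` K = (\<Union>\<tau>\<in>T. u ` \<tau>)"
    using union by blast
  moreover have "finite (u ` \<tau>)" if "\<tau> \<in> T" for \<tau>
  proof (cases "\<tau> = {}")
    case False
    then obtain p where "p \<in> \<tau>" by blast
    then have "u ` \<tau> \<subseteq> {u p}"
      using const that by blast
    then show ?thesis
      using finite_subset by blast
  qed simp
  ultimately have "finite (u ` K)"
    using finT by simp
  then have "u constant_on K"
    using continuous_finite_range_constant[OF rect(4) H_continuous[OF u]] by blast
  then show ?thesis
    using x y by (auto simp: constant_on_def)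
qed

definition Q :: "nat \<Rightarrow> (pt \<Rightarrow> real) set"
  where "Q r = {v. continuous_on K v \<and> (\<forall>x. x \<notin> K \<longrightarrow> v x = 0) \<and>
    (\<forall>\<tau>\<in>T. \<exists>c. \<forall>x\<in>\<tau>. v x = polynomial2 r c x)}"

lemma Q_subset_H: "Q r \<subseteq> H"
proof
  fix v assume v: "v \<in> Q r"
  show "v \<in> H"
    unfolding H_def mem_Collect_eq
  proof (intro conjI ballI)
    show "continuous_on K v"
      using v by (simp add: Q_def)
    show "lipschitz_fun \<tau> v" if \<tau>: "\<tau> \<in> T" for \<tau>
    proof -
      have "\<exists>c. \<forall>x\<in>\<tau>. v x = polynomial2 r c x"
        using v \<tau> by (simp add: Q_def)
      then obtain c where "\<forall>x\<in>\<tau>. v x = polynomial2 r c x" ..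
      then show ?thesis
        using lipschitz_polynomial2[OF rectangle_props(1)[OF rectT[OF \<tau>]]]
        by (subst lipschitz_fun_cong[where v = "polynomial2 r c"]) auto
    qed
    show "AE x in lebesgue_on K. v differentiable (at x)"
      using AE_interior
    proof eventually_elim
      case (elim x)
      then obtain \<tau> where \<tau>: "\<tau> \<in> T" "x \<in> interior \<tau>" by blast
      have "\<exists>c. \<forall>x\<in>\<tau>. v x = polynomial2 r c x"
        using v \<tau> by (simp add: Q_def)
      then obtain c where c: "\<forall>x\<in>\<tau>. v x = polynomial2 r c x" ..
      obtain f' where "(polynomial2 r c has_derivative f') (at x)"
        using differentiable_polynomial2 unfolding differentiable_def by blast
      then have "(v has_derivative f') (at x)"
        by (rule has_derivative_transform_within_open[OF _ open_interior \<tau>(2)])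
          (use c interior_subset in force)
      then show ?case
        by (auto simp: differentiable_def)
    qed
  qed
qed

lemma polynomial2_add: "polynomial2 r c x + polynomial2 r d x = polynomial2 r (\<lambda>i j. c i j + d i j) x"
  by (simp add: polynomial2_def sum.distrib algebra_simps)

lemma polynomial2_scale: "a * polynomial2 r c x = polynomial2 r (\<lambda>i j. a * c i j) x"
  by (simp add: polynomial2_def sum_distrib_left algebra_simps)

lemma subspace_Q: "fsp.subspace (Q r)"
  unfolding fsp.subspace_def
proof (intro conjI ballI allI)
  show "0 \<in> Q r"
    unfolding Q_def by (auto simp: zero_fun_def polynomial2_def intro!: exI[of _ "\<lambda>i j. 0"])
  show "u + v \<in> Q r" if "u \<in> Q r" "v \<in> Q r" for u v
    unfolding Q_def mem_Collect_eq
  proof (intro conjI allI impI ballI)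
    show "continuous_on K (u + v)"
      using that unfolding plus_fun_def Q_def by (auto intro!: continuous_intros)
    show "(u + v) x = 0" if "x \<notin> K" for x
      using \<open>u \<in> Q r\<close> \<open>v \<in> Q r\<close> that by (simp add: Q_def)
    fix \<tau> assume \<tau>: "\<tau> \<in> T"
    have "\<exists>c. \<forall>x\<in>\<tau>. u x = polynomial2 r c x" "\<exists>c. \<forall>x\<in>\<tau>. v x = polynomial2 r c x"
      using that \<tau> by (simp_all add: Q_def)
    then obtain c d where "\<forall>x\<in>\<tau>. u x = polynomial2 r c x" "\<forall>x\<in>\<tau>. v x = polynomial2 r d x"
      by (elim exE)
    then show "\<exists>c. \<forall>x\<in>\<tau>. (u + v) x = polynomial2 r c x"
      using polynomial2_add by (intro exI[of _ "\<lambda>i j. c i j + d i j"]) simp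
  qed
  show "fscale a u \<in> Q r" if "u \<in> Q r" for a u
    unfolding Q_def mem_Collect_eq
  proof (intro conjI allI impI ballI)
    show "continuous_on K (fscale a u)"
      using that unfolding fscale_def Q_def by (auto intro!: continuous_intros)
    show "fscale a u x = 0" if "x \<notin> K" for x
      using \<open>u \<in> Q r\<close> that by (simp add: Q_def)
    fix \<tau> assume \<tau>: "\<tau> \<in> T"
    have "\<exists>c. \<forall>x\<in>\<tau>. u x = polynomial2 r c x"
      using that \<tau> by (simp add: Q_def)
    then obtain c where "\<forall>x\<in>\<tau>. u x = polynomial2 r c x" ..
    then show "\<exists>c. \<forall>x\<in>\<tau>. fscale a u x = polynomial2 r c x"
      using polynomial2_scale by (intro exI[of _ "\<lambda>i j. a * c i j"]) simp
  qed
qed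

text \<open>
  With one fine cell selected for each point of \<open>K\<close>, every piecewise polynomial is a combination of
  the finitely many monomials cut off to the sets of points with a given selected cell.
\<close>
lemma Q_finite_dim: obtains B where "finite B" "B \<subseteq> Q r" "fsp.span B = Q r"
proof -
  define sel where "sel x = (SOME \<tau>. \<tau> \<in> T \<and> x \<in> \<tau>)" for x
  have sel: "sel x \<in> T \<and> x \<in> sel x" if "x \<in> K" for x
    unfolding sel_def by (rule someI_ex) (use that union in blast)
  define e where "e = (\<lambda>(\<tau>, i, j) x. if x \<in> K \<and> sel x = \<tau> then (x$1) ^ i * (x$2) ^ j else (0::real))"
  define B0 where "B0 = e ` (T \<times> {..r} \<times> {..r})"
  have fin: "finite B0"
    using finT by (simp add: B0_def)
  have "Q r \<subseteq> fsp.span B0"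
  proof
    fix v assume v: "v \<in> Q r"
    then have "\<forall>\<tau>\<in>T. \<exists>c. \<forall>x\<in>\<tau>. v x = polynomial2 r c x"
      by (simp add: Q_def)
    then obtain c where c: "\<And>\<tau> x. \<tau> \<in> T \<Longrightarrow> x \<in> \<tau> \<Longrightarrow> v x = polynomial2 r (c \<tau>) x"
      by metis
    have sum_apply: "(\<Sum>a\<in>A. f a) x = (\<Sum>a\<in>A. f a x)"
      for f :: "pt set \<times> nat \<times> nat \<Rightarrow> pt \<Rightarrow> real" and A x
      by (induction A rule: infinite_finite_induct) auto
    have "v = (\<Sum>(\<tau>, i, j)\<in>T \<times> {..r} \<times> {..r}. fscale (c \<tau> i j) (e (\<tau>, i, j)))"
    proof
      fix x
      have "(\<Sum>(\<tau>, i, j)\<in>T \<times> {..r} \<times> {..r}. fscale (c \<tau> i j) (e (\<tau>, i, j))) x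
          = (\<Sum>(\<tau>, i, j)\<in>T \<times> {..r} \<times> {..r}. c \<tau> i j * e (\<tau>, i, j) x)"
        unfolding sum_apply by (intro sum.cong) auto
      also have "\<dots> = (\<Sum>\<tau>\<in>T. \<Sum>i\<le>r. \<Sum>j\<le>r. c \<tau> i j * e (\<tau>, i, j) x)"
        by (simp add: sum.cartesian_product)
      also have "\<dots> = (\<Sum>\<tau>\<in>T. if x \<in> K \<and> sel x = \<tau> then polynomial2 r (c \<tau>) x else 0)"
      proof (rule sum.cong[OF refl])
        fix \<tau>
        show "(\<Sum>i\<le>r. \<Sum>j\<le>r. c \<tau> i j * e (\<tau>, i, j) x) =
            (if x \<in> K \<and> sel x = \<tau> then polynomial2 r (c \<tau>) x else 0)"
        proof (cases "x \<in> K \<and> sel x = \<tau>")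
          case True
          then show ?thesis
            by (simp add: e_def polynomial2_def mult.assoc)
        next
          case False
          then have "e (\<tau>, i, j) x = 0" for i j
            unfolding e_def prod.case by (rule if_not_P)
          then show ?thesis
            unfolding if_not_P[OF False] by simp
        qed
      qed
      also have "\<dots> = v x"
      proof (cases "x \<in> K")
        case True
        then show ?thesis
          using sel[OF True] c[of "sel x" x] finT by simp
      next
        case False
        then show ?thesis
          using v by (simp add: Q_def)
      qed
      finally show "v x = (\<Sum>(\<tau>, i, j)\<in>T \<times> {..r} \<times> {..r}. fscale (c \<tau> i j) (e (\<tau>, i, j))) x"
        by simp
    qed
    also have "\<dots> \<in> fsp.span B0"
    proof (rule fsp.span_sum)
      fix t assume t: "t \<in> T \<times> {..r} \<times> {..r}"
      obtain \<tau> i j where "t = (\<tau>, i, j)"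
        by (metis surj_pair)
      then show "(case t of (\<tau>, i, j) \<Rightarrow> fscale (c \<tau> i j) (e (\<tau>, i, j))) \<in> fsp.span B0"
        using t by (auto simp: B0_def intro: fsp.span_scale[OF fsp.span_base])
    qed
    finally show "v \<in> fsp.span B0" .
  qed
  then show ?thesis
    using fsp_finite_basis[OF fin _ subspace_Q] that by blast
qed

end

context block
begin

section \<open>Discrete harmonic extension and normal flux\<close>
lemma edge_subset_frontier: "E edge_of K \<Longrightarrow> E \<subseteq> frontier K"
  using frontier_eq_Union_edges[OF rectK] by blast

lemma frontier_subset: "frontier K \<subseteq> K"
  using rect(2) by (rule frontier_subset_closed)

lemma frontier_ne: "frontier K \<noteq> {}"
  using rect(1,5) by (metis compact_eq_bounded_closed frontier_eq_empty not_bounded_UNIV)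

definition bdC :: "(pt \<Rightarrow> real) set"
  where "bdC = {g. continuous_on (frontier K) g}"

definition bdform :: "(pt \<Rightarrow> real) \<Rightarrow> (pt \<Rightarrow> real) \<Rightarrow> real"
  where "bdform g v = bd_integral K (\<lambda>x. g x * v x)"

lemma bdC_edge: "g \<in> bdC \<Longrightarrow> E edge_of K \<Longrightarrow> continuous_on E g"
  unfolding bdC_def using continuous_on_subset edge_subset_frontier by blast

lemma psd_form_bdform: "psd_form fscale bdC bdform"
proof unfold_locales
  show "fsp.subspace bdC"
    unfolding fsp.subspace_def bdC_def fscale_def plus_fun_def zero_fun_def
    by (auto intro!: continuous_intros)
  show "bdform (u + v) w = bdform u w + bdform v w" if "u \<in> bdC" "v \<in> bdC" "w \<in> bdC" for u v w
    unfolding bdform_def bd_integral_def sum.distrib[symmetric]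
  proof (rule sum.cong[OF refl])
    fix E assume "E \<in> {E. E edge_of K}"
    then have E: "is_edge E" and c: "continuous_on E u" "continuous_on E v" "continuous_on E w"
      using that rectK by (auto intro: is_edgeI bdC_edge)
    show "edge_integral E (\<lambda>x. (u + v) x * w x)
        = edge_integral E (\<lambda>x. u x * w x) + edge_integral E (\<lambda>x. v x * w x)"
      using c by (subst edge_integral_add[OF E, symmetric])
        (auto intro!: continuous_intros simp: distrib_right)
  qed
  show "bdform (fscale c u) v = c * bdform u v" for u v c
    unfolding bdform_def bd_integral_def sum_distrib_left
    by (intro sum.cong refl) (auto simp: mult.assoc edge_integral_cmult[OF is_edgeI[OF rectK]])
  show "bdform u v = bdform v u" for u v
    by (simp add: bdform_def mult.commute)
  show "0 \<le> bdform u u" for u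
    unfolding bdform_def bd_integral_def
    by (intro sum_nonneg edge_integral_nonneg) (auto intro: is_edgeI[OF rectK])
qed

sublocale B: psd_form fscale bdC bdform
  by (rule psd_form_bdform)

text \<open>
  This makes the boundary form definite on functions vanishing off the boundary, whence the
  uniqueness of the flux.
\<close>
lemma bdform_zero_imp:
  assumes g: "g \<in> bdC" "bdform g g = 0" and x: "x \<in> frontier K"
  shows "g x = 0"
proof -
  obtain E where E: "E edge_of K" "x \<in> E"
    using x frontier_eq_Union_edges[OF rectK] by blast
  have c: "continuous_on E (\<lambda>x. g x * g x)"
    using bdC_edge[OF g(1) E(1)] by (intro continuous_intros)
  have "\<forall>E\<in>{E. E edge_of K}. edge_integral E (\<lambda>x. g x * g x) = 0"
    using g(2) unfolding bdform_def bd_integral_def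
    by (subst (asm) sum_nonneg_eq_0_iff[OF finite_edges[OF rectK]])
      (auto intro: edge_integral_nonneg is_edgeI[OF rectK])
  then have "edge_integral E (\<lambda>x. g x * g x) = 0"
    using E by blast
  then have "g x * g x = 0"
    using edge_integral_zero_imp[OF is_edgeI[OF rectK E(1)] c _ _ E(2)] by simp
  then show ?thesis by simp
qed

definition restr :: "(pt \<Rightarrow> real) \<Rightarrow> pt \<Rightarrow> real"
  where "restr w = (\<lambda>x. if x \<in> frontier K then w x else 0)"

definition Wbd :: "(pt \<Rightarrow> real) set"
  where "Wbd = restr ` Q 2"

definition Q0 :: "(pt \<Rightarrow> real) set"
  where "Q0 = {z \<in> Q 2. \<forall>x\<in>frontier K. z x = 0}"

lemma restr_linear: "Vector_Spaces.linear fscale fscale restr"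
  by unfold_locales (auto simp: restr_def fun_eq_iff fscale_def algebra_simps)

lemma Wbd_span: obtains B where "finite B" "B \<subseteq> Wbd" "fsp.span B = Wbd"
proof -
  obtain B where B: "finite B" "B \<subseteq> Q 2" "fsp.span B = Q 2"
    using Q_finite_dim by blast
  interpret R: Vector_Spaces.linear fscale fscale restr
    by (rule restr_linear)
  have "fsp.span (restr ` B) = Wbd"
    using R.span_image B(3) by (simp add: Wbd_def)
  then show ?thesis
    using that[of "restr ` B"] B(1,2) by (auto simp: Wbd_def)
qed

lemma subspace_Wbd: "fsp.subspace Wbd"
  using Wbd_span fsp.subspace_span by metis

lemma Wbd_subset_bdC: "Wbd \<subseteq> bdC"
proof
  fix g assume "g \<in> Wbd"
  then obtain w where w: "w \<in> Q 2" "g = restr w"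
    by (auto simp: Wbd_def)
  then have "continuous_on (frontier K) w"
    using frontier_subset continuous_on_subset by (auto simp: Q_def)
  then have "continuous_on (frontier K) g"
    by (rule continuous_on_eq) (simp add: w restr_def)
  then show "g \<in> bdC"
    by (simp add: bdC_def)
qed

lemma Wbd_outside: "g \<in> Wbd \<Longrightarrow> x \<notin> frontier K \<Longrightarrow> g x = 0"
  by (auto simp: Wbd_def restr_def)

lemma Wbd_null: "g \<in> Wbd \<Longrightarrow> bdform g g = 0 \<Longrightarrow> g = 0"
  using bdform_zero_imp Wbd_subset_bdC Wbd_outside by (fastforce simp: fun_eq_iff)

lemma subspace_Q0: "fsp.subspace Q0"
  using subspace_Q[of 2] unfolding Q0_def fsp.subspace_def by auto

lemma Q2_null:
  assumes w: "w \<in> Q0" and z: "energy w w = 0"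
  shows "w = 0"
proof
  fix x
  obtain y where y: "y \<in> frontier K"
    using frontier_ne by blast
  have wQ: "w \<in> Q 2"
    using w by (simp add: Q0_def)
  have "w x = w y" if "x \<in> K"
    using energy_zero_imp_constant[OF subsetD[OF Q_subset_H wQ] z that] y frontier_subset by blast
  then show "w x = 0 x"
    using w y wQ by (cases "x \<in> K") (auto simp: Q0_def Q_def)
qed

definition is_hext :: "(pt \<Rightarrow> real) \<Rightarrow> (pt \<Rightarrow> real) \<Rightarrow> bool"
  where "is_hext v w \<longleftrightarrow> w \<in> Q 2 \<and> (\<forall>x\<in>frontier K. w x = v x) \<and> (\<forall>z\<in>Q0. energy w z = 0)"

lemma Q0_H: "Q0 \<subseteq> H" and Q2_H: "Q 2 \<subseteq> H"
  using Q_subset_H by (auto simp: Q0_def)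

lemma hext_unique:
  assumes "is_hext v w" "is_hext v w'"
  shows "w = w'"
proof -
  have Q2: "w \<in> Q 2" "w' \<in> Q 2"
    using assms by (auto simp: is_hext_def)
  then have d: "w - w' \<in> Q0"
    using assms fsp.subspace_diff[OF subspace_Q] by (auto simp: is_hext_def Q0_def)
  have "energy (w - w') (w - w') = energy w (w - w') - energy w' (w - w')"
    using Q2 d Q0_H Q2_H by (intro E.diff_left) auto
  also have "\<dots> = 0"
    using assms d by (simp add: is_hext_def)
  finally have "w - w' = 0"
    using Q2_null d by blast
  then show ?thesis by simp
qed

text \<open>
  Correct an arbitrary extension by its energy projection onto the functions vanishing on the
  boundary.
\<close>
lemma hext_exists:
  assumes "v \<in> Wbd"
  shows "\<exists>w. is_hext v w"
proof -
  obtain w0 where w0: "w0 \<in> Q 2" "v = restr w0"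
    using assms by (auto simp: Wbd_def)
  obtain B0 where B0: "finite B0" "B0 \<subseteq> Q 2" "fsp.span B0 = Q 2"
    using Q_finite_dim by blast
  have "Q0 \<subseteq> fsp.span B0"
    using B0(3) by (auto simp: Q0_def)
  then obtain B where B: "finite B" "B \<subseteq> Q0" "fsp.span B = Q0"
    using fsp_finite_basis[OF B0(1) _ subspace_Q0] by blast
  have "B \<subseteq> H"
    using B(2) Q0_H by blast
  then obtain p where p: "p \<in> Q0" "\<forall>z\<in>Q0. energy (w0 - p) z = 0"
    using E.projection[OF B(1) _ subsetD[OF Q2_H w0(1)]] B(3) by blast
  have "w0 - p \<in> Q 2"
    using p(1) w0(1) fsp.subspace_diff[OF subspace_Q] by (auto simp: Q0_def)
  then have "is_hext v (w0 - p)"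
    using p w0 by (auto simp: is_hext_def Q0_def restr_def)
  then show ?thesis by blast
qed

definition hext :: "(pt \<Rightarrow> real) \<Rightarrow> pt \<Rightarrow> real"
  where "hext v = (THE w. is_hext v w)"

lemma hext_eq: "is_hext v w \<Longrightarrow> hext v = w"
  unfolding hext_def using hext_unique by blast

lemma is_hext_hext: "v \<in> Wbd \<Longrightarrow> is_hext v (hext v)"
  using hext_exists hext_eq by metis

lemma hext_H: "v \<in> Wbd \<Longrightarrow> hext v \<in> H"
  using is_hext_hext Q2_H unfolding is_hext_def by blast

lemma hext_add:
  assumes "u \<in> Wbd" "v \<in> Wbd"
  shows "hext (u + v) = hext u + hext v"
proof (rule hext_eq)
  note h = assms[THEN is_hext_hext]
  show "is_hext (u + v) (hext u + hext v)"
    unfolding is_hext_def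
  proof (intro conjI ballI)
    show "hext u + hext v \<in> Q 2"
      using h fsp.subspace_add[OF subspace_Q] by (simp add: is_hext_def)
    show "(hext u + hext v) x = (u + v) x" if "x \<in> frontier K" for x
      using h that by (simp add: is_hext_def)
    show "energy (hext u + hext v) z = 0" if "z \<in> Q0" for z
      using h that Q0_H assms[THEN hext_H] by (simp add: E.add_left subset_iff is_hext_def)
  qed
qed

lemma hext_scale:
  assumes "u \<in> Wbd"
  shows "hext (fscale c u) = fscale c (hext u)"
proof (rule hext_eq)
  note h = assms[THEN is_hext_hext]
  show "is_hext (fscale c u) (fscale c (hext u))"
    unfolding is_hext_def
  proof (intro conjI ballI)
    show "fscale c (hext u) \<in> Q 2"
      using h fsp.subspace_scale[OF subspace_Q] by (simp add: is_hext_def)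
    show "fscale c (hext u) x = fscale c u x" if "x \<in> frontier K" for x
      using h that by (simp add: is_hext_def)
    show "energy (fscale c (hext u)) z = 0" if "z \<in> Q0" for z
      using h that Q0_H assms[THEN hext_H] by (simp add: E.scale_left subset_iff is_hext_def)
  qed
qed

definition is_flux :: "(pt \<Rightarrow> real) \<Rightarrow> (pt \<Rightarrow> real) \<Rightarrow> bool"
  where "is_flux u g \<longleftrightarrow> g \<in> Wbd \<and> (\<forall>v\<in>Wbd. bdform g v = energy u (hext v))"

lemma flux_unique:
  assumes "is_flux u g" "is_flux u g'"
  shows "g = g'"
proof -
  have cutoff: "g \<in> Wbd" "g' \<in> Wbd"
    using assms by (auto simp: is_flux_def)
  then have d: "g - g' \<in> Wbd"
    using fsp.subspace_diff[OF subspace_Wbd] by blast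
  have "bdform (g - g') (g - g') = bdform g (g - g') - bdform g' (g - g')"
    using cutoff d Wbd_subset_bdC by (intro B.diff_left) auto
  also have "\<dots> = 0"
    using assms d by (simp add: is_flux_def)
  finally have "g - g' = 0"
    using Wbd_null d by blast
  then show ?thesis by simp
qed

text \<open>
  Riesz representation for the boundary form, on the finitely generated space of boundary values.
\<close>
lemma flux_exists:
  assumes u: "u \<in> H"
  shows "\<exists>g. is_flux u g"
proof -
  obtain B where B: "finite B" "B \<subseteq> Wbd" "fsp.span B = Wbd"
    using Wbd_span by blast
  have "\<exists>g\<in>fsp.span B. \<forall>v\<in>fsp.span B. bdform g v = energy u (hext v)"
  proof (rule B.riesz[OF B(1)])
    show "B \<subseteq> bdC"
      using B(2) Wbd_subset_bdC by blast
    show "energy u (hext (v + w)) = energy u (hext v) + energy u (hext w)"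
      if "v \<in> fsp.span B" "w \<in> fsp.span B" for v w
      using that u by (simp add: B(3) hext_add E.add_right hext_H)
    show "energy u (hext (fscale c v)) = c * energy u (hext v)" if "v \<in> fsp.span B" for c v
      using that u by (simp add: B(3) hext_scale E.scale_right hext_H)
    show "energy u (hext v) = 0" if "v \<in> fsp.span B" "bdform v v = 0" for v
    proof -
      have v: "v \<in> Wbd"
        using that B(3) by simp
      then have "v = fscale 0 v"
        using Wbd_null that(2) by (simp add: fun_eq_iff)
      then have "hext v = fscale 0 (hext v)"
        using hext_scale[OF v, of 0] by metis
      then show ?thesis
        using E.scale_right[OF u hext_H[OF v], of 0] by simp
    qed
  qed
  then show ?thesis
    unfolding is_flux_def B(3) by blast
qed

definition bflux :: "(pt \<Rightarrow> real) \<Rightarrow> pt \<Rightarrow> real"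
  where "bflux u = (THE g. is_flux u g)"

lemma bflux_eq: "is_flux u g \<Longrightarrow> bflux u = g"
  unfolding bflux_def using flux_unique by blast

lemma is_flux_bflux: "u \<in> H \<Longrightarrow> is_flux u (bflux u)"
  using flux_exists bflux_eq by metis

lemma bflux_Wbd: "u \<in> H \<Longrightarrow> bflux u \<in> Wbd"
  using is_flux_bflux by (simp add: is_flux_def)

lemma bflux_continuous: "u \<in> H \<Longrightarrow> continuous_on (frontier K) (bflux u)"
  using bflux_Wbd Wbd_subset_bdC by (auto simp: bdC_def)

lemma bflux_add:
  assumes "u \<in> H" "v \<in> H"
  shows "bflux (u + v) = bflux u + bflux v"
proof (rule bflux_eq)
  note h = assms[THEN is_flux_bflux]
  show "is_flux (u + v) (bflux u + bflux v)"
    unfolding is_flux_def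
  proof (intro conjI ballI)
    show "bflux u + bflux v \<in> Wbd"
      using assms[THEN bflux_Wbd] fsp.subspace_add[OF subspace_Wbd] by simp
    show "bdform (bflux u + bflux v) w = energy (u + v) (hext w)" if "w \<in> Wbd" for w
      using h that assms[THEN bflux_Wbd] Wbd_subset_bdC assms hext_H[OF that]
      by (simp add: E.add_left B.add_left subset_iff is_flux_def)
  qed
qed

lemma bflux_scale:
  assumes "u \<in> H"
  shows "bflux (fscale c u) = fscale c (bflux u)"
proof (rule bflux_eq)
  note h = assms[THEN is_flux_bflux]
  show "is_flux (fscale c u) (fscale c (bflux u))"
    unfolding is_flux_def
  proof (intro conjI ballI)
    show "fscale c (bflux u) \<in> Wbd"
      using assms[THEN bflux_Wbd] fsp.subspace_scale[OF subspace_Wbd] by simp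
    show "bdform (fscale c (bflux u)) w = energy (fscale c u) (hext w)" if "w \<in> Wbd" for w
      using h that assms[THEN bflux_Wbd] Wbd_subset_bdC assms hext_H[OF that]
      by (simp add: E.scale_left B.scale_left subset_iff is_flux_def)
  qed
qed

text \<open>
  Testing the definition of the flux \<open>F\<close> with \<open>F\<close> itself gives
  \<open>bdform F F = energy u (hext F)\<close>; apply the Cauchy--Schwarz inequality and the inverse inequality to
  the extension of \<open>F\<close>.
\<close>
lemma bflux_bound:
  assumes u: "u \<in> H" and c: "0 \<le> c"
    and inv: "\<And>v. v \<in> Wbd \<Longrightarrow> energy (hext v) (hext v) \<le> c * bdform v v"
  shows "bdform (bflux u) (bflux u) \<le> c * energy u u"
proof -
  define F where "F = bflux u"
  define X where "X = bdform F F"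
  have F: "F \<in> Wbd" "X = energy u (hext F)"
    using is_flux_bflux[OF u] by (auto simp: F_def X_def is_flux_def)
  have X0: "0 \<le> X"
    unfolding X_def using F Wbd_subset_bdC by (intro B.nonneg) auto
  have "X\<^sup>2 \<le> energy u u * energy (hext F) (hext F)"
    unfolding F(2) by (rule E.cauchy_schwarz[OF u hext_H[OF F(1)]])
  also have "\<dots> \<le> energy u u * (c * X)"
    using inv[OF F(1)] E.nonneg[OF u] unfolding X_def by (rule mult_left_mono)
  finally have "X * X \<le> X * (c * energy u u)"
    by (simp add: power2_eq_square algebra_simps)
  then show ?thesis
    using X0 c E.nonneg[OF u] unfolding F_def[symmetric] X_def[symmetric]
    by (cases "X = 0") auto
qed

end

section \<open>Rectangular meshes\<close>
text \<open>
  In coordinates, the unit normal of an edge \<open>x $ i = c\<close> is one of the two unit vectors of the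
  direction \<open>i\<close>, and it points out of the rectangle exactly if its sign agrees with the side on which
  the edge lies.
\<close>
lemma edge_coordinates:
  assumes K: "rectangle K" and E: "E edge_of K" and n: "norm n = 1"
    and orth: "\<forall>x\<in>E. \<forall>y\<in>E. (x - y) \<bullet> n = 0"
  obtains a b i j c where "K = cbox a b" "box a b \<noteq> {}" "j \<noteq> i" "\<forall>k. k = i \<or> k = j"
    "c = a $ i \<or> c = b $ i" "E = {x \<in> cbox a b. x $ i = c}" "n $ j = 0" "n $ i \<noteq> 0"
    "points_out K E n \<longleftrightarrow> (c = b $ i \<longleftrightarrow> n $ i > 0)"
proof -
  obtain a b where ab: "K = cbox a b" "box a b \<noteq> {}"
    using K by (auto simp: rectangle_def)
  obtain i c where c: "c = a $ i \<or> c = b $ i" and Ei: "E = {x \<in> cbox a b. x $ i = c}"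
    using E ab edge_of_cbox_iff by blast
  obtain j where j: "j \<noteq> i" "\<forall>l. l = i \<or> l = j"
    using two_indices by blast
  note all2 = all_two_indices[OF j(2)]
  have lt: "a $ k < b $ k" for k
    using ab by (simp add: interval_ne_empty_cart(2))
  define p where "p s t = (\<chi> k. if k = i then s else t)" for s t :: real
  have p[simp]: "p s t $ i = s" "p s t $ j = t" for s t
    using j by (auto simp: p_def)
  have cb: "x \<in> cbox a b \<longleftrightarrow> (a $ i \<le> x $ i \<and> x $ i \<le> b $ i) \<and> a $ j \<le> x $ j \<and> x $ j \<le> b $ j" for x
    unfolding mem_box_cart(2) by (rule all2)
  have pE: "p c t \<in> E" if "a $ j \<le> t" "t \<le> b $ j" for t
    unfolding Ei using that c lt[of i] by (auto simp: cb)
  have "(p c (b $ j) - p c (a $ j)) \<bullet> n = 0"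
    using orth pE lt[of j] by simp
  then have nj: "n $ j = 0"
    using lt[of j] by (simp add: inner_two_indices[OF j(2,1)])
  have ni: "n $ i \<noteq> 0"
  proof
    assume "n $ i = 0"
    then have "n \<bullet> n = 0"
      using nj by (simp add: inner_two_indices[OF j(2,1)])
    then show False using n by simp
  qed
  have diff: "(x - y) \<bullet> n = (x $ i - c) * n $ i" if "y \<in> E" for x y
    using that nj by (simp add: inner_two_indices[OF j(2,1)] Ei)
  have out: "points_out K E n \<longleftrightarrow> (\<forall>x\<in>K. (x $ i - c) * n $ i \<le> 0)"
    unfolding points_out_def using diff pE[of "a $ j"] lt[of j] by auto
  have "points_out K E n \<longleftrightarrow> (c = b $ i \<longleftrightarrow> n $ i > 0)"
  proof (cases "c = b $ i")
    case True
    have "points_out K E n \<longleftrightarrow> n $ i > 0"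
    proof
      assume "points_out K E n"
      moreover have "p (a $ i) (a $ j) \<in> K"
        unfolding ab(1) cb using lt[of i] lt[of j] by simp
      ultimately have "(a $ i - b $ i) * n $ i \<le> 0"
        using out True p(1) by metis
      then show "n $ i > 0"
        using lt[of i] ni by (simp add: mult_le_0_iff)
    next
      assume "n $ i > 0"
      then show "points_out K E n"
        unfolding out True by (auto simp: ab(1) cb mult_le_0_iff)
    qed
    then show ?thesis using True by simp
  next
    case False
    then have ca: "c = a $ i" using c by simp
    have "points_out K E n \<longleftrightarrow> \<not> n $ i > 0"
    proof
      assume "points_out K E n"
      moreover have "p (b $ i) (a $ j) \<in> K"
        unfolding ab(1) cb using lt[of i] lt[of j] by simp
      ultimately have "(b $ i - a $ i) * n $ i \<le> 0"
        using out ca p(1) by metis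
      then show "\<not> n $ i > 0"
        using lt[of i] ni by (simp add: mult_le_0_iff)
    next
      assume "\<not> n $ i > 0"
      then show "points_out K E n"
        unfolding out ca by (auto simp: ab(1) cb mult_le_0_iff)
    qed
    then show ?thesis using False by simp
  qed
  then show ?thesis
    using that ab j c Ei nj ni by blast
qed

text \<open>
  Two rectangles on the same side of a common edge share a strip along it. This is what makes the
  two blocks of an edge unique.
\<close>
lemma same_side_interiors_meet:
  assumes K: "rectangle K" "E edge_of K" and K': "rectangle K'" "E edge_of K'" and n: "norm n = 1"
    and orth: "\<forall>x\<in>E. \<forall>y\<in>E. (x - y) \<bullet> n = 0"
    and side: "points_out K E n \<longleftrightarrow> points_out K' E n"
  shows "interior K \<inter> K' \<noteq> {}"
proof -
  obtain a b i j c where 1: "K = cbox a b" "box a b \<noteq> {}" "j \<noteq> i" "\<forall>k. k = i \<or> k = j"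
    "c = a $ i \<or> c = b $ i" "E = {x \<in> cbox a b. x $ i = c}" "n $ j = 0" "n $ i \<noteq> 0"
    "points_out K E n \<longleftrightarrow> (c = b $ i \<longleftrightarrow> n $ i > 0)"
    using edge_coordinates[OF K n orth] .
  obtain a' b' i' j' c' where 2: "K' = cbox a' b'" "box a' b' \<noteq> {}" "j' \<noteq> i'" "\<forall>k. k = i' \<or> k = j'"
    "c' = a' $ i' \<or> c' = b' $ i'" "E = {x \<in> cbox a' b'. x $ i' = c'}" "n $ j' = 0" "n $ i' \<noteq> 0"
    "points_out K' E n \<longleftrightarrow> (c' = b' $ i' \<longleftrightarrow> n $ i' > 0)"
    using edge_coordinates[OF K' n orth] .
  have [simp]: "i' = i"
    using 1(4)[rule_format, of i'] 1(7) 2(8) by auto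
  have lt: "a $ k < b $ k" "a' $ k < b' $ k" for k
    using 1(2) 2(2) by (simp_all add: interval_ne_empty_cart(2))
  define p where "p s t = (\<chi> k. if k = i then s else t)" for s t :: real
  have p[simp]: "p s t $ i = s" "p s t $ j = t" for s t
    using 1(3) by (auto simp: p_def)
  have cb: "x \<in> cbox l r \<longleftrightarrow> (l $ i \<le> x $ i \<and> x $ i \<le> r $ i) \<and> l $ j \<le> x $ j \<and> x $ j \<le> r $ j" for l r x :: pt
    unfolding mem_box_cart(2) by (rule all_two_indices[OF 1(4)])
  have bx: "x \<in> box l r \<longleftrightarrow> (l $ i < x $ i \<and> x $ i < r $ i) \<and> l $ j < x $ j \<and> x $ j < r $ j" for l r x :: pt
    unfolding mem_box_cart(1) by (rule all_two_indices[OF 1(4)])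
  have pE: "p c t \<in> E" if "a $ j \<le> t" "t \<le> b $ j" for t
    unfolding 1(6) using that 1(5) lt(1)[of i] by (auto simp: cb)
  have "p c (a $ j) \<in> E" "p c (b $ j) \<in> E"
    using pE lt(1)[of j] by simp_all
  then have 3: "c' = c" "a' $ j \<le> a $ j" "b $ j \<le> b' $ j"
    unfolding 2(6) by (simp_all add: cb)
  have sides: "c = b $ i \<longleftrightarrow> c = b' $ i"
    using side 1(9) 2(9) 3 by auto
  \<comment> \<open>Halfway between the edge and the nearer one of the two opposite edges.\<close>
  define s where "s = (if c = b $ i then (max (a $ i) (a' $ i) + c) / 2 else (min (b $ i) (b' $ i) + c) / 2)"
  define x where "x = p s ((a $ j + b $ j) / 2)"
  have "x \<in> box a b \<and> x \<in> cbox a' b'"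
  proof (cases "c = b $ i")
    case True
    then show ?thesis
      using lt(1)[of i] lt(2)[of i] lt(1)[of j] 3 sides unfolding bx cb x_def s_def
      by (auto simp: max_def field_simps)
  next
    case False
    then have "c = a $ i" "c = a' $ i"
      using 1(5) 2(5) 3 sides by auto
    then show ?thesis
      using False lt(1)[of i] lt(2)[of i] lt(1)[of j] 3 unfolding bx cb x_def s_def
      by (auto simp: min_def field_simps)
  qed
  then show ?thesis
    unfolding 1(1) 2(1) by (auto simp: interior_cbox)
qed

locale dg_mesh =
  fixes P :: dg_data
  assumes region: "rectangle (region P)"
    and coarse: "rect_mesh (region P) (coarse_mesh P)"
    and fine: "rect_mesh (region P) (fine_mesh P)" "mesh_refines (fine_mesh P) (coarse_mesh P)"
    and normals: "edge_normals P"
begin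

lemma finite_coarse: "finite (coarse_mesh P)"
  and coarse_rectangle: "K \<in> coarse_mesh P \<Longrightarrow> rectangle K"
  and Union_coarse: "\<Union>(coarse_mesh P) = region P"
  and coarse_face: "\<lbrakk>K \<in> coarse_mesh P; K' \<in> coarse_mesh P\<rbrakk> \<Longrightarrow> (K \<inter> K') face_of K"
  using coarse by (auto simp: rect_mesh_def)

lemma coarse_subset: "K \<in> coarse_mesh P \<Longrightarrow> K \<subseteq> region P"
  using Union_coarse by blast

lemmas coarse_props = rectangle_props[OF coarse_rectangle]

text \<open>
  The intersection of two blocks is a face of both; a proper face avoids the interior.
\<close>
lemma interior_block_disjoint:
  assumes K: "K \<in> coarse_mesh P" and K': "K' \<in> coarse_mesh P" and ne: "K \<noteq> K'"
  shows "interior K \<inter> K' = {}"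
proof (cases "K \<inter> K' = K")
  case False
  then show ?thesis
    using face_of_disjoint_interior[OF coarse_face[OF K K']] interior_subset by blast
next
  case True
  then have "K face_of K'"
    using coarse_face[OF K' K] by (simp add: Int_commute)
  then have "K \<inter> interior K' = {}"
    using ne by (rule face_of_disjoint_interior)
  moreover have "interior K \<subseteq> interior K'"
    using True by (intro interior_mono) auto
  ultimately show ?thesis
    using coarse_props(6)[OF K] interior_subset by blast
qed

definition fine_in :: "pt set \<Rightarrow> pt set set"
  where "fine_in K = {\<tau> \<in> fine_mesh P. \<tau> \<subseteq> K}"

text \<open>
  A fine cell meeting the interior of \<open>K\<close> lies in some block, which can only be \<open>K\<close>; closing up
  covers the rest of \<open>K\<close>.
\<close>
lemma Union_fine_in:
  assumes K: "K \<in> coarse_mesh P"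
  shows "\<Union>(fine_in K) = K"
proof
  show "\<Union>(fine_in K) \<subseteq> K"
    by (auto simp: fine_in_def)
  have fin: "finite (fine_in K)" and rect: "\<And>\<tau>. \<tau> \<in> fine_in K \<Longrightarrow> rectangle \<tau>"
    using fine(1) by (auto simp: fine_in_def rect_mesh_def)
  have cl: "closed (\<Union>(fine_in K))"
    using fin rect rectangle_props(2) by (intro closed_Union) auto
  have "interior K \<subseteq> \<Union>(fine_in K)"
  proof
    fix x assume x: "x \<in> interior K"
    then have "x \<in> region P"
      using interior_subset coarse_subset[OF K] by blast
    then obtain \<tau> where \<tau>: "\<tau> \<in> fine_mesh P" "x \<in> \<tau>"
      using fine(1) unfolding rect_mesh_def by blast
    then obtain K' where K': "K' \<in> coarse_mesh P" "\<tau> \<subseteq> K'"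
      using fine(2) by (auto simp: mesh_refines_def)
    then have "K' = K"
      using interior_block_disjoint[OF K K'(1)] x \<tau> by blast
    then show "x \<in> \<Union>(fine_in K)"
      using \<tau> K' by (auto simp: fine_in_def)
  qed
  then have "closure (interior K) \<subseteq> \<Union>(fine_in K)"
    using cl closure_minimal by blast
  then show "K \<subseteq> \<Union>(fine_in K)"
    using coarse_props(7)[OF K] by simp
qed

text \<open>
  The intersection of the two blocks is a proper face of \<open>K\<close> which contains a relative interior
  point of \<open>E\<close>, hence all of \<open>E\<close>, and its dimension leaves no room for more.
\<close>
lemma edge_meets_block:
  assumes K: "K \<in> coarse_mesh P" and E: "E edge_of K" and y: "y \<in> rel_interior E"
    and K': "K' \<in> coarse_mesh P" "K' \<noteq> K" and yK': "y \<in> K'"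
  shows "E = K \<inter> K'" "E edge_of K'"
proof -
  define F where "F = K \<inter> K'"
  have F: "F face_of K" "F face_of K'"
    unfolding F_def using coarse_face[OF K K'(1)] coarse_face[OF K'(1) K] by (simp_all add: Int_commute)
  have EK: "E face_of K" "aff_dim E = 1"
    using E by (auto simp: edge_of_def)
  have sub: "E \<subseteq> K"
    using EK face_of_imp_subset by blast
  have "y \<in> F"
    using y rel_interior_subset sub yK' by (auto simp: F_def)
  then have EF: "E \<subseteq> F"
    using subset_of_face_of[OF F(1) sub] y by blast
  have "F \<noteq> K"
    using interior_block_disjoint[OF K K'(1)] K'(2) coarse_props(6)[OF K] interior_subset
    by (fastforce simp: F_def)
  then have "aff_dim F < 2"
    using face_of_aff_dim_lt[OF coarse_props(3)[OF K] F(1)] coarse_props(11)[OF K] by simp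
  moreover have "E face_of F"
    using EK(1) EF face_of_imp_subset[OF F(1)] by (rule face_of_subset)
  moreover have "convex F"
    using F(1) face_of_imp_convex coarse_props(3)[OF K] by blast
  ultimately have "E = F"
    using face_of_aff_dim_lt[of F E] EK(2) by fastforce
  then show "E = K \<inter> K'" "E edge_of K'"
    using F EK by (auto simp: F_def edge_of_def)
qed

text \<open>
  The blocks outside \<open>S\<close> are finitely many closed sets; if all of them missed \<open>y\<close>, then \<open>\<Union>S\<close> would
  contain a neighborhood of \<open>y\<close>.
\<close>
lemma uncovered_point:
  assumes y: "y \<in> interior (region P)" and S: "y \<notin> interior (\<Union>S)"
  shows "\<exists>K\<in>coarse_mesh P - S. y \<in> K"
proof (rule ccontr)
  assume no: "\<not> ?thesis"
  define U where "U = interior (region P) - \<Union>(coarse_mesh P - S)"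
  have "closed (\<Union>(coarse_mesh P - S))"
    using finite_coarse coarse_props(2) by (intro closed_Union) auto
  then have "open U"
    unfolding U_def by (intro open_Diff) auto
  moreover have "U \<subseteq> \<Union>S"
  proof
    fix x assume x: "x \<in> U"
    then have "x \<in> region P"
      using interior_subset by (auto simp: U_def)
    then obtain K where "K \<in> coarse_mesh P" "x \<in> K"
      using Union_coarse by blast
    then show "x \<in> \<Union>S"
      using x by (auto simp: U_def)
  qed
  ultimately have "U \<subseteq> interior (\<Union>S)"
    by (rule interior_maximal[rotated])
  moreover have "y \<in> U"
    using y no by (auto simp: U_def)
  ultimately show False
    using S by blast
qed

lemma edge_rel_interior_ne:
  assumes "E edge_of K" "K \<in> coarse_mesh P"
  obtains y where "y \<in> rel_interior E"
proof -
  have "convex E"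
    using assms coarse_props(3) face_of_imp_convex unfolding edge_of_def by blast
  moreover have "E \<noteq> {}"
    using assms by (auto simp: edge_of_def)
  ultimately show ?thesis
    using that rel_interior_eq_empty by blast
qed

lemma rel_interior_edge_inside:
  assumes K: "K \<in> coarse_mesh P" and E: "E edge_of K" and int: "\<not> E \<subseteq> frontier (region P)"
    and y: "y \<in> rel_interior E"
  shows "y \<in> interior (region P)"
proof (rule ccontr)
  assume no: "y \<notin> interior (region P)"
  have sub: "E \<subseteq> region P"
    using E edge_of_imp_subset coarse_subset[OF K] by blast
  then have "y \<in> frontier (region P)"
    using no y sub rel_interior_subset closure_subset unfolding frontier_def by blast
  then obtain G where G: "G edge_of region P" "y \<in> G"
    using frontier_eq_Union_edges[OF region] by blast
  then have "E \<subseteq> G"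
    using subset_of_face_of[OF _ sub] y by (auto simp: edge_of_def)
  then show False
    using int G frontier_eq_Union_edges[OF region] by blast
qed

lemma neighbor_exists:
  assumes K: "K \<in> coarse_mesh P" and E: "E edge_of K" and int: "\<not> E \<subseteq> frontier (region P)"
  shows "\<exists>K'\<in>coarse_mesh P. K' \<noteq> K \<and> E = K \<inter> K' \<and> E edge_of K'"
proof -
  obtain y where y: "y \<in> rel_interior E"
    using edge_rel_interior_ne[OF E K] .
  have "y \<in> interior (region P)"
    by (rule rel_interior_edge_inside[OF K E int y])
  moreover have "y \<notin> interior (\<Union>{K})"
    using y rel_interior_subset E frontier_eq_Union_edges[OF coarse_rectangle[OF K]]
    by (fastforce simp: frontier_def)
  ultimately obtain K' where "K' \<in> coarse_mesh P" "K' \<noteq> K" "y \<in> K'"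
    using uncovered_point by blast
  then show ?thesis
    using edge_meets_block[OF K E y] by blast
qed

lemma edge_normal_props:
  assumes "E \<in> edges P"
  shows "norm (edge_normal P E) = 1" "\<forall>x\<in>E. \<forall>y\<in>E. (x - y) \<bullet> edge_normal P E = 0"
    "E \<subseteq> frontier (region P) \<Longrightarrow> points_out (region P) E (edge_normal P E)"
  using normals assms by (auto simp: edge_normals_def)

lemma edgesI: "K \<in> coarse_mesh P \<Longrightarrow> E edge_of K \<Longrightarrow> E \<in> edges P"
  by (auto simp: edges_def)

lemma same_side_unique:
  assumes "K \<in> coarse_mesh P" "E edge_of K" "K' \<in> coarse_mesh P" "E edge_of K'"
    and "points_out K E (edge_normal P E) \<longleftrightarrow> points_out K' E (edge_normal P E)"
  shows "K = K'"
proof (rule ccontr)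
  assume ne: "K \<noteq> K'"
  note n = edge_normal_props[OF edgesI[OF assms(1,2)]]
  have "interior K \<inter> K' \<noteq> {}"
    using assms n by (intro same_side_interiors_meet[of K E K'] coarse_rectangle) auto
  then show False
    using interior_block_disjoint[OF assms(1,3) ne] by blast
qed

lemma boundary_edge:
  assumes E: "E \<in> edges P" "E \<subseteq> frontier (region P)"
  shows "plus_block P E \<in> coarse_mesh P" "E edge_of plus_block P E"
    "points_out (plus_block P E) E (edge_normal P E)"
proof -
  obtain K where K: "K \<in> coarse_mesh P" "E edge_of K"
    using E by (auto simp: edges_def)
  have out: "points_out K E (edge_normal P E)"
    using edge_normal_props(3)[OF E] coarse_subset[OF K(1)] by (auto simp: points_out_def)
  have "plus_block P E = K"
    unfolding plus_block_def using K out same_side_unique by (intro the_equality) auto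
  then show "plus_block P E \<in> coarse_mesh P" "E edge_of plus_block P E"
    "points_out (plus_block P E) E (edge_normal P E)"
    using K out by auto
qed

lemma interior_edge:
  assumes E: "E \<in> edges P" "\<not> E \<subseteq> frontier (region P)"
  shows "plus_block P E \<in> coarse_mesh P" "E edge_of plus_block P E"
    "points_out (plus_block P E) E (edge_normal P E)"
    "minus_block P E \<in> coarse_mesh P" "E edge_of minus_block P E"
    "\<not> points_out (minus_block P E) E (edge_normal P E)"
proof -
  let ?out = "\<lambda>K. points_out K E (edge_normal P E)"
  obtain K where K: "K \<in> coarse_mesh P" "E edge_of K"
    using E by (auto simp: edges_def)
  obtain K' where K': "K' \<in> coarse_mesh P" "K' \<noteq> K" "E edge_of K'"
    using neighbor_exists[OF K E(2)] by blast
  have "?out K \<noteq> ?out K'"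
    using same_side_unique[OF K K'(1,3)] K'(2) by blast
  then obtain K1 K2 where 12: "K1 \<in> coarse_mesh P" "E edge_of K1" "?out K1"
    "K2 \<in> coarse_mesh P" "E edge_of K2" "\<not> ?out K2"
    using K K' by metis
  have "plus_block P E = K1"
    unfolding plus_block_def using 12 same_side_unique by (intro the_equality) auto
  moreover have "minus_block P E = K2"
    unfolding minus_block_def using 12 same_side_unique by (intro the_equality) auto
  ultimately show "plus_block P E \<in> coarse_mesh P" "E edge_of plus_block P E"
    "points_out (plus_block P E) E (edge_normal P E)"
    "minus_block P E \<in> coarse_mesh P" "E edge_of minus_block P E"
    "\<not> points_out (minus_block P E) E (edge_normal P E)"
    using 12 by auto
qed

lemma plus_block:
  assumes "E \<in> edges P"
  shows "plus_block P E \<in> coarse_mesh P" "E edge_of plus_block P E"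
    "points_out (plus_block P E) E (edge_normal P E)"
  using assms boundary_edge interior_edge by blast+

lemma plus_minus_distinct:
  assumes "E \<in> edges P" "\<not> E \<subseteq> frontier (region P)"
  shows "plus_block P E \<noteq> minus_block P E"
  using interior_edge[OF assms] by auto

lemma edge_blocks:
  assumes E: "E \<in> edges P" "\<not> E \<subseteq> frontier (region P)" and K: "K \<in> coarse_mesh P" "E edge_of K"
  shows "K = plus_block P E \<or> K = minus_block P E"
  using same_side_unique[OF K] interior_edge[OF E] by metis

text \<open>
  Otherwise a third block would have the same edge, on the side of one of the two.
\<close>
lemma edge_interior_two_blocks:
  assumes E: "E \<in> edges P" "\<not> E \<subseteq> frontier (region P)"
  shows "rel_interior E \<subseteq> interior (plus_block P E \<union> minus_block P E)"
proof
  note b = interior_edge[OF E]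
  fix y assume y: "y \<in> rel_interior E"
  show "y \<in> interior (plus_block P E \<union> minus_block P E)"
  proof (rule ccontr)
    assume "y \<notin> interior (plus_block P E \<union> minus_block P E)"
    then have "y \<notin> interior (\<Union>{plus_block P E, minus_block P E})"
      by simp
    then obtain K where K: "K \<in> coarse_mesh P" "K \<noteq> plus_block P E" "K \<noteq> minus_block P E" "y \<in> K"
      using uncovered_point[OF rel_interior_edge_inside[OF b(1,2) E(2) y]] by blast
    then have "E edge_of K"
      using edge_meets_block[OF b(1,2) y] by blast
    then show False
      using edge_blocks[OF E K(1)] K by blast
  qed
qed

section \<open>Neighborhoods of coarse nodes\<close>
lemma edge_is_edge: "E \<in> edges P \<Longrightarrow> is_edge E"
  using coarse_rectangle by (auto simp: edges_def intro: is_edgeI)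

lemma finite_edges_P: "finite (edges P)"
proof -
  have "edges P = (\<Union>K\<in>coarse_mesh P. {E. E edge_of K})"
    by (auto simp: edges_def)
  then show ?thesis
    using finite_coarse finite_edges coarse_rectangle by auto
qed

lemma omega_blocks_eq: "omega_blocks P z = {K \<in> coarse_mesh P. z \<in> vertices K}"
proof
  show "{K \<in> coarse_mesh P. z \<in> vertices K} \<subseteq> omega_blocks P z"
    by (auto simp: omega_blocks_def omega_def)
  show "omega_blocks P z \<subseteq> {K \<in> coarse_mesh P. z \<in> vertices K}"
  proof
    fix K assume "K \<in> omega_blocks P z"
    then have K: "K \<in> coarse_mesh P" "K \<subseteq> omega P z"
      by (auto simp: omega_blocks_def)
    obtain x where x: "x \<in> interior K"
      using coarse_props(6)[OF K(1)] by blast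
    then obtain K' where K': "K' \<in> coarse_mesh P" "z \<in> vertices K'" "x \<in> K'"
      using K(2) interior_subset unfolding omega_def by blast
    then have "K = K'"
      using interior_block_disjoint[OF K(1) K'(1)] x by blast
    then show "K \<in> {K \<in> coarse_mesh P. z \<in> vertices K}"
      using K' by simp
  qed
qed

lemma omega_eq: "omega P z = \<Union>(omega_blocks P z)"
  by (simp add: omega_blocks_eq omega_def)

lemma omega_blocks_coarse: "K \<in> omega_blocks P z \<Longrightarrow> K \<in> coarse_mesh P"
  by (simp add: omega_blocks_def)

lemma finite_omega_blocks: "finite (omega_blocks P z)"
  using finite_coarse by (simp add: omega_blocks_def)

lemma omega_subset: "omega P z \<subseteq> region P"
  unfolding omega_eq using omega_blocks_coarse coarse_subset by blast

text \<open>
  The block has interior points close to \<open>y\<close>, and these belong to no other block.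
\<close>
lemma block_near_omega:
  assumes K: "K \<in> coarse_mesh P" and y: "y \<in> K" "y \<in> interior (omega P z)"
  shows "K \<in> omega_blocks P z"
proof -
  have "y \<in> closure (interior K)"
    using y coarse_props(7)[OF K] by simp
  then obtain x where x: "x \<in> interior K" "x \<in> interior (omega P z)"
    using y(2) open_Int_closure_eq_empty[of "interior (omega P z)" "interior K"] by blast
  then obtain K' where K': "K' \<in> omega_blocks P z" "x \<in> K'"
    using interior_subset omega_eq by blast
  then have "K = K'"
    using interior_block_disjoint[OF K omega_blocks_coarse[OF K'(1)]] x by blast
  then show ?thesis
    using K' by simp
qed

lemma omega_edge:
  assumes E: "E \<in> omega_edges P z"
  shows "E \<in> edges P" "\<not> E \<subseteq> frontier (region P)"
    "plus_block P E \<in> omega_blocks P z" "minus_block P E \<in> omega_blocks P z"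
proof -
  show EP: "E \<in> edges P"
    using E by (simp add: omega_edges_def)
  then obtain K where K: "K \<in> coarse_mesh P" "E edge_of K"
    by (auto simp: edges_def)
  obtain y where y: "y \<in> rel_interior E"
    using edge_rel_interior_ne[OF K(2,1)] .
  then have yE: "y \<in> E" and yo: "y \<in> interior (omega P z)"
    using rel_interior_subset E by (auto simp: omega_edges_def)
  then have "y \<in> interior (region P)"
    using interior_mono[OF omega_subset] by blast
  then show int: "\<not> E \<subseteq> frontier (region P)"
    using yE by (auto simp: frontier_def)
  show "plus_block P E \<in> omega_blocks P z" "minus_block P E \<in> omega_blocks P z"
    using interior_edge[OF EP int] yE yo block_near_omega edge_of_imp_subset by blast+
qed

lemma omega_edgeI:
  assumes "E \<in> edges P" "\<not> E \<subseteq> frontier (region P)"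
    "plus_block P E \<in> omega_blocks P z" "minus_block P E \<in> omega_blocks P z"
  shows "E \<in> omega_edges P z"
proof -
  have "interior (plus_block P E \<union> minus_block P E) \<subseteq> interior (omega P z)"
    using assms(3,4) omega_eq by (intro interior_mono) blast
  then show ?thesis
    using edge_interior_two_blocks[OF assms(1,2)] assms(1) by (auto simp: omega_edges_def)
qed

text \<open>
  On such an edge a function in \<open>Vomega0\<close> has zero trace, so that the edge does not contribute to
  the penalty terms.
\<close>
lemma outer_edge_frontier:
  assumes E: "E \<in> edges P" "E \<notin> omega_edges P z"
    and K: "K = plus_block P E \<or> \<not> E \<subseteq> frontier (region P) \<and> K = minus_block P E"
    and Ko: "K \<in> omega_blocks P z" and x: "x \<in> E"
  shows "x \<in> frontier (omega P z)"
proof -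
  have EK: "E edge_of K"
    using K plus_block[OF E(1)] interior_edge[OF E(1)] by blast
  have xo: "x \<in> omega P z"
    using x EK Ko edge_of_imp_subset omega_eq by blast
  have "x \<notin> interior (omega P z)"
  proof (cases "E \<subseteq> frontier (region P)")
    case True
    then show ?thesis
      using x interior_mono[OF omega_subset] by (auto simp: frontier_def)
  next
    case False
    note b = interior_edge[OF E(1) False]
    obtain K' where K': "K' \<in> coarse_mesh P" "E edge_of K'" "K' \<notin> omega_blocks P z"
      using omega_edgeI[OF E(1) False] E(2) b by blast
    then show ?thesis
      using block_near_omega[OF K'(1)] x edge_of_imp_subset by blast
  qed
  then show ?thesis
    using xo closure_subset by (auto simp: frontier_def)
qed

lemma vertex_in: "z \<in> vertices K \<Longrightarrow> z \<in> K"
  by (simp add: vertices_def extreme_point_of_def)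

text \<open>
  Faces of the mesh intersect in faces, so a vertex of one block is a vertex of every block that
  contains it.
\<close>
lemma blocks_containing_node:
  assumes z: "z \<in> nodes P" and K: "K \<in> coarse_mesh P" "z \<in> K"
  shows "K \<in> omega_blocks P z"
proof -
  obtain K' where K': "K' \<in> coarse_mesh P" "z \<in> vertices K'"
    using z by (auto simp: nodes_def)
  have f: "(K' \<inter> K) face_of K'" "(K' \<inter> K) face_of K"
    using coarse_face[OF K'(1) K(1)] coarse_face[OF K(1) K'(1)] by (simp_all add: Int_commute)
  have "z extreme_point_of (K' \<inter> K)"
    using extreme_point_of_face[OF f(1)] K' K(2) vertex_in by (auto simp: vertices_def)
  then have "z extreme_point_of K"
    using extreme_point_of_face[OF f(2)] by blast
  then show ?thesis
    using K by (simp add: omega_blocks_eq vertices_def)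
qed

text \<open>
  Near \<open>z\<close> the region is covered by the blocks of the neighborhood. A small convex open piece of the
  region stays connected when the point \<open>z\<close> is removed, so if the blocks fell into two classes, a point
  other than \<open>z\<close> would lie in blocks of both. Their intersection, a proper face with two points, is an
  edge in the interior of the neighborhood.
\<close>
lemma omega_connected:
  fixes c :: "pt set \<Rightarrow> real"
  assumes z: "z \<in> nodes P"
    and same: "\<And>E. E \<in> omega_edges P z \<Longrightarrow> c (plus_block P E) = c (minus_block P E)"
    and K1: "K1 \<in> omega_blocks P z" and K2: "K2 \<in> omega_blocks P z"
  shows "c K1 = c K2"
proof (rule ccontr)
  assume ne: "c K1 \<noteq> c K2"
  have "closed (\<Union>{K \<in> coarse_mesh P. z \<notin> K})"
    using finite_coarse coarse_props(2) by (intro closed_Union) auto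
  then obtain r where r: "r > 0" "ball z r \<inter> \<Union>{K \<in> coarse_mesh P. z \<notin> K} = {}"
  proof -
    have "open (- \<Union>{K \<in> coarse_mesh P. z \<notin> K})" "z \<in> - \<Union>{K \<in> coarse_mesh P. z \<notin> K}"
      using \<open>closed (\<Union>{K \<in> coarse_mesh P. z \<notin> K})\<close> by auto
    then obtain r where "r > 0" "ball z r \<subseteq> - \<Union>{K \<in> coarse_mesh P. z \<notin> K}"
      using open_contains_ball by blast
    then show ?thesis
      by (intro that[of r]) auto
  qed
  define S where "S = interior (region P) \<inter> ball z r - {z}"
  have "convex (interior (region P) \<inter> ball z r)"
    using rectangle_props(3)[OF region] by (intro convex_Int convex_interior) auto
  then have "connected S"
    unfolding S_def by (intro connected_open_delete) (auto simp: convex_connected)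
  define A where "A = {K \<in> omega_blocks P z. c K = c K1}"
  define B where "B = {K \<in> omega_blocks P z. c K \<noteq> c K1}"
  have cl: "closed (\<Union>A)" "closed (\<Union>B)"
    using finite_omega_blocks coarse_props(2)[OF omega_blocks_coarse]
    by (auto simp: A_def B_def intro!: closed_Union)
  have cover: "S \<subseteq> \<Union>A \<union> \<Union>B"
  proof
    fix x assume x: "x \<in> S"
    then have "x \<in> region P"
      using interior_subset by (auto simp: S_def)
    then obtain K where K: "K \<in> coarse_mesh P" "x \<in> K"
      using Union_coarse by blast
    then have "z \<in> K"
      using x r(2) by (auto simp: S_def)
    then have "K \<in> omega_blocks P z"
      using blocks_containing_node[OF z K(1)] by blast
    then show "x \<in> \<Union>A \<union> \<Union>B"
      using K(2) by (auto simp: A_def B_def)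
  qed
  have meets: "S \<inter> K \<noteq> {}" if "K \<in> omega_blocks P z" for K
  proof -
    have K: "K \<in> coarse_mesh P" "z \<in> vertices K"
      using that by (auto simp: omega_blocks_eq)
    have "z \<in> closure (interior K)"
      using vertex_in[OF K(2)] coarse_props(7)[OF K(1)] by simp
    then have "ball z r \<inter> interior K \<noteq> {}"
      using r(1) open_Int_closure_eq_empty[OF open_ball, of z r "interior K"]
        centre_in_ball[of z r] by blast
    moreover have "z \<notin> interior K"
      using K(2) extreme_point_not_in_interior by (auto simp: vertices_def)
    moreover have "interior K \<subseteq> interior (region P)"
      by (rule interior_mono[OF coarse_subset[OF K(1)]])
    ultimately show ?thesis
      using interior_subset by (fastforce simp: S_def)
  qed
  have "S \<inter> \<Union>A \<inter> \<Union>B \<noteq> {}"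
  proof
    assume "S \<inter> \<Union>A \<inter> \<Union>B = {}"
    then have "\<Union>A \<inter> S = {} \<or> \<Union>B \<inter> S = {}"
      using connected_closedD[OF \<open>connected S\<close> _ cover cl] by blast
    moreover have "K1 \<in> A" "K2 \<in> B"
      using K1 K2 ne by (auto simp: A_def B_def)
    ultimately show False
      using meets[OF K1] meets[OF K2] by blast
  qed
  then obtain x K K' where x: "x \<in> S" and K: "K \<in> A" "x \<in> K" and K': "K' \<in> B" "x \<in> K'"
    by blast
  have Kc: "K \<in> coarse_mesh P" "z \<in> K" and K'c: "K' \<in> coarse_mesh P" "z \<in> K'"
    using K K' vertex_in by (auto simp: A_def B_def omega_blocks_eq)
  have neK: "K \<noteq> K'"
    using K K' by (auto simp: A_def B_def)
  define F where "F = K \<inter> K'"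
  have F: "F face_of K" "F face_of K'"
    unfolding F_def using coarse_face[OF Kc(1) K'c(1)] coarse_face[OF K'c(1) Kc(1)]
    by (simp_all add: Int_commute)
  have "F \<noteq> K"
    using interior_block_disjoint[OF Kc(1) K'c(1) neK] coarse_props(6)[OF Kc(1)] interior_subset
    by (fastforce simp: F_def)
  then have "aff_dim F < 2"
    using face_of_aff_dim_lt[OF coarse_props(3)[OF Kc(1)] F(1)] coarse_props(11)[OF Kc(1)] by simp
  moreover have "aff_dim {x, z} = 1"
    using x by (simp add: aff_dim_2 S_def)
  then have "1 \<le> aff_dim F"
    using aff_dim_subset[of "{x, z}" F] K K' Kc K'c by (simp add: F_def)
  ultimately have FK: "F edge_of K" "F edge_of K'"
    using F by (auto simp: edge_of_def)
  have FP: "F \<in> edges P"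
    using edgesI[OF Kc(1) FK(1)] .
  have int: "\<not> F \<subseteq> frontier (region P)"
    using x K K' by (auto simp: F_def S_def frontier_def)
  have two: "{K, K'} = {plus_block P F, minus_block P F}"
    using edge_blocks[OF FP int Kc(1) FK(1)] edge_blocks[OF FP int K'c(1) FK(2)] neK by auto
  then have "F \<in> omega_edges P z"
    using K K' by (intro omega_edgeI FP int) (auto simp: A_def B_def doubleton_eq_iff)
  then have "c K = c K'"
    using same two by (metis doubleton_eq_iff)
  then show False
    using K K' by (simp add: A_def B_def)
qed

lemma vertices_finite: "K \<in> coarse_mesh P \<Longrightarrow> finite (vertices K)"
  unfolding vertices_def by (intro finite_polyhedron_extreme_points coarse_props(10))

lemma finite_nodes: "finite (nodes P)"
  unfolding nodes_def using finite_coarse vertices_finite by auto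

lemma card_vertices_le: "K \<in> coarse_mesh P \<Longrightarrow> card (vertices K) \<le> max_vertices P"
  unfolding max_vertices_def using finite_coarse by (intro Max_ge) auto

text \<open>
  A rectangle is the convex hull of its vertices and is no single point.
\<close>
lemma other_vertex:
  assumes K: "K \<in> coarse_mesh P"
  shows "\<exists>y\<in>vertices K. y \<noteq> z"
proof (rule ccontr)
  assume "\<not> ?thesis"
  then have sub: "{y. y extreme_point_of K} \<subseteq> {z}"
    by (auto simp: vertices_def)
  have "K = convex hull {y. y extreme_point_of K}"
    using coarse_props(1,3)[OF K] by (rule Krein_Milman_Minkowski)
  also have "\<dots> \<subseteq> convex hull {z}"
    using sub by (rule hull_mono)
  finally have "K \<subseteq> {z}" by simp
  then have "interior K \<subseteq> interior {z}"
    by (rule interior_mono)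
  then show False
    using coarse_props(6)[OF K] by simp
qed

end

section \<open>Sums and restrictions of semidefinite forms\<close>
lemma (in psd_form) psd_form_cmult:
  assumes "0 \<le> c"
  shows "psd_form scale V (\<lambda>u v. c * b u v)"
proof unfold_locales
  show "c * b u v = c * b v u" if "u \<in> V" "v \<in> V" for u v
    by (simp only: sym[OF that])
qed (use assms in \<open>simp_all add: subspace_V add_left scale_left nonneg distrib_left\<close>)

lemma psd_form_add:
  assumes "psd_form sc V a" "psd_form sc V b"
  shows "psd_form sc V (\<lambda>u v. a u v + b u v)"
proof -
  interpret A: psd_form sc V a by fact
  interpret B: psd_form sc V b by fact
  show ?thesis
  proof unfold_locales
    show "a u v + b u v = a v u + b v u" if "u \<in> V" "v \<in> V" for u v
      by (simp only: A.sym[OF that] B.sym[OF that])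
  qed (simp_all add: A.subspace_V A.add_left B.add_left A.scale_left B.scale_left
        A.nonneg B.nonneg distrib_left)
qed

lemma psd_form_sum:
  assumes "finite I" "vector_space sc" "module.subspace sc V"
    "\<And>i. i \<in> I \<Longrightarrow> psd_form sc V (b i)"
  shows "psd_form sc V (\<lambda>u v. \<Sum>i\<in>I. b i u v)"
  using assms(1,4)
proof (induction I rule: finite_induct)
  case empty
  then show ?case
    using assms(2,3) by (simp add: psd_form_def psd_form_axioms_def)
next
  case (insert x I)
  then show ?case
    by (simp add: psd_form_add)
qed

lemma psd_form_subspace:
  assumes "psd_form sc V b" "module.subspace sc U" "U \<subseteq> V"
  shows "psd_form sc U b"
proof -
  interpret A: psd_form sc V b by fact
  show ?thesis
  proof unfold_locales
    show "b u v = b v u" if "u \<in> U" "v \<in> U" for u v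
      using that assms(3) by (intro A.sym) auto
  qed (use assms(2,3) in \<open>simp_all add: A.add_left A.scale_left A.nonneg subset_iff\<close>)
qed

context block
begin

section \<open>Products with a cutoff function\<close>
text \<open>
  The volume part of the mass form of the spectral problem, for one block.
\<close>
definition weight_form :: "(pt \<Rightarrow> real) \<Rightarrow> (pt \<Rightarrow> real) \<Rightarrow> (pt \<Rightarrow> real) \<Rightarrow> real"
  where "weight_form \<rho> u v = (LINT x|lebesgue_on K. \<kappa> x * (norm (grad \<rho> x))\<^sup>2 * u x * v x)"

lemma integrable_weight:
  assumes "\<rho> \<in> H" "u \<in> H" "v \<in> H"
  shows "integrable (lebesgue_on K) (\<lambda>x. \<kappa> x * (norm (grad \<rho> x))\<^sup>2 * u x * v x)"
  using integrable_weighted_gradients[OF assms(1,1), of "\<lambda>x. u x * v x"] assms[THEN H_continuous]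
  by (simp add: power2_norm_eq_inner mult.assoc continuous_on_mult)

lemma psd_form_weight:
  assumes \<rho>: "\<rho> \<in> H"
  shows "psd_form fscale H (weight_form \<rho>)"
proof unfold_locales
  show "fsp.subspace H" by (rule subspace_H)
  show "weight_form \<rho> (u + v) w = weight_form \<rho> u w + weight_form \<rho> v w"
    if "u \<in> H" "v \<in> H" "w \<in> H" for u v w
    using that \<rho>
    by (simp add: weight_form_def distrib_left distrib_right integrable_weight
        flip: Bochner_Integration.integral_add)
  show "weight_form \<rho> (fscale c u) v = c * weight_form \<rho> u v" for u v c
  proof -
    have "weight_form \<rho> (fscale c u) v = (LINT x|lebesgue_on K. c * (\<kappa> x * (norm (grad \<rho> x))\<^sup>2 * u x * v x))"
      unfolding weight_form_def by (simp add: mult_ac)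
    then show ?thesis
      by (simp add: weight_form_def)
  qed
  show "weight_form \<rho> u v = weight_form \<rho> v u" for u v
    by (simp add: weight_form_def mult_ac)
  show "0 \<le> weight_form \<rho> u u" for u
    unfolding weight_form_def
  proof (rule Bochner_Integration.integral_nonneg)
    fix x assume "x \<in> space (lebesgue_on K)"
    then have "1 \<le> \<kappa> x"
      using \<kappa>_ge1 by simp
    then have "0 \<le> \<kappa> x * (norm (grad \<rho> x))\<^sup>2 * (u x * u x)"
      by (intro mult_nonneg_nonneg zero_le_square[of "u x"]) auto
    then show "0 \<le> \<kappa> x * (norm (grad \<rho> x))\<^sup>2 * u x * u x"
      by (simp add: mult.assoc)
  qed
qed

text \<open>
  Pointwise product rule and \<open>|p + q|\<^sup>2 \<le> 2 |p|\<^sup>2 + 2 |q|\<^sup>2\<close>.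
\<close>
lemma energy_product_bound:
  assumes \<rho>: "\<rho> \<in> H" and w: "w \<in> H" and range: "\<And>x. x \<in> K \<Longrightarrow> 0 \<le> \<rho> x \<and> \<rho> x \<le> 1"
  shows "energy (\<lambda>x. \<rho> x * w x) (\<lambda>x. \<rho> x * w x) \<le> 2 * (energy w w + weight_form \<rho> w w)"
proof -
  have "energy (\<lambda>x. \<rho> x * w x) (\<lambda>x. \<rho> x * w x) \<le>
    (LINT x|lebesgue_on K. 2 * (\<kappa> x * (grad w x \<bullet> grad w x) + \<kappa> x * (norm (grad \<rho> x))\<^sup>2 * w x * w x))"
    unfolding energy_def
  proof (rule integral_mono_AE)
    show "integrable (lebesgue_on K)
       (\<lambda>x. \<kappa> x * (grad (\<lambda>x. \<rho> x * w x) x \<bullet> grad (\<lambda>x. \<rho> x * w x) x))"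
      using \<rho> w by (intro integrable_energy H_mult)
    show "integrable (lebesgue_on K)
       (\<lambda>x. 2 * (\<kappa> x * (grad w x \<bullet> grad w x) + \<kappa> x * (norm (grad \<rho> x))\<^sup>2 * w x * w x))"
      using \<rho> w by (intro Bochner_Integration.integrable_mult_right Bochner_Integration.integrable_add
          integrable_energy integrable_weight)
    show "AE x in lebesgue_on K. \<kappa> x * (grad (\<lambda>x. \<rho> x * w x) x \<bullet> grad (\<lambda>x. \<rho> x * w x) x) \<le>
        2 * (\<kappa> x * (grad w x \<bullet> grad w x) + \<kappa> x * (norm (grad \<rho> x))\<^sup>2 * w x * w x)"
      using AE_K AE_differentiable[OF \<rho>] AE_differentiable[OF w]
    proof eventually_elim
      case (elim x)
      define p where "p = \<rho> x *\<^sub>R grad w x"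
      define q where "q = w x *\<^sub>R grad \<rho> x"
      have g: "grad (\<lambda>x. \<rho> x * w x) x = p + q"
        using elim by (simp add: grad_mult p_def q_def)
      have "0 \<le> (p - q) \<bullet> (p - q)"
        by (rule inner_ge_zero)
      then have "(p + q) \<bullet> (p + q) \<le> 2 * (p \<bullet> p + q \<bullet> q)"
        by (simp add: algebra_simps inner_commute)
      also have "p \<bullet> p = (\<rho> x)\<^sup>2 * (grad w x \<bullet> grad w x)"
        by (simp add: p_def power2_eq_square)
      also have "\<dots> \<le> 1 * (grad w x \<bullet> grad w x)"
        using range[OF elim(1)] by (intro mult_right_mono) (auto simp: power_le_one)
      also have "q \<bullet> q = (norm (grad \<rho> x))\<^sup>2 * w x * w x"
        by (simp add: q_def power2_norm_eq_inner)
      finally have "(p + q) \<bullet> (p + q) \<le> 2 * (grad w x \<bullet> grad w x + (norm (grad \<rho> x))\<^sup>2 * w x * w x)"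
        by simp
      then have "\<kappa> x * ((p + q) \<bullet> (p + q)) \<le>
          \<kappa> x * (2 * (grad w x \<bullet> grad w x + (norm (grad \<rho> x))\<^sup>2 * w x * w x))"
        using \<kappa>_ge1[OF elim(1)] by (intro mult_left_mono) auto
      then show ?case
        unfolding g by (simp add: algebra_simps)
    qed
  qed
  also have "\<dots> = 2 * (energy w w + weight_form \<rho> w w)"
    using \<rho> w by (simp add: energy_def weight_form_def integrable_energy integrable_weight)
  finally show ?thesis .
qed

end

section \<open>The broken space and its forms\<close>
locale dg_problem = dg_mesh P for P :: dg_data +
  fixes Cinv :: real
  assumes coeff: "kappa P \<in> borel_measurable (lebesgue_on (region P))"
      "bounded (kappa P ` region P)" "\<forall>x\<in>region P. 1 \<le> kappa P x"
    and pou: "partition_of_unity P"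
    and inverse_ineq: "0 < Cinv" "inverse_inequality P Cinv"
    and penalty: "Cinv\<^sup>2 < penalty P"
begin

lemma block_K:
  assumes K: "K \<in> coarse_mesh P"
  shows "block K (fine_in K) (kappa P)"
proof
  show "rectangle K" by (rule coarse_rectangle[OF K])
  show "finite (fine_in K)" "\<And>\<tau>. \<tau> \<in> fine_in K \<Longrightarrow> rectangle \<tau>"
    using fine(1) by (auto simp: fine_in_def rect_mesh_def)
  show "\<Union>(fine_in K) = K" by (rule Union_fine_in[OF K])
  note sub = coarse_subset[OF K]
  show "kappa P \<in> borel_measurable (lebesgue_on K)"
    using coeff(1) measurable_restrict_mono sub by blast
  show "bounded (kappa P ` K)"
    using coeff(2) sub by (meson bounded_subset image_mono)
  show "1 \<le> kappa P x" if "x \<in> K" for x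
    using coeff(3) sub that by blast
qed

definition block_space :: "pt set \<Rightarrow> (pt \<Rightarrow> real) set"
  where "block_space K = block.H K (fine_in K)"

text \<open>
  All forms are bilinear on \<open>X\<close>. The finite element space \<open>VDG P\<close> is too small for this purpose, since
  the modified residuals evaluate them on products with the partition of unity.
\<close>
definition X :: "dgfun set"
  where "X = {v. (\<forall>K\<in>coarse_mesh P. v K \<in> block_space K) \<and> (\<forall>K. K \<notin> coarse_mesh P \<longrightarrow> v K = 0)}"

lemma XD: "u \<in> X \<Longrightarrow> K \<in> coarse_mesh P \<Longrightarrow> u K \<in> block_space K"
  by (simp add: X_def)

lemma dgscale_block: "dgscale c u K = fscale c (u K)"
  by (simp add: dgscale_def fscale_def)

lemma subspace_block_space: "K \<in> coarse_mesh P \<Longrightarrow> fsp.subspace (block_space K)"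
  using block.subspace_H[OF block_K] by (simp add: block_space_def)

lemma subspace_blockwise:
  assumes "\<And>K. K \<in> coarse_mesh P \<Longrightarrow> fsp.subspace (S K)"
  shows "dgv.subspace {v. (\<forall>K\<in>coarse_mesh P. v K \<in> S K) \<and> (\<forall>K. K \<notin> coarse_mesh P \<longrightarrow> v K = 0)}"
proof (rule dgv.subspaceI; (unfold mem_Collect_eq)?; (elim conjE)?)
  show "(\<forall>K\<in>coarse_mesh P. (0::dgfun) K \<in> S K) \<and> (\<forall>K. K \<notin> coarse_mesh P \<longrightarrow> (0::dgfun) K = 0)"
    using assms by (simp add: fsp.subspace_0)
next
  fix u v :: dgfun
  assume u: "\<forall>K\<in>coarse_mesh P. u K \<in> S K" "\<forall>K. K \<notin> coarse_mesh P \<longrightarrow> u K = 0"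
    and v: "\<forall>K\<in>coarse_mesh P. v K \<in> S K" "\<forall>K. K \<notin> coarse_mesh P \<longrightarrow> v K = 0"
  show "(\<forall>K\<in>coarse_mesh P. (u + v) K \<in> S K) \<and> (\<forall>K. K \<notin> coarse_mesh P \<longrightarrow> (u + v) K = 0)"
    using u v assms by (simp add: fsp.subspace_add)
next
  fix c and u :: dgfun
  assume u: "\<forall>K\<in>coarse_mesh P. u K \<in> S K" "\<forall>K. K \<notin> coarse_mesh P \<longrightarrow> u K = 0"
  show "(\<forall>K\<in>coarse_mesh P. dgscale c u K \<in> S K) \<and> (\<forall>K. K \<notin> coarse_mesh P \<longrightarrow> dgscale c u K = 0)"
    using u assms by (simp add: dgscale_block fsp.subspace_scale fsp.scale_zero_right)
qed

lemma subspace_X: "dgv.subspace X"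
  unfolding X_def by (rule subspace_blockwise[OF subspace_block_space])

lemma block_space_continuous: "K \<in> coarse_mesh P \<Longrightarrow> u \<in> block_space K \<Longrightarrow> continuous_on K u"
  using block.H_continuous[OF block_K] by (simp add: block_space_def)

lemma aH_block_energy: "K \<in> coarse_mesh P \<Longrightarrow> aH_block P K = block.energy K (kappa P)"
  by (intro ext) (simp add: aH_block_def block.energy_def[OF block_K])

lemma Ball_Collect_conj: "(\<forall>z\<in>{z \<in> A. Q z}. R z) \<longleftrightarrow> (\<forall>z\<in>A. Q z \<longrightarrow> R z)"
  by blast

lemma Qspace_block: "K \<in> coarse_mesh P \<Longrightarrow> Qspace r P K = block.Q K (fine_in K) r"
  by (simp only: Qspace_def block.Q_def[OF block_K] polynomial2_def)
    (simp only: fine_in_def Ball_Collect_conj)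

lemma Wh_bd_block:
  assumes K: "K \<in> coarse_mesh P"
  shows "Wh_bd P K = block.Wbd K (fine_in K)"
proof -
  interpret b: block K "fine_in K" "kappa P" by (rule block_K[OF K])
  show ?thesis
    unfolding Wh_bd_def b.Wbd_def Wh_def Qspace_block[OF K]
    by (intro image_cong refl ext) (simp add: b.restr_def)
qed

lemma harmonic_ext_block:
  assumes K: "K \<in> coarse_mesh P"
  shows "harmonic_ext P K v = block.hext K (fine_in K) (kappa P) v"
proof -
  interpret b: block K "fine_in K" "kappa P" by (rule block_K[OF K])
  have "b.is_hext v = (\<lambda>w. w \<in> b.Q 2 \<and> (\<forall>x\<in>frontier K. w x = v x) \<and>
      (\<forall>z\<in>b.Q 2. (\<forall>x\<in>frontier K. z x = 0) \<longrightarrow> b.energy w z = 0))"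
    by (rule ext) (simp only: b.is_hext_def b.Q0_def Ball_Collect_conj)
  then show ?thesis
    unfolding harmonic_ext_def b.hext_def Wh_def Qspace_block[OF K] aH_block_energy[OF K]
    by (simp only:)
qed

lemma flux_block:
  assumes K: "K \<in> coarse_mesh P"
  shows "flux P K u = block.bflux K (fine_in K) (kappa P) u"
proof -
  interpret b: block K "fine_in K" "kappa P" by (rule block_K[OF K])
  have "b.is_flux u = (\<lambda>g. g \<in> b.Wbd \<and>
      (\<forall>v\<in>b.Wbd. bd_integral K (\<lambda>x. g x * v x) = b.energy u (b.hext v)))"
    by (rule ext) (simp only: b.is_flux_def b.bdform_def)
  then show ?thesis
    unfolding flux_def b.bflux_def Wh_bd_block[OF K] harmonic_ext_block[OF K] aH_block_energy[OF K]
    by (simp only:)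
qed

lemma Vh_subset: "K \<in> coarse_mesh P \<Longrightarrow> Vh P K \<subseteq> block_space K"
  unfolding Vh_def block_space_def using block.Q_subset_H[OF block_K] by (simp add: Qspace_block)

lemma VDG_subset: "VDG P \<subseteq> X"
  using Vh_subset by (auto simp: VDG_def X_def)

lemma subspace_VDG: "dgv.subspace (VDG P)"
  unfolding VDG_def
  by (rule subspace_blockwise) (simp add: Vh_def Qspace_block block.subspace_Q[OF block_K])

lemma flux_linear:
  assumes K: "K \<in> coarse_mesh P" and u: "u \<in> block_space K"
  shows "v \<in> block_space K \<Longrightarrow> flux P K (u + v) = flux P K u + flux P K v"
    "flux P K (fscale c u) = fscale c (flux P K u)"
    "continuous_on (frontier K) (flux P K u)"
proof -
  interpret b: block K "fine_in K" "kappa P" by (rule block_K[OF K])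
  show "flux P K (u + v) = flux P K u + flux P K v" if "v \<in> block_space K"
    using u that b.bflux_add[of u v] by (simp add: flux_block[OF K] block_space_def)
  show "flux P K (fscale c u) = fscale c (flux P K u)"
    using u b.bflux_scale[of u c] by (simp add: flux_block[OF K] block_space_def)
  show "continuous_on (frontier K) (flux P K u)"
    using u b.bflux_continuous[of u] by (simp add: flux_block[OF K, abs_def] block_space_def)
qed

lemma fine_mesh_nonempty: "fine_mesh P \<noteq> {}"
  using fine(1) rectangle_props(5)[OF region] by (auto simp: rect_mesh_def)

lemma mesh_size_pos: "mesh_size P > 0"
proof -
  obtain \<tau> where \<tau>: "\<tau> \<in> fine_mesh P"
    using fine_mesh_nonempty by blast
  then have r: "rectangle \<tau>" "finite (fine_mesh P)"
    using fine(1) by (auto simp: rect_mesh_def)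
  have "\<not> \<tau> \<subseteq> {x}" for x
    using rectangle_props(6)[OF r(1)] interior_mono[of \<tau> "{x}"] by auto
  then obtain x y where xy: "x \<in> \<tau>" "y \<in> \<tau>" "x \<noteq> y"
    by blast
  have "0 < dist x y"
    using xy by simp
  also have "\<dots> \<le> diameter \<tau>"
    using xy rectangle_props(1)[OF r(1)] by (intro diameter_bounded_bound compact_imp_bounded)
  also have "\<dots> \<le> mesh_size P"
    unfolding mesh_size_def using \<tau> r by (intro Max_ge) auto
  finally show ?thesis .
qed

lemma penalty_pos: "penalty P > 0"
  using penalty zero_le_power2[of Cinv] by linarith

lemma coeff_max_ge1:
  assumes "K \<in> coarse_mesh P"
  shows "1 \<le> coeff_max P K"
proof -
  interpret b: block K "fine_in K" "kappa P" by (rule block_K[OF assms])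
  obtain x where x: "x \<in> K"
    using b.rect(5) by blast
  have "1 \<le> kappa P x"
    by (rule b.\<kappa>_ge1[OF x])
  also have "\<dots> \<le> coeff_max P K"
    unfolding coeff_max_def using x b.\<kappa>_bdd by (intro cSup_upper bounded_imp_bdd_above) auto
  finally show ?thesis .
qed

lemma coeff_avg_ge1:
  assumes E: "E \<in> edges P"
  shows "1 \<le> coeff_avg P E"
proof (cases "E \<subseteq> frontier (region P)")
  case True
  then show ?thesis
    using coeff_max_ge1[OF plus_block(1)[OF E]] by (simp add: coeff_avg_def)
next
  case False
  then show ?thesis
    using coeff_max_ge1[OF plus_block(1)[OF E]] coeff_max_ge1[OF interior_edge(4)[OF E False]]
    by (simp add: coeff_avg_def)
qed

lemma flux_bound:
  assumes K: "K \<in> coarse_mesh P" and u: "u \<in> block_space K"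
  shows "bd_integral K (\<lambda>x. flux P K u x * flux P K u x)
    \<le> coeff_max P K * Cinv\<^sup>2 / mesh_size P * aH_block P K u u"
proof -
  interpret b: block K "fine_in K" "kappa P" by (rule block_K[OF K])
  have "b.bdform (b.bflux u) (b.bflux u) \<le> coeff_max P K * Cinv\<^sup>2 / mesh_size P * b.energy u u"
  proof (rule b.bflux_bound)
    show "u \<in> b.H" using u by (simp add: block_space_def)
    show "0 \<le> coeff_max P K * Cinv\<^sup>2 / mesh_size P"
      using coeff_max_ge1[OF K] mesh_size_pos by (intro divide_nonneg_pos mult_nonneg_nonneg) auto
    show "b.energy (b.hext v) (b.hext v) \<le> coeff_max P K * Cinv\<^sup>2 / mesh_size P * b.bdform v v"
      if "v \<in> b.Wbd" for v
      using inverse_ineq(2) K that unfolding inverse_inequality_def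
      by (simp add: Wh_bd_block harmonic_ext_block aH_block_energy b.bdform_def power2_eq_square)
  qed
  then show ?thesis
    by (simp add: b.bdform_def flux_block[OF K] aH_block_energy[OF K])
qed

lemma edge_in_blocks:
  assumes "E \<in> edges P"
  shows "E \<subseteq> frontier (plus_block P E)" "E \<subseteq> plus_block P E"
    "\<not> E \<subseteq> frontier (region P) \<Longrightarrow> E \<subseteq> frontier (minus_block P E)"
    "\<not> E \<subseteq> frontier (region P) \<Longrightarrow> E \<subseteq> minus_block P E"
proof -
  have *: "E \<subseteq> frontier K \<and> E \<subseteq> K" if "K \<in> coarse_mesh P" "E edge_of K" for K
    using that frontier_eq_Union_edges[OF coarse_rectangle[OF that(1)]] edge_of_imp_subset by auto
  show "E \<subseteq> frontier (plus_block P E)" "E \<subseteq> plus_block P E"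
    using *[OF plus_block(1,2)[OF assms]] by auto
  show "E \<subseteq> frontier (minus_block P E)" "E \<subseteq> minus_block P E" if "\<not> E \<subseteq> frontier (region P)"
    using *[OF interior_edge(4,5)[OF assms that]] by auto
qed

lemma jump_add: "jump P E (u + v) x = jump P E u x + jump P E v x"
  and jump_scale: "jump P E (dgscale c u) x = c * jump P E u x"
  and avg_add: "avg P E (u + v) x = avg P E u x + avg P E v x"
  and avg_scale: "avg P E (dgscale c u) x = c * avg P E u x"
  by (simp_all add: jump_def avg_def dgscale_def right_diff_distrib distrib_left add_divide_distrib)

lemma jump_avg_continuous:
  assumes "E \<in> edges P" "\<And>K. K \<in> coarse_mesh P \<Longrightarrow> continuous_on K (u K)"
  shows "continuous_on E (jump P E u)" "continuous_on E (avg P E u)"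
proof -
  have p: "continuous_on E (u (plus_block P E))"
    by (rule continuous_on_subset[OF assms(2)[OF plus_block(1)[OF assms(1)]] edge_in_blocks(2)[OF assms(1)]])
  have m: "continuous_on E (u (minus_block P E))" if "\<not> E \<subseteq> frontier (region P)"
    by (rule continuous_on_subset[OF assms(2)[OF interior_edge(4)[OF assms(1) that]]
          edge_in_blocks(4)[OF assms(1) that]])
  have "continuous_on E (jump P E u) \<and> continuous_on E (avg P E u)"
  proof (cases "E \<subseteq> frontier (region P)")
    case True
    then have "jump P E u = u (plus_block P E)" "avg P E u = u (plus_block P E)"
      by (simp_all add: fun_eq_iff jump_def avg_def)
    then show ?thesis
      using p by simp
  next
    case False
    then have "jump P E u = (\<lambda>x. u (plus_block P E) x - u (minus_block P E) x)"
      "avg P E u = (\<lambda>x. (u (plus_block P E) x + u (minus_block P E) x) / 2)"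
      by (simp_all add: fun_eq_iff jump_def avg_def)
    then show ?thesis
      using p m[OF False] by (auto intro!: continuous_intros)
  qed
  then show "continuous_on E (jump P E u)" "continuous_on E (avg P E u)"
    by auto
qed

lemma X_continuous:
  assumes "u \<in> X" "E \<in> edges P"
  shows "continuous_on E (jump P E u)" "continuous_on E (avg P E u)"
proof -
  have c: "\<And>K. K \<in> coarse_mesh P \<Longrightarrow> continuous_on K (u K)"
    by (rule block_space_continuous[OF _ XD[OF assms(1)]])
  show "continuous_on E (jump P E u)" "continuous_on E (avg P E u)"
    by (rule jump_avg_continuous[OF assms(2) c], assumption)+
qed

text \<open>
  The average normal flux on an edge. The fluxes of the two blocks of an interior edge refer to their
  outward normals, which are opposite, so their average is half a difference.
\<close>
definition eflux :: "pt set \<Rightarrow> dgfun \<Rightarrow> pt \<Rightarrow> real"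
  where "eflux E u x = avg P E (edge_flux P E u) x"

lemma eflux_boundary:
  "E \<in> edges P \<Longrightarrow> E \<subseteq> frontier (region P) \<Longrightarrow>
    eflux E u x = flux P (plus_block P E) (u (plus_block P E)) x"
  by (simp add: eflux_def avg_def edge_flux_def boundary_edge)

lemma eflux_interior:
  "E \<in> edges P \<Longrightarrow> \<not> E \<subseteq> frontier (region P) \<Longrightarrow>
    eflux E u x = (flux P (plus_block P E) (u (plus_block P E)) x
      - flux P (minus_block P E) (u (minus_block P E)) x) / 2"
  by (simp add: eflux_def avg_def edge_flux_def interior_edge)

lemma eflux_add:
  assumes E: "E \<in> edges P" and "u \<in> X" "v \<in> X"
  shows "eflux E (u + v) x = eflux E u x + eflux E v x"
proof (cases "E \<subseteq> frontier (region P)")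
  have lin: "flux P K ((u + v) K) x = flux P K (u K) x + flux P K (v K) x" if "K \<in> coarse_mesh P" for K
    using flux_linear(1)[OF that XD[OF assms(2) that] XD[OF assms(3) that]] by simp
  case True
  then show ?thesis
    by (simp only: eflux_boundary[OF E] lin[OF plus_block(1)[OF E]])
next
  have lin: "flux P K ((u + v) K) x = flux P K (u K) x + flux P K (v K) x" if "K \<in> coarse_mesh P" for K
    using flux_linear(1)[OF that XD[OF assms(2) that] XD[OF assms(3) that]] by simp
  case False
  then show ?thesis
    by (simp add: eflux_interior[OF E] lin[OF plus_block(1)[OF E]] lin[OF interior_edge(4)[OF E]]
        field_simps del: plus_fun_apply)
qed

lemma eflux_scale:
  assumes E: "E \<in> edges P" and "u \<in> X"
  shows "eflux E (dgscale c u) x = c * eflux E u x"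
proof -
  have lin: "flux P K (dgscale c u K) x = c * flux P K (u K) x" if "K \<in> coarse_mesh P" for K
    using flux_linear(2)[OF that XD[OF assms(2) that]] by (simp add: dgscale_block)
  show ?thesis
    using lin[OF plus_block(1)[OF E]] lin[OF interior_edge(4)[OF E]]
    by (cases "E \<subseteq> frontier (region P)")
      (simp_all add: eflux_boundary[OF E] eflux_interior[OF E] right_diff_distrib)
qed

lemma eflux_continuous:
  assumes E: "E \<in> edges P" and u: "u \<in> X"
  shows "continuous_on E (eflux E u)"
proof -
  let ?f = "\<lambda>K. flux P K (u K)"
  have p: "continuous_on E (?f (plus_block P E))"
    by (rule continuous_on_subset[OF flux_linear(3)[OF plus_block(1)[OF E] XD[OF u plus_block(1)[OF E]]]
        edge_in_blocks(1)[OF E]])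
  show ?thesis
  proof (cases "E \<subseteq> frontier (region P)")
    case True
    then have "eflux E u = ?f (plus_block P E)"
      using eflux_boundary[OF E] by (intro ext)
    then show ?thesis
      using p by simp
  next
    case False
    have m: "continuous_on E (?f (minus_block P E))"
      by (rule continuous_on_subset[OF flux_linear(3)[OF interior_edge(4)[OF E False]
            XD[OF u interior_edge(4)[OF E False]]] edge_in_blocks(3)[OF E False]])
    have "eflux E u = (\<lambda>x. (?f (plus_block P E) x - ?f (minus_block P E) x) / 2)"
      using eflux_interior[OF E False] by (intro ext)
    then show ?thesis
      using p m by (auto intro!: continuous_intros)
  qed
qed

text \<open>
  The penalty terms and the edge terms of the mass form have this shape, with \<open>G\<close> the jump or the
  average.
\<close>
lemma psd_form_edge:
  assumes E: "E \<in> edges P" and w: "continuous_on E w" "\<And>x. x \<in> E \<Longrightarrow> 0 \<le> w x"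
    and G: "\<And>u. u \<in> X \<Longrightarrow> continuous_on E (G u)"
    and add: "\<And>u v x. \<lbrakk>u \<in> X; v \<in> X\<rbrakk> \<Longrightarrow> G (u + v) x = G u x + G v x"
    and scale: "\<And>u c x. u \<in> X \<Longrightarrow> G (dgscale c u) x = c * G u x"
  shows "psd_form dgscale X (\<lambda>u v. edge_integral E (\<lambda>x. w x * G u x * G v x))"
proof unfold_locales
  note ei = edge_is_edge[OF E]
  show "dgv.subspace X" by (rule subspace_X)
  show "edge_integral E (\<lambda>x. w x * G (u + v) x * G y x) =
      edge_integral E (\<lambda>x. w x * G u x * G y x) + edge_integral E (\<lambda>x. w x * G v x * G y x)"
    if "u \<in> X" "v \<in> X" "y \<in> X" for u v y
  proof -
    have "(\<lambda>x. w x * G (u + v) x * G y x) = (\<lambda>x. w x * G u x * G y x + w x * G v x * G y x)"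
      using that by (simp add: add algebra_simps)
    then show ?thesis
      using that w(1) G by (simp add: edge_integral_add[OF ei] continuous_on_mult)
  qed
  show "edge_integral E (\<lambda>x. w x * G (dgscale c u) x * G v x) =
      c * edge_integral E (\<lambda>x. w x * G u x * G v x)" if "u \<in> X" "v \<in> X" for u v c
  proof -
    have "(\<lambda>x. w x * G (dgscale c u) x * G v x) = (\<lambda>x. c * (w x * G u x * G v x))"
      using that by (simp add: scale algebra_simps)
    then show ?thesis
      by (simp only: edge_integral_cmult[OF ei])
  qed
  show "edge_integral E (\<lambda>x. w x * G u x * G v x) = edge_integral E (\<lambda>x. w x * G v x * G u x)" for u v
    by (simp add: mult_ac)
  show "0 \<le> edge_integral E (\<lambda>x. w x * G u x * G u x)" for u
    using w(2) by (intro edge_integral_nonneg[OF ei]) (simp add: mult.assoc)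
qed

definition jump_form :: "pt set \<Rightarrow> dgfun \<Rightarrow> dgfun \<Rightarrow> real"
  where "jump_form E u v = penalty P / mesh_size P *
    edge_integral E (\<lambda>x. coeff_avg P E * jump P E u x * jump P E v x)"

lemma psd_form_jump: "E \<in> edges P \<Longrightarrow> psd_form dgscale X (jump_form E)"
  unfolding jump_form_def
  by (intro psd_form.psd_form_cmult psd_form_edge)
    (use coeff_avg_ge1 penalty_pos mesh_size_pos in
      \<open>auto simp: jump_add jump_scale X_continuous intro: order_trans[OF zero_le_one] less_imp_le\<close>)

lemma psd_form_on_block:
  assumes K: "K \<in> coarse_mesh P" and b: "psd_form fscale (block_space K) b"
  shows "psd_form dgscale X (\<lambda>u v. b (u K) (v K))"
proof -
  interpret B: psd_form fscale "block_space K" b by fact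
  show ?thesis
  proof unfold_locales
    show "b (u K) (v K) = b (v K) (u K)" if "u \<in> X" "v \<in> X" for u v
      using that K by (intro B.sym XD)
  qed (use K in \<open>simp_all add: subspace_X dgscale_block XD B.add_left B.scale_left B.nonneg\<close>)
qed

lemma psd_form_aH_block: "K \<in> coarse_mesh P \<Longrightarrow> psd_form fscale (block_space K) (aH_block P K)"
  using block.psd_form_energy[OF block_K] by (simp add: block_space_def aH_block_energy)

lemma psd_form_aH: "psd_form dgscale X (aH P)"
  unfolding aH_def
  by (intro psd_form_sum finite_coarse psd_form_on_block psd_form_aH_block subspace_X
      dgv.vector_space_axioms)

definition jump_energy :: "dgfun \<Rightarrow> dgfun \<Rightarrow> real"
  where "jump_energy u v = (\<Sum>E\<in>edges P. jump_form E u v)"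

lemma psd_form_jump_energy: "psd_form dgscale X jump_energy"
  unfolding jump_energy_def
  by (intro psd_form_sum finite_edges_P psd_form_jump subspace_X dgv.vector_space_axioms)

definition dg_energy :: "dgfun \<Rightarrow> dgfun \<Rightarrow> real"
  where "dg_energy u v = aH P u v + jump_energy u v"

lemma psd_form_dg_energy: "psd_form dgscale X dg_energy"
  unfolding dg_energy_def by (intro psd_form_add psd_form_aH psd_form_jump_energy)

text \<open>
  One half of the consistency terms of \<open>aDG\<close>; the other half has the arguments exchanged.
\<close>
definition consist :: "dgfun \<Rightarrow> dgfun \<Rightarrow> real"
  where "consist u v = (\<Sum>E\<in>edges P. edge_integral E (\<lambda>x. eflux E u x * jump P E v x))"

lemma aDG_eq:
  assumes "u \<in> X" "v \<in> X"
  shows "aDG P u v = dg_energy u v - (consist u v + consist v u)"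
proof -
  have "edge_integral E (\<lambda>x. avg P E (edge_flux P E u) x * jump P E v x + avg P E (edge_flux P E v) x * jump P E u x)
    = edge_integral E (\<lambda>x. eflux E u x * jump P E v x) + edge_integral E (\<lambda>x. eflux E v x * jump P E u x)"
    if E: "E \<in> edges P" for E
    unfolding eflux_def[symmetric] using assms X_continuous[OF _ E] eflux_continuous[OF E]
    by (intro edge_integral_add[OF edge_is_edge[OF E]] continuous_on_mult) auto
  then show ?thesis
    by (simp add: aDG_def dg_energy_def jump_energy_def jump_form_def consist_def sum.distrib)
qed

lemma consist_add_left: "u \<in> X \<Longrightarrow> v \<in> X \<Longrightarrow> w \<in> X \<Longrightarrow> consist (u + v) w = consist u w + consist v w"
  unfolding consist_def sum.distrib[symmetric]
proof (rule sum.cong[OF refl])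
  fix E assume "u \<in> X" "v \<in> X" "w \<in> X" and E: "E \<in> edges P"
  then show "edge_integral E (\<lambda>x. eflux E (u + v) x * jump P E w x) =
      edge_integral E (\<lambda>x. eflux E u x * jump P E w x) + edge_integral E (\<lambda>x. eflux E v x * jump P E w x)"
    using X_continuous[OF _ E] eflux_continuous[OF E]
    by (subst edge_integral_add[OF edge_is_edge[OF E], symmetric])
      (auto simp: eflux_add distrib_right intro: continuous_on_mult)
qed

lemma consist_add_right: "u \<in> X \<Longrightarrow> v \<in> X \<Longrightarrow> w \<in> X \<Longrightarrow> consist w (u + v) = consist w u + consist w v"
  unfolding consist_def sum.distrib[symmetric]
proof (rule sum.cong[OF refl])
  fix E assume "u \<in> X" "v \<in> X" "w \<in> X" and E: "E \<in> edges P"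
  then show "edge_integral E (\<lambda>x. eflux E w x * jump P E (u + v) x) =
      edge_integral E (\<lambda>x. eflux E w x * jump P E u x) + edge_integral E (\<lambda>x. eflux E w x * jump P E v x)"
    using X_continuous[OF _ E] eflux_continuous[OF E]
    by (subst edge_integral_add[OF edge_is_edge[OF E], symmetric])
      (auto simp: jump_add distrib_left intro: continuous_on_mult)
qed

lemma consist_scale: "u \<in> X \<Longrightarrow> consist (dgscale c u) v = c * consist u v"
    "consist v (dgscale c u) = c * consist v u"
  unfolding consist_def sum_distrib_left
  by (intro sum.cong refl; simp add: eflux_scale jump_scale mult.assoc mult.left_commute[of _ c]
      edge_integral_cmult[OF edge_is_edge])+

section \<open>Coercivity\<close>
text \<open>
  On an interior edge, the squared average flux divided by the average coefficient is at most the
  sum of the squared one-sided fluxes divided by the coefficients of their blocks. Every block then collects the integral over its own boundary, which \<open>flux_bound\<close>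
  controls by its energy.
\<close>
lemma eflux_weighted_bound:
  assumes u: "u \<in> X"
  shows "(\<Sum>E\<in>edges P. edge_integral E (\<lambda>x. eflux E u x * eflux E u x / coeff_avg P E))
    \<le> Cinv\<^sup>2 / mesh_size P * aH P u u"
proof -
  define G where "G E K = edge_integral E (\<lambda>x. flux P K (u K) x * flux P K (u K) x) / coeff_max P K" for E K
  let ?inc = "\<lambda>E. {K \<in> coarse_mesh P. E edge_of K}"
  have cont: "continuous_on E (flux P K (u K))" if "K \<in> coarse_mesh P" "E edge_of K" for E K
    using flux_linear(3)[OF that(1) XD[OF u that(1)]] that
      frontier_eq_Union_edges[OF coarse_rectangle[OF that(1)]] by (auto elim: continuous_on_subset)
  have G0: "0 \<le> G E K" if "K \<in> coarse_mesh P" "E edge_of K" for E K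
    unfolding G_def using coeff_max_ge1[OF that(1)] that
    by (intro divide_nonneg_pos edge_integral_nonneg edge_is_edge edgesI) auto
  have "edge_integral E (\<lambda>x. eflux E u x * eflux E u x / coeff_avg P E) \<le> (\<Sum>K\<in>?inc E. G E K)"
    if E: "E \<in> edges P" for E
  proof (cases "E \<subseteq> frontier (region P)")
    case True
    note b = boundary_edge[OF E True]
    have "edge_integral E (\<lambda>x. eflux E u x * eflux E u x / coeff_avg P E) = G E (plus_block P E)"
      unfolding G_def using edge_integral_cmult[OF edge_is_edge[OF E], of "1 / coeff_max P (plus_block P E)"]
      by (simp add: eflux_boundary[OF E True] coeff_avg_def True)
    also have "\<dots> \<le> (\<Sum>K\<in>?inc E. G E K)"
      using b G0 finite_coarse by (intro member_le_sum) auto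
    finally show ?thesis .
  next
    case False
    note b = interior_edge[OF E False]
    define p m where "p = plus_block P E" and "m = minus_block P E"
    define s t where "s = coeff_max P p" and "t = coeff_max P m"
    have st: "s > 0" "t > 0"
      using coeff_max_ge1[OF b(1)] coeff_max_ge1[OF b(4)] by (auto simp: s_def t_def p_def m_def)
    let ?f = "flux P p (u p)" and ?g = "flux P m (u m)"
    have cf: "continuous_on E ?f" "continuous_on E ?g"
      using cont b by (auto simp: p_def m_def)
    have young: "((f - g) / 2) * ((f - g) / 2) / ((s + t) / 2) \<le> (1 / s) * (f * f) + (1 / t) * (g * g)" for f g
    proof -
      \<comment> \<open>\<open>(s + t) (t f\<^sup>2 + s g\<^sup>2) - s t (f - g)\<^sup>2 = (t f + s g)\<^sup>2\<close>\<close>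
      have "0 \<le> (t * f + s * g)\<^sup>2"
        by simp
      then have "(f - g)\<^sup>2 * (s * t) \<le> (s + t) * (t * f\<^sup>2 + s * g\<^sup>2)"
        by (simp add: power2_eq_square algebra_simps)
      then have "(f - g)\<^sup>2 \<le> (s + t) * (f\<^sup>2 / s + g\<^sup>2 / t)"
        using st by (simp add: field_simps)
      then have "(f - g)\<^sup>2 / (s + t) \<le> f\<^sup>2 / s + g\<^sup>2 / t"
        using st by (simp add: field_simps)
      moreover have "((f - g) / 2) * ((f - g) / 2) / ((s + t) / 2) = (f - g)\<^sup>2 / (s + t) / 2"
        using st by (simp add: power2_eq_square)
      moreover have "0 \<le> (f - g)\<^sup>2 / (s + t)"
        using st by simp
      moreover have "y \<le> r" if "x \<le> r" "y = x / 2" "0 \<le> x" for x y r :: real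
        using that by simp
      ultimately have "((f - g) / 2) * ((f - g) / 2) / ((s + t) / 2) \<le> f\<^sup>2 / s + g\<^sup>2 / t"
        by blast
      then show ?thesis
        by (simp add: power2_eq_square)
    qed
    have "edge_integral E (\<lambda>x. eflux E u x * eflux E u x / coeff_avg P E)
      \<le> edge_integral E (\<lambda>x. (1 / s) * (?f x * ?f x) + (1 / t) * (?g x * ?g x))"
    proof (rule edge_integral_mono[OF edge_is_edge[OF E]])
      show "continuous_on E (\<lambda>x. eflux E u x * eflux E u x / coeff_avg P E)"
        using eflux_continuous[OF E u] coeff_avg_ge1[OF E] by (intro continuous_intros) auto
      show "continuous_on E (\<lambda>x. (1 / s) * (?f x * ?f x) + (1 / t) * (?g x * ?g x))"
        using cf by (intro continuous_intros)
      show "eflux E u x * eflux E u x / coeff_avg P E \<le> (1 / s) * (?f x * ?f x) + (1 / t) * (?g x * ?g x)" for x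
        using young[of "?f x" "?g x"] False
        by (simp only: eflux_interior[OF E False] coeff_avg_def p_def m_def s_def t_def if_False)
    qed
    also have "\<dots> = (1 / s) * edge_integral E (\<lambda>x. ?f x * ?f x) + (1 / t) * edge_integral E (\<lambda>x. ?g x * ?g x)"
      using cf by (subst edge_integral_add[OF edge_is_edge[OF E]])
        (auto intro!: continuous_intros simp: edge_integral_cmult[OF edge_is_edge[OF E]]
          simp del: times_divide_eq_left)
    also have "\<dots> = (\<Sum>K\<in>{p, m}. G E K)"
      using plus_minus_distinct[OF E False] by (simp add: G_def s_def t_def p_def m_def)
    also have "\<dots> \<le> (\<Sum>K\<in>?inc E. G E K)"
      using b G0 finite_coarse by (intro sum_mono2) (auto simp: p_def m_def)
    finally show ?thesis .
  qed
  then have "(\<Sum>E\<in>edges P. edge_integral E (\<lambda>x. eflux E u x * eflux E u x / coeff_avg P E))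
      \<le> (\<Sum>E\<in>edges P. \<Sum>K\<in>?inc E. G E K)"
    by (rule sum_mono)
  also have "\<dots> = (\<Sum>K\<in>coarse_mesh P. \<Sum>E | E \<in> edges P \<and> E edge_of K. G E K)"
    by (rule sum.swap_restrict[OF finite_edges_P finite_coarse])
  also have "\<dots> = (\<Sum>K\<in>coarse_mesh P. bd_integral K (\<lambda>x. flux P K (u K) x * flux P K (u K) x) / coeff_max P K)"
    unfolding bd_integral_def sum_divide_distrib G_def
    by (intro sum.cong) (auto intro: edgesI)
  also have "\<dots> \<le> (\<Sum>K\<in>coarse_mesh P. Cinv\<^sup>2 / mesh_size P * aH_block P K (u K) (u K))"
  proof (rule sum_mono)
    fix K assume K: "K \<in> coarse_mesh P"
    show "bd_integral K (\<lambda>x. flux P K (u K) x * flux P K (u K) x) / coeff_max P K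
        \<le> Cinv\<^sup>2 / mesh_size P * aH_block P K (u K) (u K)"
      using flux_bound[OF K XD[OF u K]] coeff_max_ge1[OF K] by (simp add: field_simps)
  qed
  also have "\<dots> = Cinv\<^sup>2 / mesh_size P * aH P u u"
    by (simp add: aH_def sum_distrib_left)
  finally show ?thesis .
qed

text \<open>
  Young's inequality with the weight \<open>q d\<close>, where \<open>q = Cinv / sqrt (penalty P)\<close> and \<open>d\<close> is the
  penalty factor, balances the two sides: the flux part becomes \<open>q\<close> times the volume energy and the jump
  part becomes \<open>q\<close> times the penalty energy.
\<close>
lemma consist_bound:
  assumes u: "u \<in> X"
  shows "\<bar>2 * consist u u\<bar> \<le> Cinv / sqrt (penalty P) * dg_energy u u"
proof -
  define q where "q = Cinv / sqrt (penalty P)"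
  have sp: "sqrt (penalty P) > 0"
    using penalty_pos by simp
  have q: "q > 0" "q\<^sup>2 = Cinv\<^sup>2 / penalty P"
    using sp inverse_ineq(1) penalty_pos by (auto simp: q_def power_divide)
  define d where "d = penalty P / mesh_size P"
  have d: "d > 0"
    using penalty_pos mesh_size_pos by (simp add: d_def)
  have edge: "\<bar>2 * edge_integral E (\<lambda>x. eflux E u x * jump P E u x)\<bar> \<le>
      1 / (q * d) * edge_integral E (\<lambda>x. eflux E u x * eflux E u x / coeff_avg P E) + q * jump_form E u u"
    if E: "E \<in> edges P" for E
  proof -
    note ei = edge_is_edge[OF E]
    define k where "k = coeff_avg P E"
    have k: "k > 0"
      using coeff_avg_ge1[OF E] by (simp add: k_def)
    have ce: "continuous_on E (eflux E u)" and cj: "continuous_on E (jump P E u)"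
      using eflux_continuous[OF E u] X_continuous(1)[OF u E] .
    let ?R = "\<lambda>x. 1 / (q * d) * (eflux E u x * eflux E u x / k) + (q * d) * (k * jump P E u x * jump P E u x)"
    have young: "\<bar>2 * (f * j)\<bar> \<le> 1 / (q * d) * (f * f / k) + (q * d) * (k * j * j)" for f j
    proof -
      define c where "c = q * d * k"
      have c: "c > 0"
        using q d k by (simp add: c_def)
      have "0 \<le> (\<bar>f\<bar> - c * \<bar>j\<bar>)\<^sup>2" by simp
      then have "2 * \<bar>f\<bar> * \<bar>j\<bar> * c \<le> f * f + c * c * (j * j)"
        by (simp add: power2_eq_square algebra_simps)
      then have "2 * \<bar>f\<bar> * \<bar>j\<bar> \<le> f * f / c + c * (j * j)"
        using c by (simp add: field_simps)
      then show ?thesis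
        using q d k by (simp add: c_def abs_mult mult_ac)
    qed
    have R: "edge_integral E ?R = 1 / (q * d) * edge_integral E (\<lambda>x. eflux E u x * eflux E u x / k)
        + (q * d) * edge_integral E (\<lambda>x. k * jump P E u x * jump P E u x)"
      using ce cj k by (subst edge_integral_add[OF ei])
        (auto intro!: continuous_intros simp only: edge_integral_cmult[OF ei] refl)
    have cR: "continuous_on E ?R"
      using ce cj k by (intro continuous_intros) auto
    have "2 * edge_integral E (\<lambda>x. eflux E u x * jump P E u x) \<le> edge_integral E ?R"
      unfolding edge_integral_cmult[OF ei, symmetric]
      using ce cj young by (intro edge_integral_mono[OF ei _ cR] continuous_intros) (auto simp: abs_le_iff)
    moreover have "(-2) * edge_integral E (\<lambda>x. eflux E u x * jump P E u x) \<le> edge_integral E ?R"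
      unfolding edge_integral_cmult[OF ei, symmetric]
      using ce cj young by (intro edge_integral_mono[OF ei _ cR] continuous_intros) (auto simp: abs_le_iff)
    ultimately have "\<bar>2 * edge_integral E (\<lambda>x. eflux E u x * jump P E u x)\<bar> \<le> edge_integral E ?R"
      by (simp add: abs_le_iff)
    then show ?thesis
      unfolding R by (simp add: jump_form_def k_def d_def mult.assoc)
  qed
  have "\<bar>2 * consist u u\<bar> \<le> (\<Sum>E\<in>edges P. \<bar>2 * edge_integral E (\<lambda>x. eflux E u x * jump P E u x)\<bar>)"
    unfolding consist_def sum_distrib_left by (rule sum_abs)
  also have "\<dots> \<le> (\<Sum>E\<in>edges P. 1 / (q * d) * edge_integral E (\<lambda>x. eflux E u x * eflux E u x / coeff_avg P E)
      + q * jump_form E u u)"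
    using edge by (rule sum_mono)
  also have "\<dots> = 1 / (q * d) * (\<Sum>E\<in>edges P. edge_integral E (\<lambda>x. eflux E u x * eflux E u x / coeff_avg P E))
      + q * jump_energy u u"
    by (simp add: sum.distrib sum_distrib_left jump_energy_def)
  also have "\<dots> \<le> 1 / (q * d) * (Cinv\<^sup>2 / mesh_size P * aH P u u) + q * jump_energy u u"
    using eflux_weighted_bound[OF u] q d by (intro add_right_mono mult_left_mono) auto
  also have "1 / (q * d) * (Cinv\<^sup>2 / mesh_size P * aH P u u) = q * aH P u u"
  proof -
    have "Cinv\<^sup>2 / mesh_size P = q\<^sup>2 * d"
      using q(2) penalty_pos by (simp add: d_def)
    then show ?thesis
      using q(1) d by (simp add: power2_eq_square)
  qed
  finally show ?thesis
    by (simp add: dg_energy_def q_def distrib_left)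
qed

lemma aDG_bounds:
  assumes u: "u \<in> X"
  shows "(1 - Cinv / sqrt (penalty P)) * dg_energy u u \<le> aDG P u u"
    "aDG P u u \<le> (1 + Cinv / sqrt (penalty P)) * dg_energy u u"
  using consist_bound[OF u] by (simp_all add: aDG_eq[OF u u] abs_le_iff algebra_simps)

lemma Cinv_ratio: "0 < 1 - Cinv / sqrt (penalty P)"
proof -
  have "sqrt (Cinv\<^sup>2) < sqrt (penalty P)"
    using penalty by (rule real_sqrt_less_mono)
  then have "Cinv < sqrt (penalty P)"
    using inverse_ineq(1) by simp
  moreover have "0 < sqrt (penalty P)"
    using penalty_pos by simp
  ultimately show ?thesis
    by simp
qed

lemma psd_form_aDG: "psd_form dgscale X (aDG P)"
proof -
  interpret D: psd_form dgscale X dg_energy by (rule psd_form_dg_energy)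
  show ?thesis
  proof unfold_locales
    show "dgv.subspace X" by (rule subspace_X)
    show "aDG P (u + v) w = aDG P u w + aDG P v w" if "u \<in> X" "v \<in> X" "w \<in> X" for u v w
      using that by (simp add: aDG_eq D.V_closed D.add_left consist_add_left consist_add_right)
    show "aDG P (dgscale c u) v = c * aDG P u v" if "u \<in> X" "v \<in> X" for c u v
      using that by (simp add: aDG_eq D.V_closed D.scale_left consist_scale algebra_simps)
    show "aDG P u v = aDG P v u" if "u \<in> X" "v \<in> X" for u v
      using that D.sym[OF that] by (simp add: aDG_eq)
    show "0 \<le> aDG P u u" if "u \<in> X" for u
      using aDG_bounds(1)[OF that] Cinv_ratio D.nonneg[OF that]
      by (smt (verit) mult_nonneg_nonneg)
  qed
qed

end

context dg_problem
begin

section \<open>The local forms of a neighborhood\<close>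
lemma pou_props:
  assumes "K \<in> coarse_mesh P" "y \<in> vertices K"
  shows "\<exists>C. C-lipschitz_on K (pou P K y)" "AE x in lebesgue_on K. pou P K y differentiable (at x)"
    "x \<in> K \<Longrightarrow> 0 \<le> pou P K y x" "pou P K y y = 1"
    "y' \<in> vertices K \<Longrightarrow> y' \<noteq> y \<Longrightarrow> pou P K y y' = 0"
    "x \<in> K \<Longrightarrow> (\<Sum>y\<in>vertices K. pou P K y x) = 1"
  using pou assms unfolding partition_of_unity_def by blast+

lemma pou_block_space:
  assumes K: "K \<in> coarse_mesh P" and z: "z \<in> vertices K"
  shows "pou P K z \<in> block_space K"
proof -
  interpret b: block K "fine_in K" "kappa P" by (rule block_K[OF K])
  have lip: "lipschitz_fun K (pou P K z)"
    using pou_props(1)[OF K z] by (simp add: lipschitz_fun_def)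
  have "lipschitz_fun \<tau> (pou P K z)" if "\<tau> \<in> fine_in K" for \<tau>
    using lip by (rule lipschitz_fun_subset) (use that in \<open>simp add: fine_in_def\<close>)
  then show ?thesis
    using lipschitz_fun_continuous[OF lip] pou_props(2)[OF K z] by (simp add: block_space_def b.H_def)
qed

lemma pou_range:
  assumes K: "K \<in> coarse_mesh P" and z: "z \<in> vertices K" and x: "x \<in> K"
  shows "0 \<le> pou P K z x \<and> pou P K z x \<le> 1"
proof
  show "0 \<le> pou P K z x"
    by (rule pou_props(3)[OF K z x])
  have "pou P K z x \<le> (\<Sum>y\<in>vertices K. pou P K y x)"
    using vertices_finite[OF K] pou_props(3)[OF K _ x] z by (intro member_le_sum) auto
  then show "pou P K z x \<le> 1"
    using pou_props(6)[OF K z x] by simp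
qed

lemma block_space_mult: "K \<in> coarse_mesh P \<Longrightarrow> u \<in> block_space K \<Longrightarrow> v \<in> block_space K \<Longrightarrow> (\<lambda>x. u x * v x) \<in> block_space K"
  using block.H_mult[OF block_K] by (simp add: block_space_def)

lemma block_space_zero: "K \<in> coarse_mesh P \<Longrightarrow> (\<lambda>x. 0) \<in> block_space K"
  using block.H_const[OF block_K] by (simp add: block_space_def)

text \<open>
  The sum over the blocks of a neighborhood of the products with the partition of unity functions of
  its node.
\<close>
definition cutoff :: "pt \<Rightarrow> dgfun \<Rightarrow> dgfun"
  where "cutoff z w = (\<lambda>K x. if K \<in> omega_blocks P z then pou P K z x * w K x else 0)"

lemma omega_blocks_vertex: "K \<in> omega_blocks P z \<Longrightarrow> z \<in> vertices K"
  by (simp add: omega_blocks_eq)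

lemma cutoff_block: "K \<in> omega_blocks P z \<Longrightarrow> cutoff z w K = (\<lambda>x. pou P K z x * w K x)"
  "K \<notin> omega_blocks P z \<Longrightarrow> cutoff z w K = (\<lambda>x. 0)"
  by (simp_all add: cutoff_def)

lemma cutoff_X:
  assumes w: "w \<in> X"
  shows "cutoff z w \<in> X"
  unfolding X_def mem_Collect_eq
proof (intro conjI ballI allI impI)
  show "cutoff z w K \<in> block_space K" if K: "K \<in> coarse_mesh P" for K
  proof (cases "K \<in> omega_blocks P z")
    case True
    then show ?thesis
      using block_space_mult[OF K pou_block_space[OF K omega_blocks_vertex[OF True]] XD[OF w K]] by (simp add: cutoff_block)
  next
    case False
    then show ?thesis
      using block_space_zero[OF K] by (simp add: cutoff_block)
  qed
  show "cutoff z w K = 0" if "K \<notin> coarse_mesh P" for K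
  proof -
    have "K \<notin> omega_blocks P z"
      using that omega_blocks_coarse by blast
    then show ?thesis
      by (simp add: cutoff_def zero_fun_def)
  qed
qed

lemma chi_mult_X:
  assumes w: "w \<in> X" and K: "K \<in> omega_blocks P z"
  shows "chi_mult P z K w \<in> X"
  unfolding X_def mem_Collect_eq
proof (intro conjI ballI allI impI)
  note Kc = omega_blocks_coarse[OF K]
  show "chi_mult P z K w K' \<in> block_space K'" if K': "K' \<in> coarse_mesh P" for K'
  proof (cases "K' = K")
    case True
    then show ?thesis
      using block_space_mult[OF Kc pou_block_space[OF Kc omega_blocks_vertex[OF K]] XD[OF w Kc]]
      by (simp add: chi_mult_def)
  next
    case False
    then show ?thesis
      using block_space_zero[OF K'] by (simp add: chi_mult_def)
  qed
  show "chi_mult P z K w K' = 0" if "K' \<notin> coarse_mesh P" for K'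
    using that Kc by (auto simp: chi_mult_def zero_fun_def)
qed

lemma dgfun_sum_apply: "(\<Sum>i\<in>I. f i) K x = (\<Sum>i\<in>I. f i K x)" for f :: "'i \<Rightarrow> dgfun"
  by (induction I rule: infinite_finite_induct) auto

lemma sum_chi_mult: "(\<Sum>K\<in>omega_blocks P z. chi_mult P z K v) = cutoff z v"
proof (intro ext)
  fix K x
  have "(\<Sum>K'\<in>omega_blocks P z. chi_mult P z K' v) K x
      = (\<Sum>K'\<in>omega_blocks P z. if K = K' then pou P K z x * v K x else 0)"
    unfolding dgfun_sum_apply by (intro sum.cong) (auto simp: chi_mult_def)
  then show "(\<Sum>K'\<in>omega_blocks P z. chi_mult P z K' v) K x = cutoff z v K x"
    using finite_omega_blocks by (simp add: cutoff_def)
qed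

lemma cutoff_add: "cutoff z (u + v) = cutoff z u + cutoff z v"
  and cutoff_scale: "cutoff z (dgscale c u) = dgscale c (cutoff z u)"
  by (auto simp: cutoff_def dgscale_def fun_eq_iff distrib_left)

lemma omega_edges_sub: "omega_edges P z \<subseteq> edges P"
  by (auto simp: omega_edges_def)

lemma finite_omega_edges: "finite (omega_edges P z)"
  using finite_subset[OF omega_edges_sub finite_edges_P] .

lemma aomega_eq:
  "aomega P z u v = (\<Sum>K\<in>omega_blocks P z. aH_block P K (u K) (v K)) + (\<Sum>E\<in>omega_edges P z. jump_form E u v)"
  by (simp add: aomega_def jump_form_def)

lemma psd_form_aomega: "psd_form dgscale X (aomega P z)"
proof -
  have "psd_form dgscale X (\<lambda>u v. (\<Sum>K\<in>omega_blocks P z. aH_block P K (u K) (v K)) +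
      (\<Sum>E\<in>omega_edges P z. jump_form E u v))"
  proof (rule psd_form_add)
    show "psd_form dgscale X (\<lambda>u v. \<Sum>K\<in>omega_blocks P z. aH_block P K (u K) (v K))"
      by (rule psd_form_sum[OF finite_omega_blocks dgv.vector_space_axioms subspace_X])
        (rule psd_form_on_block[OF omega_blocks_coarse psd_form_aH_block[OF omega_blocks_coarse]])
    show "psd_form dgscale X (\<lambda>u v. \<Sum>E\<in>omega_edges P z. jump_form E u v)"
      by (rule psd_form_sum[OF finite_omega_edges dgv.vector_space_axioms subspace_X])
        (rule psd_form_jump[OF omega_edge(1)])
  qed
  then show ?thesis
    by (simp only: aomega_eq[abs_def])
qed

definition weight :: "pt set \<Rightarrow> pt \<Rightarrow> (pt \<Rightarrow> real) \<Rightarrow> (pt \<Rightarrow> real) \<Rightarrow> real"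
  where "weight K z u v = (LINT x|lebesgue_on K. kappa P x * (norm (grad (pou P K z) x))\<^sup>2 * u x * v x)"

lemma weight_eq: "K \<in> coarse_mesh P \<Longrightarrow> weight K z = block.weight_form K (kappa P) (pou P K z)"
  by (intro ext) (simp add: weight_def block.weight_form_def[OF block_K])

definition mass_form :: "pt \<Rightarrow> pt set \<Rightarrow> dgfun \<Rightarrow> dgfun \<Rightarrow> real"
  where "mass_form z E u v = penalty P / mesh_size P *
    edge_integral E (\<lambda>x. coeff_avg P E * (jump P E (\<lambda>K. pou P K z) x)\<^sup>2 * avg P E u x * avg P E v x)"

lemma somega_eq:
  "somega P z u v = (\<Sum>K\<in>omega_blocks P z. weight K z (u K) (v K)) + (\<Sum>E\<in>omega_edges P z. mass_form z E u v)"
  by (simp add: somega_def weight_def mass_form_def)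

lemma omega_edge_continuous:
  assumes E: "E \<in> omega_edges P z"
    and c: "\<And>K. K \<in> omega_blocks P z \<Longrightarrow> continuous_on K (u K)"
  shows "continuous_on E (jump P E u)"
proof -
  note o = omega_edge[OF E]
  have "continuous_on E (u (plus_block P E))" "continuous_on E (u (minus_block P E))"
    using continuous_on_subset[OF c[OF o(3)] edge_in_blocks(2)[OF o(1)]]
      continuous_on_subset[OF c[OF o(4)] edge_in_blocks(4)[OF o(1,2)]] by auto
  moreover have "jump P E u = (\<lambda>x. u (plus_block P E) x - u (minus_block P E) x)"
    using o(2) by (simp add: fun_eq_iff jump_def)
  ultimately show ?thesis
    by (auto intro!: continuous_intros)
qed

lemma pou_jump_continuous: "E \<in> omega_edges P z \<Longrightarrow> continuous_on E (jump P E (\<lambda>K. pou P K z))"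
  by (erule omega_edge_continuous)
    (rule block_space_continuous[OF omega_blocks_coarse pou_block_space[OF omega_blocks_coarse omega_blocks_vertex]])

lemma psd_form_mass:
  assumes E: "E \<in> omega_edges P z"
  shows "psd_form dgscale X (mass_form z E)"
proof -
  note EP = omega_edge(1)[OF E]
  have c1: "0 \<le> coeff_avg P E"
    using coeff_avg_ge1[OF EP] by simp
  have "psd_form dgscale X (\<lambda>u v. edge_integral E
      (\<lambda>x. (coeff_avg P E * (jump P E (\<lambda>K. pou P K z) x)\<^sup>2) * avg P E u x * avg P E v x))"
  proof (rule psd_form_edge[OF EP])
    show "continuous_on E (\<lambda>x. coeff_avg P E * (jump P E (\<lambda>K. pou P K z) x)\<^sup>2)"
      using pou_jump_continuous[OF E] by (intro continuous_intros)
    show "0 \<le> coeff_avg P E * (jump P E (\<lambda>K. pou P K z) x)\<^sup>2" for x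
      using c1 by simp
    show "continuous_on E (avg P E u)" if "u \<in> X" for u
      by (rule X_continuous(2)[OF that EP])
    show "avg P E (u + v) x = avg P E u x + avg P E v x" for u v x
      by (rule avg_add)
    show "avg P E (dgscale c u) x = c * avg P E u x" for u c x
      by (rule avg_scale)
  qed
  then show ?thesis
    unfolding mass_form_def
    by (rule psd_form.psd_form_cmult) (use penalty_pos mesh_size_pos in simp)
qed

lemma psd_form_weight_K:
  assumes "K \<in> omega_blocks P z"
  shows "psd_form fscale (block_space K) (weight K z)"
  using block.psd_form_weight[OF block_K[OF omega_blocks_coarse[OF assms]]]
    pou_block_space[OF omega_blocks_coarse[OF assms] omega_blocks_vertex[OF assms]]
  by (simp add: block_space_def weight_eq[OF omega_blocks_coarse[OF assms]])

lemma psd_form_somega: "psd_form dgscale X (somega P z)"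
proof -
  have "psd_form dgscale X (\<lambda>u v. (\<Sum>K\<in>omega_blocks P z. weight K z (u K) (v K)) +
      (\<Sum>E\<in>omega_edges P z. mass_form z E u v))"
  proof (rule psd_form_add)
    show "psd_form dgscale X (\<lambda>u v. \<Sum>K\<in>omega_blocks P z. weight K z (u K) (v K))"
      by (rule psd_form_sum[OF finite_omega_blocks dgv.vector_space_axioms subspace_X])
        (rule psd_form_on_block[OF omega_blocks_coarse psd_form_weight_K])
    show "psd_form dgscale X (\<lambda>u v. \<Sum>E\<in>omega_edges P z. mass_form z E u v)"
      by (rule psd_form_sum[OF finite_omega_edges dgv.vector_space_axioms subspace_X])
        (rule psd_form_mass)
  qed
  then show ?thesis
    by (simp only: somega_eq[abs_def])
qed

text \<open>
  On an edge, the jump of a product is the average of one factor times the jump of the other plus the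
  reverse, and averages of partition of unity functions are at most 1.
\<close>
lemma cutoff_bound:
  assumes w: "w \<in> X"
  shows "aomega P z (cutoff z w) (cutoff z w) \<le> 2 * (aomega P z w w + somega P z w w)"
proof -
  have vol: "aH_block P K (cutoff z w K) (cutoff z w K) \<le> 2 * (aH_block P K (w K) (w K) + weight K z (w K) (w K))"
    if Ko: "K \<in> omega_blocks P z" for K
  proof -
    note K = omega_blocks_coarse[OF Ko] and z = omega_blocks_vertex[OF Ko]
    interpret b: block K "fine_in K" "kappa P" by (rule block_K[OF K])
    show ?thesis
      using b.energy_product_bound[of "pou P K z" "w K"] pou_block_space[OF K z] XD[OF w K] pou_range[OF K z]
      by (simp add: cutoff_block(1)[OF Ko] aH_block_energy[OF K] weight_eq[OF K] block_space_def)
  qed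
  have edge: "jump_form E (cutoff z w) (cutoff z w) \<le> 2 * (jump_form E w w + mass_form z E w w)"
    if E: "E \<in> omega_edges P z" for E
  proof -
    note o = omega_edge[OF E] and ei = edge_is_edge[OF omega_edge(1)[OF E]]
    define k where "k = coeff_avg P E"
    have k: "k \<ge> 0"
      using coeff_avg_ge1[OF o(1)] by (simp add: k_def)
    define p m where "p = plus_block P E" and "m = minus_block P E"
    let ?j = "jump P E (\<lambda>K. pou P K z)"
    note cj = pou_jump_continuous[OF E] and cw = X_continuous[OF w o(1)]
      and cW = X_continuous(1)[OF cutoff_X[OF w] o(1)]
    have c1: "continuous_on E (\<lambda>x. k * jump P E w x * jump P E w x)"
      using cw by (intro continuous_intros)
    have c2: "continuous_on E (\<lambda>x. k * (?j x)\<^sup>2 * avg P E w x * avg P E w x)"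
      using cw cj by (intro continuous_intros)
    have "edge_integral E (\<lambda>x. k * jump P E (cutoff z w) x * jump P E (cutoff z w) x) \<le>
        edge_integral E (\<lambda>x. 2 * (k * jump P E w x * jump P E w x + k * (?j x)\<^sup>2 * avg P E w x * avg P E w x))"
    proof (rule edge_integral_mono[OF ei])
      show "continuous_on E (\<lambda>x. k * jump P E (cutoff z w) x * jump P E (cutoff z w) x)"
        using cW by (intro continuous_intros)
      show "continuous_on E (\<lambda>x. 2 * (k * jump P E w x * jump P E w x + k * (?j x)\<^sup>2 * avg P E w x * avg P E w x))"
        using continuous_on_add[OF c1 c2] by (rule continuous_on_mult_left)
      fix x assume x: "x \<in> E"
      have xin: "x \<in> p" "x \<in> m"
        using x edge_in_blocks(2)[OF o(1)] edge_in_blocks(4)[OF o(1,2)] by (auto simp: p_def m_def)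
      define cp cm wp wm where "cp = pou P p z x" and "cm = pou P m z x" and "wp = w p x" and "wm = w m x"
      have r: "0 \<le> cp \<and> cp \<le> 1" "0 \<le> cm \<and> cm \<le> 1"
        using pou_range[OF omega_blocks_coarse[OF o(3)] omega_blocks_vertex[OF o(3)]]
          pou_range[OF omega_blocks_coarse[OF o(4)] omega_blocks_vertex[OF o(4)]] xin
        by (auto simp: cp_def cm_def p_def m_def)
      have jW: "jump P E (cutoff z w) x = cp * wp - cm * wm"
        using o by (simp add: jump_def cutoff_def p_def m_def cp_def cm_def wp_def wm_def)
      have jw: "jump P E w x = wp - wm" and aw: "avg P E w x = (wp + wm) / 2" and jc: "?j x = cp - cm"
        using o by (simp_all add: jump_def avg_def p_def m_def cp_def cm_def wp_def wm_def)
      \<comment> \<open>\<open>[cw] = {c} [w] + [c] {w}\<close>\<close>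
      define s t where "s = (cp + cm) / 2 * (wp - wm)" and "t = (cp - cm) * ((wp + wm) / 2)"
      have st: "cp * wp - cm * wm = s + t"
        by (simp add: s_def t_def field_simps)
      have "0 \<le> (s - t) * (s - t)"
        by (rule zero_le_square)
      then have "(s + t) * (s + t) \<le> 2 * (s * s + t * t)"
        by (simp add: algebra_simps)
      also have "s * s = ((cp + cm) / 2)\<^sup>2 * ((wp - wm) * (wp - wm))"
        by (simp add: s_def power2_eq_square)
      also have "\<dots> \<le> 1 * ((wp - wm) * (wp - wm))"
        using r by (intro mult_right_mono power_le_one) auto
      also have "t * t = (cp - cm)\<^sup>2 * ((wp + wm) / 2) * ((wp + wm) / 2)"
        by (simp add: t_def power2_eq_square)
      finally have "(s + t) * (s + t) \<le> 2 * ((wp - wm) * (wp - wm) + (cp - cm)\<^sup>2 * ((wp + wm) / 2) * ((wp + wm) / 2))"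
        by simp
      then have "k * ((s + t) * (s + t)) \<le> k * (2 * ((wp - wm) * (wp - wm) + (cp - cm)\<^sup>2 * ((wp + wm) / 2) * ((wp + wm) / 2)))"
        using k by (rule mult_left_mono)
      then show "k * jump P E (cutoff z w) x * jump P E (cutoff z w) x \<le>
          2 * (k * jump P E w x * jump P E w x + k * (?j x)\<^sup>2 * avg P E w x * avg P E w x)"
        unfolding jW jw aw jc st by (simp add: algebra_simps)
    qed
    also have "\<dots> = 2 * (edge_integral E (\<lambda>x. k * jump P E w x * jump P E w x) +
        edge_integral E (\<lambda>x. k * (?j x)\<^sup>2 * avg P E w x * avg P E w x))"
      by (simp only: edge_integral_cmult[OF ei] edge_integral_add[OF ei c1 c2])
    finally have le: "edge_integral E (\<lambda>x. k * jump P E (cutoff z w) x * jump P E (cutoff z w) x) \<le>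
        2 * (edge_integral E (\<lambda>x. k * jump P E w x * jump P E w x) +
        edge_integral E (\<lambda>x. k * (?j x)\<^sup>2 * avg P E w x * avg P E w x))" .
    have "0 \<le> penalty P / mesh_size P"
      using penalty_pos mesh_size_pos by simp
    from mult_left_mono[OF le this] show ?thesis
      by (simp add: jump_form_def mass_form_def k_def algebra_simps)
  qed
  have "aomega P z (cutoff z w) (cutoff z w) \<le>
      (\<Sum>K\<in>omega_blocks P z. 2 * (aH_block P K (w K) (w K) + weight K z (w K) (w K))) +
      (\<Sum>E\<in>omega_edges P z. 2 * (jump_form E w w + mass_form z E w w))"
    unfolding aomega_eq using vol edge by (intro add_mono sum_mono)
  also have "\<dots> = 2 * (aomega P z w w + somega P z w w)"
    by (simp add: aomega_eq somega_eq sum.distrib sum_distrib_left[symmetric] algebra_simps)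
  finally show ?thesis .
qed

lemma jump_form_nonneg: "u \<in> X \<Longrightarrow> E \<in> edges P \<Longrightarrow> 0 \<le> jump_form E u u"
  by (rule psd_form.nonneg[OF psd_form_jump])

lemma aH_block_nonneg: "u \<in> X \<Longrightarrow> K \<in> coarse_mesh P \<Longrightarrow> 0 \<le> aH_block P K (u K) (u K)"
  by (rule psd_form.nonneg[OF psd_form_aH_block]) (auto intro: XD)

lemma aomega_zero:
  assumes v: "v \<in> X" and z: "aomega P z v v = 0"
  shows "K \<in> omega_blocks P z \<Longrightarrow> aH_block P K (v K) (v K) = 0"
    "E \<in> omega_edges P z \<Longrightarrow> jump_form E v v = 0"
proof -
  have a: "0 \<le> (\<Sum>K\<in>omega_blocks P z. aH_block P K (v K) (v K))"
    by (intro sum_nonneg aH_block_nonneg[OF v] omega_blocks_coarse)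
  have j: "0 \<le> (\<Sum>E\<in>omega_edges P z. jump_form E v v)"
    by (intro sum_nonneg jump_form_nonneg[OF v] omega_edge(1))
  have "(\<Sum>K\<in>omega_blocks P z. aH_block P K (v K) (v K)) = 0" "(\<Sum>E\<in>omega_edges P z. jump_form E v v) = 0"
    using a j z by (simp_all add: aomega_eq add_nonneg_eq_0_iff)
  then show "K \<in> omega_blocks P z \<Longrightarrow> aH_block P K (v K) (v K) = 0"
    "E \<in> omega_edges P z \<Longrightarrow> jump_form E v v = 0"
    using sum_nonneg_eq_0_iff[OF finite_omega_blocks aH_block_nonneg[OF v omega_blocks_coarse]]
      sum_nonneg_eq_0_iff[OF finite_omega_edges jump_form_nonneg[OF v omega_edge(1)]] by auto
qed

lemma aH_block_zero_constant:
  assumes K: "K \<in> coarse_mesh P" and u: "u \<in> block_space K" "aH_block P K u u = 0" and xy: "x \<in> K" "y \<in> K"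
  shows "u x = u y"
  using block.energy_zero_imp_constant[OF block_K[OF K] _ _ xy] u by (simp add: block_space_def aH_block_energy[OF K])

lemma aomega_zero_constant:
  assumes v: "v \<in> X" and a: "aomega P z v v = 0" and K: "K \<in> omega_blocks P z" and xy: "x \<in> K" "y \<in> K"
  shows "v K x = v K y"
  using aH_block_zero_constant[OF omega_blocks_coarse[OF K] XD[OF v omega_blocks_coarse[OF K]]
    aomega_zero(1)[OF v a K] xy] .

lemma VDG_outside: "v \<in> VDG P \<Longrightarrow> x \<notin> K \<Longrightarrow> v K x = 0"
  by (cases "K \<in> coarse_mesh P") (auto simp: VDG_def Vh_def Qspace_def)

text \<open>
  The product is constant on each block and vanishes at a vertex other than \<open>z\<close>.
\<close>
lemma cutoff_null:
  assumes v: "v \<in> VDG P" and a: "aomega P z (cutoff z v) (cutoff z v) = 0"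
  shows "cutoff z v = 0"
proof (intro ext)
  fix K x
  have vX: "v \<in> X"
    using v VDG_subset by blast
  show "cutoff z v K x = 0 K x"
  proof (cases "K \<in> omega_blocks P z \<and> x \<in> K")
    case True
    note K = omega_blocks_coarse[of K z]
    obtain y where y: "y \<in> vertices K" "y \<noteq> z"
      using other_vertex[of K z] K True by blast
    have "cutoff z v K x = cutoff z v K y"
      using aomega_zero_constant[OF cutoff_X[OF vX] a _ _ vertex_in[OF y(1)]] True by blast
    also have "\<dots> = 0"
      using True K pou_props(5)[of K z y] y omega_blocks_vertex by (simp add: cutoff_def)
    finally show ?thesis by simp
  next
    case False
    then show ?thesis
      using VDG_outside[OF v, of x K] by (auto simp: cutoff_def)
  qed
qed

lemma aomega_zero_global_constant:
  assumes v: "v \<in> X" and a: "aomega P z v v = 0" and z: "z \<in> nodes P"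
  shows "\<exists>c. \<forall>K\<in>omega_blocks P z. \<forall>x\<in>K. v K x = c"
proof -
  define c where "c K = v K z" for K
  have const: "v K x = c K" if "K \<in> omega_blocks P z" "x \<in> K" for K x
    unfolding c_def using that
    by (intro aomega_zero_constant[OF v a]) (auto intro: vertex_in omega_blocks_vertex)
  have same: "c (plus_block P E) = c (minus_block P E)" if E: "E \<in> omega_edges P z" for E
  proof -
    note o = omega_edge[OF E] and ei = edge_is_edge[OF omega_edge(1)[OF E]]
    have "E \<noteq> {}"
      using edge_path_image[OF ei] by force
    then obtain x where x: "x \<in> E" by blast
    have k: "coeff_avg P E > 0"
      using coeff_avg_ge1[OF o(1)] by simp
    have "edge_integral E (\<lambda>x. coeff_avg P E * jump P E v x * jump P E v x) = 0"
      using aomega_zero(2)[OF v a E] penalty_pos mesh_size_pos by (simp add: jump_form_def)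
    then have "coeff_avg P E * jump P E v x * jump P E v x = 0"
    proof (rule edge_integral_zero_imp[OF ei _ _ _ x, rotated 2])
      show "continuous_on E (\<lambda>x. coeff_avg P E * jump P E v x * jump P E v x)"
        using X_continuous(1)[OF v o(1)] by (intro continuous_intros)
      show "0 \<le> coeff_avg P E * jump P E v x * jump P E v x" for x
        using k by (simp add: mult.assoc)
    qed
    then have "v (plus_block P E) x = v (minus_block P E) x"
      using k o(2) by (simp add: jump_def)
    then show ?thesis
      using const[OF o(3)] const[OF o(4)] x edge_in_blocks(2)[OF o(1)] edge_in_blocks(4)[OF o(1,2)]
      by (metis subsetD)
  qed
  obtain K1 where K1: "K1 \<in> omega_blocks P z"
    using z by (auto simp: nodes_def omega_blocks_eq)
  have "v K x = c K1" if "K \<in> omega_blocks P z" "x \<in> K" for K x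
    using const[OF that] omega_connected[of z c K K1, OF z same that(1) K1] by simp
  then show ?thesis by blast
qed

lemma Vomega_subset: "Vomega P z \<subseteq> VDG P"
  by (auto simp: Vomega_def)

lemma Vomega_X: "v \<in> Vomega P z \<Longrightarrow> v \<in> X"
  using Vomega_subset VDG_subset by blast

lemma subspace_Vomega: "dgv.subspace (Vomega P z)"
proof -
  have "Vomega P z = VDG P \<inter> {v. \<forall>K. K \<notin> omega_blocks P z \<longrightarrow> v K = 0}"
    by (auto simp: Vomega_def)
  moreover have "dgv.subspace {v. \<forall>K. K \<notin> omega_blocks P z \<longrightarrow> v K = 0}"
    by (intro dgv.subspaceI) (auto simp: dgscale_block fsp.scale_zero_right)
  ultimately show ?thesis
    using subspace_VDG by (simp add: dgv.subspace_inter)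
qed

lemma Vomega_eq_iff:
  assumes "u \<in> Vomega P z" "v \<in> Vomega P z" "\<And>K x. \<lbrakk>K \<in> omega_blocks P z; x \<in> K\<rbrakk> \<Longrightarrow> u K x = v K x"
  shows "u = v"
proof (intro ext)
  fix K x
  show "u K x = v K x"
  proof (cases "K \<in> omega_blocks P z")
    case True
    then show ?thesis
      using assms(3) VDG_outside[OF subsetD[OF Vomega_subset assms(1)], of x K]
        VDG_outside[OF subsetD[OF Vomega_subset assms(2)], of x K]
      by (cases "x \<in> K") auto
  next
    case False
    then show ?thesis
      using assms(1,2) by (simp add: Vomega_def)
  qed
qed

text \<open>
  A common null vector is a constant \<open>c\<close> on the neighborhood by its zero energy. The mass form gives it
  at least \<open>c\<^sup>2\<close> times the energy of a partition of unity function, which is positive because this function is 1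
  at \<open>z\<close> and 0 at another vertex.
\<close>
lemma psd_pencil_omega:
  assumes z: "z \<in> nodes P"
  shows "psd_pencil dgscale (Vomega P z) (aomega P z) (somega P z)"
proof -
  interpret A: psd_form dgscale "Vomega P z" "aomega P z"
    by (rule psd_form_subspace[OF psd_form_aomega subspace_Vomega]) (auto intro: Vomega_X)
  interpret S: psd_form dgscale "Vomega P z" "somega P z"
    by (rule psd_form_subspace[OF psd_form_somega subspace_Vomega]) (auto intro: Vomega_X)
  show ?thesis
  proof unfold_locales
    fix v assume v: "v \<in> Vomega P z" and a: "aomega P z v v = 0" and s: "somega P z v v = 0"
    note vX = Vomega_X[OF v]
    obtain c where c: "\<And>K x. \<lbrakk>K \<in> omega_blocks P z; x \<in> K\<rbrakk> \<Longrightarrow> v K x = c"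
      using aomega_zero_global_constant[OF vX a z] by blast
    obtain K where K: "K \<in> omega_blocks P z"
      using z by (auto simp: nodes_def omega_blocks_eq)
    note Kc = omega_blocks_coarse[OF K] and zK = omega_blocks_vertex[OF K]
    have "c = 0"
    proof (rule ccontr)
      assume "c \<noteq> 0"
      have w0: "0 \<le> weight K z (v K) (v K)" if "K \<in> omega_blocks P z" for K
        using psd_form.nonneg[OF psd_form_weight_K[OF that]] XD[OF vX omega_blocks_coarse[OF that]] by blast
      have "0 \<le> (\<Sum>E\<in>omega_edges P z. mass_form z E v v)"
        by (intro sum_nonneg psd_form.nonneg[OF psd_form_mass] vX)
      moreover have "0 \<le> (\<Sum>K\<in>omega_blocks P z. weight K z (v K) (v K))"
        by (intro sum_nonneg w0)
      ultimately have sum0: "(\<Sum>K\<in>omega_blocks P z. weight K z (v K) (v K)) = 0"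
        using s by (simp add: somega_eq add_nonneg_eq_0_iff)
      have "weight K z (v K) (v K) = 0"
        by (rule sum_nonneg_0[where f = "\<lambda>K. weight K z (v K) (v K)", OF finite_omega_blocks w0 sum0 K])
      moreover have "weight K z (v K) (v K) = c\<^sup>2 * aH_block P K (pou P K z) (pou P K z)"
      proof -
        have "weight K z (v K) (v K) = (LINT x|lebesgue_on K. c\<^sup>2 * (kappa P x * (grad (pou P K z) x \<bullet> grad (pou P K z) x)))"
          unfolding weight_def power2_norm_eq_inner using c[OF K]
          by (intro Bochner_Integration.integral_cong) (auto simp: power2_eq_square)
        then show ?thesis
          by (simp add: aH_block_def)
      qed
      ultimately have "aH_block P K (pou P K z) (pou P K z) = 0"
        using \<open>c \<noteq> 0\<close> by simp
      moreover obtain y where y: "y \<in> vertices K" "y \<noteq> z"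
        using other_vertex[OF Kc] by blast
      ultimately have "pou P K z z = pou P K z y"
        using aH_block_zero_constant[OF Kc pou_block_space[OF Kc zK]] vertex_in zK by blast
      then show False
        using pou_props(4,5)[OF Kc zK] y by simp
    qed
    then show "v = 0"
      using c by (intro Vomega_eq_iff[OF v] A.V_closed) auto
  qed
qed

text \<open>
  An eigenfunction for the eigenvalue 0 has zero energy and is therefore constant on the
  neighborhood, so two independent ones do not exist.
\<close>
lemma higher_eigenvalue_pos:
  assumes z: "z \<in> nodes P" and es: "eigensystem P z lam \<psi>"
    and L: "1 \<le> L" "L + 1 \<le> dgv.dim (Vomega P z)"
  shows "0 < lam (L + 1)"
proof -
  interpret pc: psd_pencil dgscale "Vomega P z" "aomega P z" "somega P z"
    by (rule psd_pencil_omega[OF z])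
  define N where "N = dgv.dim (Vomega P z)"
  have eig: "\<psi> k \<in> pc.eigenspace (lam k)" "\<psi> k \<noteq> 0" if "k \<in> {1..N}" for k
    using es that unfolding eigensystem_def eigenpair_def pc.eigenspace_def N_def Let_def by auto
  have mono: "mono_on {1..N} lam" and inj: "inj_on \<psi> {1..N}" and ind: "dgv.independent (\<psi> ` {1..N})"
    using es unfolding eigensystem_def N_def Let_def by auto
  have ge0: "0 \<le> lam k" if "k \<in> {1..N}" for k
    using pc.eigenvalue_nonneg eig that by blast
  have LN: "L \<in> {1..N}" "L + 1 \<in> {1..N}"
    using L by (auto simp: N_def)
  show ?thesis
  proof (rule ccontr)
    assume "\<not> 0 < lam (L + 1)"
    then have l1: "lam (L + 1) = 0"
      using ge0[OF LN(2)] by simp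
    have "lam L \<le> lam (L + 1)"
      using LN by (intro mono_onD[OF mono]) auto
    then have l0: "lam L = 0"
      using l1 ge0[OF LN(1)] by simp
    have V: "\<psi> L \<in> Vomega P z" "\<psi> (L + 1) \<in> Vomega P z"
      using eig(1)[OF LN(1)] eig(1)[OF LN(2)] unfolding pc.eigenspace_def by blast+
    have null: "aomega P z (\<psi> L) (\<psi> L) = 0" "aomega P z (\<psi> (L + 1)) (\<psi> (L + 1)) = 0"
      using pc.eigenspace_zero_null eig(1)[OF LN(1)] eig(1)[OF LN(2)] l0 l1 by auto
    obtain c where c: "\<And>K x. \<lbrakk>K \<in> omega_blocks P z; x \<in> K\<rbrakk> \<Longrightarrow> \<psi> L K x = c"
      using aomega_zero_global_constant[OF Vomega_X[OF V(1)] null(1) z] by blast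
    obtain d where d: "\<And>K x. \<lbrakk>K \<in> omega_blocks P z; x \<in> K\<rbrakk> \<Longrightarrow> \<psi> (L + 1) K x = d"
      using aomega_zero_global_constant[OF Vomega_X[OF V(2)] null(2) z] by blast
    have "c \<noteq> 0"
    proof
      assume "c = 0"
      then have "\<psi> L = 0"
        using c by (intro Vomega_eq_iff[OF V(1)] pc.A.V_closed) auto
      then show False
        using eig(2)[OF LN(1)] by simp
    qed
    have "\<psi> (L + 1) = dgscale (d / c) (\<psi> L)"
      using c d \<open>c \<noteq> 0\<close>
      by (intro Vomega_eq_iff[OF V(2)] pc.A.V_closed V) (auto simp: dgscale_def)
    moreover have "\<psi> L \<noteq> \<psi> (L + 1)"
      using inj_onD[OF inj _ LN] by auto
    then have "\<psi> L \<in> \<psi> ` {1..N} - {\<psi> (L + 1)}"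
      using LN by blast
    ultimately have "\<psi> (L + 1) \<in> dgv.span (\<psi> ` {1..N} - {\<psi> (L + 1)})"
      using dgv.span_scale[OF dgv.span_base] by metis
    then show False
      using ind LN(2) unfolding dgv.dependent_def by blast
  qed
qed

text \<open>
  This combines the spectral estimate with the bound for multiplication by the partition of unity.
\<close>
lemma local_projection:
  assumes z: "z \<in> nodes P" and es: "eigensystem P z lam \<psi>"
    and L: "1 \<le> L" "L + 1 \<le> dgv.dim (Vomega P z)" and e: "e \<in> Vomega P z"
  shows "\<exists>p \<in> dgv.span (\<psi> ` {1..L}).
    aomega P z (cutoff z (e - p)) (cutoff z (e - p)) \<le> 2 * (1 + real_of_ereal (1 / lam (L + 1))) * aomega P z e e"
proof -
  interpret pc: psd_pencil dgscale "Vomega P z" "aomega P z" "somega P z"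
    by (rule psd_pencil_omega[OF z])
  define N where "N = dgv.dim (Vomega P z)"
  define c where "c = real_of_ereal (1 / lam (L + 1))"
  note pos = higher_eigenvalue_pos[OF z es L]
  have c0: "0 \<le> c"
    unfolding c_def using pos by (cases "lam (L + 1)") (auto simp: one_ereal_def divide_ereal_def)
  have eig: "\<psi> k \<in> pc.eigenspace (lam k)" "\<psi> k \<noteq> 0" if "k \<in> {1..N}" for k
    using es that unfolding eigensystem_def eigenpair_def pc.eigenspace_def N_def Let_def by auto
  have mono: "mono_on {1..N} lam" and span: "dgv.span (\<psi> ` {1..N}) = Vomega P z"
    using es unfolding eigensystem_def N_def Let_def by auto
  obtain p where p: "p \<in> dgv.span (\<psi> ` {1..L})"
    and le: "aomega P z (e - p) (e - p) \<le> aomega P z e e"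
    and sle: "somega P z (e - p) (e - p) \<le> c * aomega P z (e - p) (e - p)"
    using pc.spectral_projection[OF eig mono span _ pos e] L unfolding N_def c_def by blast
  have "dgv.span (\<psi> ` {1..L}) \<subseteq> dgv.span (\<psi> ` {1..N})"
    using L by (intro dgv.span_mono image_mono) (auto simp: N_def)
  then have "p \<in> Vomega P z"
    using p span by blast
  then have "e - p \<in> Vomega P z"
    by (intro pc.A.V_closed e)
  then have "e - p \<in> X"
    by (rule Vomega_X)
  then have "aomega P z (cutoff z (e - p)) (cutoff z (e - p)) \<le> 2 * (aomega P z (e - p) (e - p) + somega P z (e - p) (e - p))"
    by (rule cutoff_bound)
  also have "\<dots> \<le> 2 * ((1 + c) * aomega P z (e - p) (e - p))"
    using sle by (simp add: algebra_simps)
  also have "\<dots> \<le> 2 * ((1 + c) * aomega P z e e)"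
    using le c0 by (intro mult_left_mono) auto
  also have "\<dots> = 2 * (1 + c) * aomega P z e e"
    by (simp only: mult.assoc)
  finally show ?thesis
    using p unfolding c_def by blast
qed

text \<open>
  A block belongs exactly to the neighborhoods of its own vertices, and an edge is interior at most
  to the neighborhoods of the vertices of its plus block.
\<close>
lemma overlap:
  assumes u: "u \<in> X"
  shows "(\<Sum>z\<in>nodes P. aomega P z u u) \<le> real (max_vertices P) * dg_energy u u"
proof -
  let ?C = "real (max_vertices P)"
  have vol: "(\<Sum>z\<in>nodes P. \<Sum>K\<in>omega_blocks P z. aH_block P K (u K) (u K)) \<le> ?C * aH P u u"
  proof -
    have "(\<Sum>z\<in>nodes P. \<Sum>K\<in>omega_blocks P z. aH_block P K (u K) (u K)) =
        (\<Sum>z\<in>nodes P. \<Sum>K | K \<in> coarse_mesh P \<and> z \<in> vertices K. aH_block P K (u K) (u K))"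
      by (simp add: omega_blocks_eq)
    also have "\<dots> = (\<Sum>K\<in>coarse_mesh P. \<Sum>z | z \<in> nodes P \<and> z \<in> vertices K. aH_block P K (u K) (u K))"
      by (rule sum.swap_restrict[OF finite_nodes finite_coarse])
    also have "\<dots> \<le> (\<Sum>K\<in>coarse_mesh P. ?C * aH_block P K (u K) (u K))"
    proof (rule sum_mono)
      fix K assume K: "K \<in> coarse_mesh P"
      have "card {z. z \<in> nodes P \<and> z \<in> vertices K} \<le> card (vertices K)"
        using vertices_finite[OF K] by (intro card_mono) auto
      then have "real (card {z. z \<in> nodes P \<and> z \<in> vertices K}) \<le> ?C"
        using card_vertices_le[OF K] by simp
      then show "(\<Sum>z | z \<in> nodes P \<and> z \<in> vertices K. aH_block P K (u K) (u K)) \<le> ?C * aH_block P K (u K) (u K)"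
        using aH_block_nonneg[OF u K] by (simp add: mult_right_mono)
    qed
    finally show ?thesis
      by (simp add: aH_def sum_distrib_left)
  qed
  have edge: "(\<Sum>z\<in>nodes P. \<Sum>E\<in>omega_edges P z. jump_form E u u) \<le> ?C * jump_energy u u"
  proof -
    have "(\<Sum>z\<in>nodes P. \<Sum>E\<in>omega_edges P z. jump_form E u u) =
        (\<Sum>z\<in>nodes P. \<Sum>E | E \<in> edges P \<and> E \<in> omega_edges P z. jump_form E u u)"
      using omega_edges_sub by (intro sum.cong refl) auto
    also have "\<dots> = (\<Sum>E\<in>edges P. \<Sum>z | z \<in> nodes P \<and> E \<in> omega_edges P z. jump_form E u u)"
      by (rule sum.swap_restrict[OF finite_nodes finite_edges_P])
    also have "\<dots> \<le> (\<Sum>E\<in>edges P. ?C * jump_form E u u)"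
    proof (rule sum_mono)
      fix E assume E: "E \<in> edges P"
      have "{z. z \<in> nodes P \<and> E \<in> omega_edges P z} \<subseteq> vertices (plus_block P E)"
        using omega_edge(3) omega_blocks_vertex by blast
      then have "card {z. z \<in> nodes P \<and> E \<in> omega_edges P z} \<le> card (vertices (plus_block P E))"
        using vertices_finite[OF plus_block(1)[OF E]] by (rule card_mono[rotated])
      then have "real (card {z. z \<in> nodes P \<and> E \<in> omega_edges P z}) \<le> ?C"
        using card_vertices_le[OF plus_block(1)[OF E]] by simp
      then show "(\<Sum>z | z \<in> nodes P \<and> E \<in> omega_edges P z. jump_form E u u) \<le> ?C * jump_form E u u"
        using jump_form_nonneg[OF u E] by (simp add: mult_right_mono)
    qed
    finally show ?thesis
      by (simp add: jump_energy_def sum_distrib_left)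
  qed
  show ?thesis
    using vol edge by (simp add: aomega_eq sum.distrib dg_energy_def distrib_left)
qed

lemma dg_energy_Vomega0:
  assumes v: "v \<in> Vomega0 P z"
  shows "dg_energy v v = aomega P z v v"
proof -
  have vo: "v \<in> Vomega P z" and v0: "\<And>K x. \<lbrakk>K \<in> omega_blocks P z; x \<in> K; x \<in> frontier (omega P z)\<rbrakk> \<Longrightarrow> v K x = 0"
    using v by (auto simp: Vomega0_def)
  have out: "v K = 0" if "K \<notin> omega_blocks P z" for K
    using vo that by (simp add: Vomega_def)
  have aH: "aH P v v = (\<Sum>K\<in>omega_blocks P z. aH_block P K (v K) (v K))"
    unfolding aH_def
  proof (rule sum.mono_neutral_right[OF finite_coarse])
    show "omega_blocks P z \<subseteq> coarse_mesh P"
      using omega_blocks_coarse by blast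
    show "\<forall>K\<in>coarse_mesh P - omega_blocks P z. aH_block P K (v K) (v K) = 0"
    proof
      fix K assume K: "K \<in> coarse_mesh P - omega_blocks P z"
      then show "aH_block P K (v K) (v K) = 0"
        using psd_form.zero_left[OF psd_form_aH_block fsp.subspace_0[OF subspace_block_space]] out[of K] by simp
    qed
  qed
  have trace: "v K x = 0" if E: "E \<in> edges P" "E \<notin> omega_edges P z" and x: "x \<in> E"
      and K: "K = plus_block P E \<or> \<not> E \<subseteq> frontier (region P) \<and> K = minus_block P E" for E K x
  proof (cases "K \<in> omega_blocks P z")
    case True
    have "x \<in> K"
      using K x edge_in_blocks(2)[OF E(1)] edge_in_blocks(4)[OF E(1)] by blast
    then show ?thesis
      using v0[OF True _ outer_edge_frontier[OF E K True x]] by blast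
  next
    case False
    then show ?thesis using out by simp
  qed
  have jump_energy: "jump_energy v v = (\<Sum>E\<in>omega_edges P z. jump_form E v v)"
    unfolding jump_energy_def
  proof (rule sum.mono_neutral_right[OF finite_edges_P omega_edges_sub], rule ballI)
    fix E assume E: "E \<in> edges P - omega_edges P z"
    have "jump P E v x = 0" if "x \<in> E" for x
      using trace[of E x] E that by (auto simp: jump_def)
    then have "edge_integral E (\<lambda>x. coeff_avg P E * jump P E v x * jump P E v x) = edge_integral E (\<lambda>x. 0 * 0)"
      using E by (intro edge_integral_cong edge_is_edge) auto
    then show "jump_form E v v = 0"
      by (simp add: jump_form_def edge_integral_eq)
  qed
  show ?thesis
    by (simp add: dg_energy_def aomega_eq aH jump_energy)
qed

end

section \<open>Residuals\<close>
locale dg_source = dg_problem +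
  fixes f :: "pt \<Rightarrow> real"
  assumes source: "f \<in> borel_measurable (lebesgue_on (region P))"
      "integrable (lebesgue_on (region P)) (\<lambda>x. (f x)\<^sup>2)"
begin

lemma integrable_source:
  assumes K: "K \<in> coarse_mesh P" and g: "continuous_on K g"
  shows "integrable (lebesgue_on K) (\<lambda>x. f x * g x)"
proof -
  interpret b: block K "fine_in K" "kappa P" by (rule block_K[OF K])
  note sub = coarse_subset[OF K]
  obtain B where B: "0 \<le> B" "\<And>x. x \<in> K \<Longrightarrow> \<bar>g x\<bar> \<le> B"
    using continuous_bounded[OF b.rect(1) g] by blast
  have fm: "f \<in> borel_measurable (lebesgue_on K)"
    using source(1) measurable_restrict_mono sub by blast
  have sq: "integrable (lebesgue_on K) (\<lambda>x. (f x)\<^sup>2)"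
  proof -
    have "set_integrable lebesgue (region P) (\<lambda>x. (f x)\<^sup>2)"
      using source(2) rectangle_props(8)[OF region]
      by (simp add: integrable_restrict_space set_integrable_def)
    then have "set_integrable lebesgue K (\<lambda>x. (f x)\<^sup>2)"
      by (rule set_integrable_subset) (use b.rect(8) sub in auto)
    then show ?thesis
      using b.rect(8) by (simp add: integrable_restrict_space set_integrable_def)
  qed
  have one: "integrable (lebesgue_on K) (\<lambda>x. 1 :: real)"
    using finite_measure.integrable_const[OF b.finite_measure_K] .
  have "integrable (lebesgue_on K) (\<lambda>x. B * (1 + (f x)\<^sup>2))"
    using one sq by (intro Bochner_Integration.integrable_mult_right Bochner_Integration.integrable_add)
  then show ?thesis
  proof (rule Bochner_Integration.integrable_bound)
    show "(\<lambda>x. f x * g x) \<in> borel_measurable (lebesgue_on K)"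
      using fm b.continuous_measurable[OF g] by (rule borel_measurable_times)
    show "AE x in lebesgue_on K. norm (f x * g x) \<le> norm (B * (1 + (f x)\<^sup>2))"
      using b.AE_K
    proof eventually_elim
      case (elim x)
      have "0 \<le> (\<bar>f x\<bar> - 1)\<^sup>2"
        by simp
      then have "2 * \<bar>f x\<bar> \<le> 1 + (f x)\<^sup>2"
        by (simp add: power2_diff)
      then have "\<bar>f x\<bar> \<le> 1 + (f x)\<^sup>2"
        using abs_ge_zero[of "f x"] by linarith
      then have "\<bar>f x\<bar> * \<bar>g x\<bar> \<le> (1 + (f x)\<^sup>2) * B"
        using B(2)[OF elim] by (intro mult_mono) auto
      then show ?case
        using B(1) by (simp add: abs_mult mult.commute)
    qed
  qed
qed

lemma residual_add:
  assumes u: "u \<in> X" and v: "v \<in> X" "w \<in> X"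
  shows "residual P f u (v + w) = residual P f u v + residual P f u w"
proof -
  have "L2_prod P f (v + w) = L2_prod P f v + L2_prod P f w"
    unfolding L2_prod_def sum.distrib[symmetric]
  proof (rule sum.cong[OF refl])
    fix K assume K: "K \<in> coarse_mesh P"
    have "integrable (lebesgue_on K) (\<lambda>x. f x * v K x)" "integrable (lebesgue_on K) (\<lambda>x. f x * w K x)"
      using integrable_source[OF K] block_space_continuous[OF K XD[OF v(1) K]] block_space_continuous[OF K XD[OF v(2) K]]
      by auto
    then show "(LINT x|lebesgue_on K. f x * (v + w) K x) =
        (LINT x|lebesgue_on K. f x * v K x) + (LINT x|lebesgue_on K. f x * w K x)"
      by (simp add: distrib_left)
  qed
  then show ?thesis
    using psd_form.add_right[OF psd_form_aDG u v] by (simp add: residual_def)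
qed

lemma residual_scale:
  assumes u: "u \<in> X" and v: "v \<in> X"
  shows "residual P f u (dgscale c v) = c * residual P f u v"
proof -
  have "L2_prod P f (dgscale c v) = c * L2_prod P f v"
    unfolding L2_prod_def sum_distrib_left
    by (intro sum.cong refl) (simp add: dgscale_def mult.left_commute[of _ c])
  then show ?thesis
    using psd_form.scale_right[OF psd_form_aDG u v] by (simp add: residual_def right_diff_distrib)
qed

lemma residual_zero: "u \<in> X \<Longrightarrow> residual P f u 0 = 0"
  using residual_scale[of u 0 0] dgv.subspace_0[OF subspace_X] by simp

lemma residual_sum:
  assumes u: "u \<in> X" and v: "\<And>i. i \<in> I \<Longrightarrow> v i \<in> X"
  shows "residual P f u (sum v I) = (\<Sum>i\<in>I. residual P f u (v i))"
  using v
  by (induction I rule: infinite_finite_induct)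
    (auto simp: residual_zero[OF u] residual_add[OF u] dgv.subspace_sum[OF subspace_X])

lemma mod_residual_eq:
  assumes u: "u \<in> X" and v: "v \<in> X"
  shows "mod_residual P f u z v = residual P f u (cutoff z v)"
  unfolding sum_chi_mult[symmetric] mod_residual_def
  using residual_sum[OF u, of "omega_blocks P z" "\<lambda>K. chi_mult P z K v", OF chi_mult_X[OF v]]
  by (simp add: residual_def)

text \<open>
  The norm is a supremum of real numbers and means nothing unless the set is bounded. Boundedness
  follows from the Riesz representation for the energy of the products \<open>cutoff z v\<close>, on whose kernel the
  modified residual vanishes by \<open>cutoff_null\<close>; the case of zero denominator is covered by the same fact.
\<close>
lemma mod_residual_bound:
  assumes z: "z \<in> nodes P" and es: "eigensystem P z lam \<psi>" and u: "u \<in> X" and v: "v \<in> Vomega P z"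
  shows "\<bar>mod_residual P f u z v\<bar> \<le> mod_residual_norm P f u z * sqrt (aomega P z (cutoff z v) (cutoff z v))"
    "0 \<le> mod_residual_norm P f u z"
proof -
  define B where "B = \<psi> ` {1..dgv.dim (Vomega P z)}"
  have B: "finite B" "dgv.span B = Vomega P z"
    using es unfolding eigensystem_def B_def Let_def by auto
  have BV: "B \<subseteq> Vomega P z"
    using B(2) dgv.span_superset by blast
  define q where "q v w = aomega P z (cutoff z v) (cutoff z w)" for v w
  interpret A: psd_form dgscale X "aomega P z" by (rule psd_form_aomega)
  interpret q: psd_form dgscale "Vomega P z" q
    by unfold_locales
      (simp_all add: q_def subspace_Vomega cutoff_add cutoff_scale A.add_left A.scale_left A.nonneg cutoff_X Vomega_X A.sym)
  have null: "mod_residual P f u z v = 0" if "v \<in> dgv.span B" "q v v = 0" for v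
  proof -
    have v: "v \<in> Vomega P z"
      using that B(2) by simp
    then have "cutoff z v = 0"
      using cutoff_null[OF subsetD[OF Vomega_subset v]] that(2) by (simp add: q_def)
    then show ?thesis
      using mod_residual_eq[OF u Vomega_X[OF v]] residual_zero[OF u] by simp
  qed
  have "\<exists>g\<in>dgv.span B. \<forall>v\<in>dgv.span B. q g v = mod_residual P f u z v"
  proof (rule q.riesz[OF B(1) BV _ _ null])
    show "mod_residual P f u z (v + w) = mod_residual P f u z v + mod_residual P f u z w"
      if "v \<in> dgv.span B" "w \<in> dgv.span B" for v w
      using that Vomega_X B(2) dgv.subspace_add[OF subspace_X]
      by (simp add: mod_residual_eq[OF u] cutoff_add residual_add[OF u] cutoff_X)
    show "mod_residual P f u z (dgscale c v) = c * mod_residual P f u z v"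
      if "v \<in> dgv.span B" for c v
      using that Vomega_X B(2) dgv.subspace_scale[OF subspace_X]
      by (simp add: mod_residual_eq[OF u] cutoff_scale residual_scale[OF u] cutoff_X)
  qed
  then obtain g where g: "g \<in> Vomega P z" "\<And>v. v \<in> Vomega P z \<Longrightarrow> q g v = mod_residual P f u z v"
    using B(2) by auto
  have cs: "\<bar>mod_residual P f u z v\<bar> \<le> sqrt (q g g) * sqrt (q v v)" if "v \<in> Vomega P z" for v
    using q.cauchy_schwarz[OF g(1) that] g(2)[OF that]
    by (metis real_sqrt_abs real_sqrt_le_iff real_sqrt_mult)
  define S where "S = insert 0 {\<bar>mod_residual P f u z v\<bar> / norm_omega P z (\<Sum>K\<in>omega_blocks P z. chi_mult P z K v) | v.
      v \<in> Vomega P z \<and> norm_omega P z (\<Sum>K\<in>omega_blocks P z. chi_mult P z K v) \<noteq> 0}"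
  have norm: "norm_omega P z (\<Sum>K\<in>omega_blocks P z. chi_mult P z K v) = sqrt (q v v)" for v
    by (simp add: norm_omega_def sum_chi_mult q_def)
  have S: "S = insert 0 {\<bar>mod_residual P f u z v\<bar> / sqrt (q v v) | v. v \<in> Vomega P z \<and> sqrt (q v v) \<noteq> 0}"
    unfolding S_def norm ..
  have N: "mod_residual_norm P f u z = Sup S"
    by (simp add: mod_residual_norm_def S_def)
  have bdd: "bdd_above S"
  proof (rule bdd_aboveI[where M = "sqrt (q g g)"])
    fix x assume "x \<in> S"
    then consider "x = 0" | w where "w \<in> Vomega P z" "sqrt (q w w) \<noteq> 0" "x = \<bar>mod_residual P f u z w\<bar> / sqrt (q w w)"
      unfolding S by blast
    then show "x \<le> sqrt (q g g)"
    proof cases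
      case 1
      then show ?thesis using q.nonneg[OF g(1)] by simp
    next
      case 2
      have "0 < sqrt (q w w)"
        using 2(2) q.nonneg[OF 2(1)] by (simp add: less_le)
      then show ?thesis
        using cs[OF 2(1)] 2(3) by (simp add: divide_le_eq)
    qed
  qed
  show "0 \<le> mod_residual_norm P f u z"
    unfolding N by (rule cSup_upper[OF _ bdd]) (simp add: S)
  show "\<bar>mod_residual P f u z v\<bar> \<le> mod_residual_norm P f u z * sqrt (aomega P z (cutoff z v) (cutoff z v))"
  proof (cases "sqrt (q v v) = 0")
    case True
    then have "mod_residual P f u z v = 0"
      using null[of v] v B(2) by simp
    then show ?thesis
      using True by (simp add: q_def)
  next
    case False
    then have pos: "0 < sqrt (q v v)"
      using q.nonneg[OF v] by (simp add: less_le)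
    have "\<bar>mod_residual P f u z v\<bar> / sqrt (q v v) \<in> S"
      unfolding S using v False by blast
    then have "\<bar>mod_residual P f u z v\<bar> / sqrt (q v v) \<le> mod_residual_norm P f u z"
      unfolding N using bdd by (rule cSup_upper)
    then show ?thesis
      using pos by (simp add: divide_le_eq q_def)
  qed
qed

definition restrict_omega :: "pt \<Rightarrow> dgfun \<Rightarrow> dgfun"
  where "restrict_omega z v = (\<lambda>K. if K \<in> omega_blocks P z then v K else 0)"

lemma restrict_omega_Vomega: "v \<in> VDG P \<Longrightarrow> restrict_omega z v \<in> Vomega P z"
  unfolding Vomega_def VDG_def restrict_omega_def
  using fsp.subspace_0[OF block.subspace_Q[OF block_K]]
  by (auto simp: Vh_def Qspace_block)

lemma cutoff_restrict: "cutoff z (restrict_omega z v) = cutoff z v"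
  by (auto simp: cutoff_def restrict_omega_def fun_eq_iff)

lemma jump_restrict:
  assumes "E \<in> omega_edges P z"
  shows "jump P E (restrict_omega z v) x = jump P E v x"
  using omega_edge[OF assms] by (simp add: jump_def restrict_omega_def)

lemma aomega_restrict: "aomega P z (restrict_omega z v) (restrict_omega z v) = aomega P z v v"
  by (simp add: aomega_eq jump_form_def jump_restrict)
    (simp add: restrict_omega_def)

lemma sum_cutoff:
  assumes v: "v \<in> VDG P"
  shows "(\<Sum>z\<in>nodes P. cutoff z v) = v"
proof (intro ext)
  fix K x
  show "(\<Sum>z\<in>nodes P. cutoff z v) K x = v K x"
  proof (cases "K \<in> coarse_mesh P \<and> x \<in> K")
    case True
    then have K: "K \<in> coarse_mesh P" and x: "x \<in> K" by auto
    have "(\<Sum>z\<in>nodes P. cutoff z v) K x = (\<Sum>z\<in>nodes P. if z \<in> vertices K then pou P K z x * v K x else 0)"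
      unfolding dgfun_sum_apply by (simp add: cutoff_def omega_blocks_eq K)
    also have "\<dots> = (\<Sum>z\<in>vertices K. pou P K z x * v K x)"
    proof -
      have "vertices K \<subseteq> nodes P"
        using K by (auto simp: nodes_def)
      then show ?thesis
        using finite_nodes by (simp add: sum.inter_restrict[symmetric] Int_absorb1)
    qed
    also have "\<dots> = v K x"
    proof -
      obtain y where "y \<in> vertices K"
        using other_vertex[OF K] by blast
      then show ?thesis
        using pou_props(6)[OF K _ x] by (simp add: sum_distrib_right[symmetric])
    qed
    finally show ?thesis .
  next
    case False
    then have "v K x = 0"
      using VDG_outside[OF v, of x K] v by (auto simp: VDG_def)
    then show ?thesis
      unfolding dgfun_sum_apply by (simp add: sum.neutral cutoff_def)
  qed
qed

text \<open>
  The residual is represented by the error on finite element functions only, not on their products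
  with the partition of unity.
\<close>
lemma residual_error:
  assumes uh: "uh \<in> VDG P" "\<forall>v\<in>VDG P. aDG P uh v = L2_prod P f v"
    and u: "u \<in> VDG P" and v: "v \<in> VDG P"
  shows "residual P f u v = aDG P (uh - u) v"
  using psd_form.diff_left[OF psd_form_aDG, of uh u v] uh u v VDG_subset
  by (auto simp: residual_def subset_iff)

lemma mod_residual_initial:
  assumes z: "z \<in> nodes P" and u: "u \<in> VDG P"
    and orth: "\<And>v. v \<in> initial_space P L \<psi> \<Longrightarrow> residual P f u v = 0"
    and psi: "\<And>k. k \<in> {1..L z} \<Longrightarrow> \<psi> z k \<in> Vomega P z"
    and p: "p \<in> dgv.span (\<psi> z ` {1..L z})"
  shows "mod_residual P f u z p = 0"
proof -
  have uX: "u \<in> X"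
    using u VDG_subset by blast
  have "dgv.subspace {p \<in> X. residual P f u (cutoff z p) = 0}"
    using dgv.subspace_add[OF subspace_X] dgv.subspace_scale[OF subspace_X] dgv.subspace_0[OF subspace_X]
      cutoff_scale[of z 0 0]
    by (intro dgv.subspaceI)
      (simp_all add: cutoff_add cutoff_scale residual_add[OF uX] residual_scale[OF uX] residual_zero[OF uX] cutoff_X)
  moreover have "\<psi> z k \<in> {p \<in> X. residual P f u (cutoff z p) = 0}" if k: "k \<in> {1..L z}" for k
  proof -
    have X: "\<psi> z k \<in> X"
      by (rule Vomega_X[OF psi[OF k]])
    have "residual P f u (chi_mult P z K (\<psi> z k)) = 0" if "K \<in> omega_blocks P z" for K
    proof (rule orth)
      have "chi_mult P z K (\<psi> z k) \<in> {chi_mult P z K (\<psi> z k) | z k K.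
          z \<in> nodes P \<and> 1 \<le> k \<and> k \<le> L z \<and> K \<in> omega_blocks P z}"
        using z k that by auto
      then show "chi_mult P z K (\<psi> z k) \<in> initial_space P L \<psi>"
        unfolding initial_space_def by (rule dgv.span_base)
    qed
    then have "residual P f u (cutoff z (\<psi> z k)) = 0"
      unfolding sum_chi_mult[symmetric]
      using residual_sum[OF uX, of "omega_blocks P z" "\<lambda>K. chi_mult P z K (\<psi> z k)", OF chi_mult_X[OF X]]
      by simp
    then show ?thesis using X by simp
  qed
  ultimately have "dgv.span (\<psi> z ` {1..L z}) \<subseteq> {p \<in> X. residual P f u (cutoff z p) = 0}"
    by (intro dgv.span_minimal) auto
  then show ?thesis
    using p mod_residual_eq[OF uX] by auto
qed

section \<open>The residual bound\<close>
text \<open>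
  The error is tested with itself: its local parts are replaced by the remainders of the spectral
  projections, and the Cauchy--Schwarz inequality over the nodes bounds the squared error \<open>A\<close> by
  \<open>A\<^sup>2 \<le> 2 S C0 A / a0\<close>, where finite overlap and coercivity have turned the sum of the local energies
  back into \<open>A\<close>.
\<close>
lemma residual_estimate:
  assumes spectral: "\<forall>z\<in>nodes P. eigensystem P z (lam z) (\<psi> z)"
    and number: "\<forall>z\<in>nodes P. 1 \<le> L z \<and> L z + 1 \<le> dgv.dim (Vomega P z)"
    and uh: "uh \<in> VDG P" "\<forall>v\<in>VDG P. aDG P uh v = L2_prod P f v"
    and u: "u \<in> VDG P" and orth: "\<And>v. v \<in> initial_space P L \<psi> \<Longrightarrow> residual P f u v = 0"
  shows "aDG P (uh - u) (uh - u) \<le> 2 * inverse (1 - Cinv / sqrt (penalty P)) * real (max_vertices P) *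
    (\<Sum>z\<in>nodes P. (1 + real_of_ereal (1 / lam z (L z + 1))) * (mod_residual_norm P f u z)\<^sup>2)"
    (is "?A \<le> 2 * inverse ?a0 * ?C * ?S")
proof -
  define e where "e = uh - u"
  define A where "A = aDG P e e"
  have eV: "e \<in> VDG P"
    unfolding e_def using dgv.subspace_diff[OF subspace_VDG uh(1) u] .
  have uX: "u \<in> X" and eX: "e \<in> X"
    using u eV VDG_subset by auto
  define c where "c z = real_of_ereal (1 / lam z (L z + 1))" for z
  define N where "N z = mod_residual_norm P f u z" for z
  have c0: "0 \<le> c z" if z: "z \<in> nodes P" for z
    using higher_eigenvalue_pos[OF z, of "lam z" "\<psi> z" "L z"] spectral number z unfolding c_def
    by (cases "lam z (L z + 1)") (auto simp: one_ereal_def divide_ereal_def)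
  have N0: "0 \<le> N z" if z: "z \<in> nodes P" for z
    unfolding N_def
    using mod_residual_bound(2)[OF z _ uX restrict_omega_Vomega[OF eV]] spectral z by blast
  have local: "residual P f u (cutoff z e) \<le> N z * sqrt (2 * (1 + c z)) * sqrt (aomega P z e e)"
    if z: "z \<in> nodes P" for z
  proof -
    define ez where "ez = restrict_omega z e"
    have ez: "ez \<in> Vomega P z"
      unfolding ez_def by (rule restrict_omega_Vomega[OF eV])
    have es: "eigensystem P z (lam z) (\<psi> z)" and Lz: "1 \<le> L z" "L z + 1 \<le> dgv.dim (Vomega P z)"
      using spectral number z by auto
    obtain p where p: "p \<in> dgv.span (\<psi> z ` {1..L z})"
      and le: "aomega P z (cutoff z (ez - p)) (cutoff z (ez - p)) \<le> 2 * (1 + c z) * aomega P z ez ez"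
      using local_projection[OF z es Lz ez] unfolding c_def by blast
    have psi: "\<psi> z k \<in> Vomega P z" if "k \<in> {1..L z}" for k
      using es Lz that unfolding eigensystem_def eigenpair_def Let_def by auto
    then have pV: "p \<in> Vomega P z"
      using p dgv.span_minimal[OF _ subspace_Vomega, of "\<psi> z ` {1..L z}" z] by blast
    have wV: "ez - p \<in> Vomega P z"
      by (rule dgv.subspace_diff[OF subspace_Vomega ez pV])
    have "residual P f u (cutoff z e) = residual P f u (cutoff z ez)"
      by (simp add: ez_def cutoff_restrict)
    also have "\<dots> = residual P f u (cutoff z ((ez - p) + p))"
      by simp
    also have "\<dots> = residual P f u (cutoff z (ez - p)) + residual P f u (cutoff z p)"
      unfolding cutoff_add by (rule residual_add[OF uX cutoff_X[OF Vomega_X[OF wV]] cutoff_X[OF Vomega_X[OF pV]]])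
    also have "\<dots> = mod_residual P f u z (ez - p)"
      using mod_residual_initial[of z u L \<psi> p, OF z u orth psi p] mod_residual_eq[OF uX Vomega_X[OF pV]]
        mod_residual_eq[OF uX Vomega_X[OF wV]] by simp
    also have "\<dots> \<le> N z * sqrt (aomega P z (cutoff z (ez - p)) (cutoff z (ez - p)))"
      using mod_residual_bound(1)[OF z es uX wV] by (simp add: N_def)
    also have "\<dots> \<le> N z * sqrt (2 * (1 + c z) * aomega P z ez ez)"
      using le N0[OF z] by (intro mult_left_mono real_sqrt_le_mono)
    also have "\<dots> = N z * sqrt (2 * (1 + c z)) * sqrt (aomega P z e e)"
      by (simp only: ez_def aomega_restrict real_sqrt_mult mult.assoc)
    finally show ?thesis .
  qed
  have a0: "0 \<le> aomega P z e e" for z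
    by (rule psd_form.nonneg[OF psd_form_aomega eX])
  define S where "S = (\<Sum>z\<in>nodes P. (1 + c z) * (N z)\<^sup>2)"
  have S0: "0 \<le> S"
    unfolding S_def using c0 by (intro sum_nonneg mult_nonneg_nonneg) auto
  have "A = residual P f u e"
    unfolding A_def e_def using residual_error[OF uh u] eV by (simp add: e_def)
  also have "\<dots> = residual P f u (\<Sum>z\<in>nodes P. cutoff z e)"
    by (simp add: sum_cutoff[OF eV])
  also have "\<dots> = (\<Sum>z\<in>nodes P. residual P f u (cutoff z e))"
    by (rule residual_sum[OF uX cutoff_X[OF eX]])
  also have "\<dots> \<le> (\<Sum>z\<in>nodes P. N z * sqrt (2 * (1 + c z)) * sqrt (aomega P z e e))"
    by (rule sum_mono) (rule local)
  finally have A1: "A \<le> (\<Sum>z\<in>nodes P. N z * sqrt (2 * (1 + c z)) * sqrt (aomega P z e e))" .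
  have A0: "0 \<le> A"
    unfolding A_def by (rule psd_form.nonneg[OF psd_form_aDG eX])
  have "A\<^sup>2 \<le> (\<Sum>z\<in>nodes P. N z * sqrt (2 * (1 + c z)) * sqrt (aomega P z e e))\<^sup>2"
    using A1 A0 by (rule power_mono)
  also have "\<dots> \<le> (\<Sum>z\<in>nodes P. (N z * sqrt (2 * (1 + c z)))\<^sup>2) * (\<Sum>z\<in>nodes P. (sqrt (aomega P z e e))\<^sup>2)"
    by (rule Cauchy_Schwarz_ineq_sum)
  also have "(\<Sum>z\<in>nodes P. (N z * sqrt (2 * (1 + c z)))\<^sup>2) = 2 * S"
    unfolding S_def sum_distrib_left using c0
    by (intro sum.cong refl) (simp add: power_mult_distrib algebra_simps)
  also have "(\<Sum>z\<in>nodes P. (sqrt (aomega P z e e))\<^sup>2) = (\<Sum>z\<in>nodes P. aomega P z e e)"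
    using a0 by simp
  also have "2 * S * (\<Sum>z\<in>nodes P. aomega P z e e) \<le> 2 * S * (?C * (inverse ?a0 * A))"
  proof -
    have "?a0 * dg_energy e e \<le> A"
      unfolding A_def by (rule aDG_bounds(1)[OF eX])
    then have "dg_energy e e \<le> inverse ?a0 * A"
      using Cinv_ratio by (simp add: field_simps)
    then have "?C * dg_energy e e \<le> ?C * (inverse ?a0 * A)"
      by (rule mult_left_mono) simp
    then show ?thesis
      using overlap[OF eX] S0 by (intro mult_left_mono) auto
  qed
  finally have "A * A \<le> A * (2 * inverse ?a0 * ?C * S)"
    by (simp add: power2_eq_square mult_ac)
  then have "A \<le> 2 * inverse ?a0 * ?C * S"
  proof (cases "A = 0")
    case True
    have "0 \<le> 2 * inverse ?a0 * ?C * S"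
      using Cinv_ratio S0 by (intro mult_nonneg_nonneg) auto
    then show ?thesis using True by simp
  next
    case False
    then have "0 < A" using A0 by simp
    then show ?thesis
      using \<open>A * A \<le> A * (2 * inverse ?a0 * ?C * S)\<close> by (simp only: mult_le_cancel_left_pos)
  qed
  then show ?thesis
    unfolding A_def e_def S_def c_def N_def .
qed

section \<open>The decrease of the error\<close>
text \<open>
  The online function represents the residual, so the norm of the residual is at most its energy
  norm.
\<close>
lemma residual_norm_le:
  assumes \<phi>: "\<phi> \<in> Vomega0 P z" and rep: "\<forall>v\<in>Vomega0 P z. aomega P z \<phi> v = residual P f u v"
  shows "(residual_norm P f u z)\<^sup>2 \<le> aomega P z \<phi> \<phi>"
proof -
  interpret A: psd_form dgscale X "aomega P z" by (rule psd_form_aomega)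
  have X: "v \<in> X" if "v \<in> Vomega0 P z" for v
    using that Vomega_X by (auto simp: Vomega0_def)
  define M where "M = sqrt (aomega P z \<phi> \<phi>)"
  have M0: "0 \<le> M"
    using A.nonneg[OF X[OF \<phi>]] by (simp add: M_def)
  define S where "S = insert 0 {\<bar>residual P f u v\<bar> / norm_omega P z v | v. v \<in> Vomega0 P z \<and> norm_omega P z v \<noteq> 0}"
  have bound: "x \<le> M" if xS: "x \<in> S" for x
  proof -
    consider "x = 0" | w where "w \<in> Vomega0 P z" "norm_omega P z w \<noteq> 0" "x = \<bar>residual P f u w\<bar> / norm_omega P z w"
      using xS unfolding S_def by blast
    then show ?thesis
    proof cases
      case 1
      then show ?thesis using M0 by simp
    next
      case 2
      have pos: "0 < norm_omega P z w"
        using 2(2) A.nonneg[OF X[OF 2(1)]] by (simp add: norm_omega_def less_le)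
      have "(residual P f u w)\<^sup>2 \<le> aomega P z \<phi> \<phi> * aomega P z w w"
        using A.cauchy_schwarz[OF X[OF \<phi>] X[OF 2(1)]] rep 2(1) by simp
      then have "\<bar>residual P f u w\<bar> \<le> M * norm_omega P z w"
        unfolding M_def norm_omega_def by (metis real_sqrt_abs real_sqrt_le_iff real_sqrt_mult)
      then show ?thesis
        using pos 2(3) by (simp add: divide_le_eq)
    qed
  qed
  have ne: "S \<noteq> {}"
    by (simp add: S_def)
  have bdd: "bdd_above S"
    using bound by (rule bdd_aboveI)
  have N: "residual_norm P f u z = Sup S"
    by (simp add: residual_norm_def S_def)
  have "0 \<le> residual_norm P f u z"
    unfolding N by (rule cSup_upper[OF _ bdd]) (simp add: S_def)
  moreover have "residual_norm P f u z \<le> M"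
    unfolding N using ne bound by (rule cSup_least)
  ultimately have "(residual_norm P f u z)\<^sup>2 \<le> M\<^sup>2"
    by (intro power_mono)
  then show ?thesis
    using A.nonneg[OF X[OF \<phi>]] by (simp add: M_def)
qed

text \<open>
  The new iterate is at least as good as \<open>u + \<alpha> \<phi>\<close> for every \<open>\<alpha>\<close>. With \<open>M\<close> the energy of \<open>\<phi>\<close>, the
  squared error of the latter is at most \<open>aDG e e - 2 \<alpha> M + \<alpha>\<^sup>2 a1 M\<close>, which is smallest for
  \<open>\<alpha> = 1 / a1\<close>.
\<close>
lemma online_decrease:
  assumes uh: "uh \<in> VDG P" "\<forall>v\<in>VDG P. aDG P uh v = L2_prod P f v"
    and u: "u \<in> VDG P" and u': "u' \<in> VDG P" and \<phi>: "\<phi> \<in> Vomega0 P z"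
    and rep: "\<forall>v\<in>Vomega0 P z. aomega P z \<phi> v = residual P f u v"
    and galerkin: "\<And>\<alpha>. residual P f u' (u + dgscale \<alpha> \<phi> - u') = 0"
  shows "aDG P (uh - u') (uh - u') \<le> aDG P (uh - u) (uh - u)
    - (residual_norm P f u z)\<^sup>2 / (1 + Cinv / sqrt (penalty P))"
proof -
  interpret D: psd_form dgscale X "aDG P" by (rule psd_form_aDG)
  define a1 where "a1 = 1 + Cinv / sqrt (penalty P)"
  have a1: "a1 > 0"
    using inverse_ineq(1) penalty_pos by (simp add: a1_def add_pos_nonneg)
  have \<phi>V: "\<phi> \<in> VDG P"
    using \<phi> Vomega_subset by (auto simp: Vomega0_def)
  have X: "uh \<in> X" "u \<in> X" "u' \<in> X" "\<phi> \<in> X"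
    using uh u u' \<phi>V VDG_subset by auto
  define M where "M = aomega P z \<phi> \<phi>"
  define e where "e = uh - u"
  define w where "w = u + dgscale (1 / a1) \<phi> - u'"
  have wV: "w \<in> VDG P"
    unfolding w_def by (intro dgv.subspace_diff[OF subspace_VDG] dgv.subspace_add[OF subspace_VDG]
        dgv.subspace_scale[OF subspace_VDG] u u' \<phi>V)
  have wX: "w \<in> X" and eX: "e \<in> X"
    using wV VDG_subset X D.V_closed by (auto simp: e_def)
  have "aDG P (uh - u') w = 0"
    using galerkin[of "1 / a1"] residual_error[OF uh u' wV] by (simp add: w_def)
  then have "aDG P (uh - u' + dgscale (- 1) w) (uh - u' + dgscale (- 1) w) = aDG P (uh - u') (uh - u') + aDG P w w"
    using D.expand_square[of "uh - u'" w "- 1"] X wX D.V_closed by simp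
  moreover have "uh - u' + dgscale (- 1) w = e + dgscale (- (1 / a1)) \<phi>"
    by (simp add: e_def w_def dgscale_def fun_eq_iff)
  ultimately have best: "aDG P (uh - u') (uh - u') \<le> aDG P (e + dgscale (- (1 / a1)) \<phi>) (e + dgscale (- (1 / a1)) \<phi>)"
    using D.nonneg[OF wX] by simp
  have "aDG P e \<phi> = M"
    unfolding M_def e_def using residual_error[OF uh u \<phi>V] rep \<phi> by simp
  moreover have "aDG P \<phi> \<phi> \<le> a1 * M"
    unfolding M_def a1_def dg_energy_Vomega0[OF \<phi>, symmetric] by (rule aDG_bounds(2)[OF X(4)])
  ultimately have "aDG P (e + dgscale (- (1 / a1)) \<phi>) (e + dgscale (- (1 / a1)) \<phi>)
      \<le> aDG P e e - 2 * (1 / a1) * M + (1 / a1)\<^sup>2 * (a1 * M)"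
    using D.expand_square[OF eX X(4), of "- (1 / a1)"] by (simp add: mult_left_mono)
  also have "\<dots> = aDG P e e - M / a1"
    using a1 by (simp add: power2_eq_square)
  also have "\<dots> \<le> aDG P e e - (residual_norm P f u z)\<^sup>2 / a1"
    using residual_norm_le[OF \<phi> rep] a1 by (simp add: M_def divide_right_mono)
  finally show ?thesis
    using best unfolding e_def a1_def by linarith
qed

end

section \<open>A posteriori bound and convergence of the online enrichment\<close>
theorem theorem3p1:
  fixes P :: dg_data
    and f :: "pt \<Rightarrow> real"
    and Cinv a0 a1 C0 :: real
    and lam :: "pt \<Rightarrow> nat \<Rightarrow> ereal"
    and \<psi> :: "pt \<Rightarrow> nat \<Rightarrow> dgfun"
    and L :: "pt \<Rightarrow> nat"
    and uh :: dgfun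
    and VH :: "nat \<Rightarrow> dgfun set"
    and uH \<phi> :: "nat \<Rightarrow> dgfun"
    and sel :: "nat \<Rightarrow> pt"
  assumes region: "rectangle (region P)"
    and coarse: "rect_mesh (region P) (coarse_mesh P)"
    and fine: "rect_mesh (region P) (fine_mesh P)" "mesh_refines (fine_mesh P) (coarse_mesh P)"
    and coeff: "kappa P \<in> borel_measurable (lebesgue_on (region P))"
      "bounded (kappa P ` region P)" "\<forall>x\<in>region P. 1 \<le> kappa P x"
    and source: "f \<in> borel_measurable (lebesgue_on (region P))"
      "integrable (lebesgue_on (region P)) (\<lambda>x. (f x)\<^sup>2)"
    and normals: "edge_normals P"
    and pou: "partition_of_unity P"
    and inverse_ineq: "0 < Cinv" "inverse_inequality P Cinv"
    and penalty: "Cinv\<^sup>2 < penalty P"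
    and constants: "a0 = 1 - Cinv / sqrt (penalty P)" "a1 = 1 + Cinv / sqrt (penalty P)"
      "C0 = real (max_vertices P)"
    and spectral: "\<forall>z\<in>nodes P. eigensystem P z (lam z) (\<psi> z)"
    and number: "\<forall>z\<in>nodes P. 1 \<le> L z \<and> L z + 1 \<le> dgv.dim (Vomega P z)"
    and initial: "VH 0 = initial_space P L \<psi>" "VH 0 \<subseteq> VDG P"
    and uh: "uh \<in> VDG P" "\<forall>v\<in>VDG P. aDG P uh v = L2_prod P f v"
    and uH: "\<forall>m. uH m \<in> VH m \<and> (\<forall>v\<in>VH m. aDG P (uH m) v = L2_prod P f v)"
    and online: "\<forall>m. sel m \<in> nodes P \<and> \<phi> m \<in> Vomega0 P (sel m) \<and>
      (\<forall>v\<in>Vomega0 P (sel m). aomega P (sel m) (\<phi> m) v = residual P f (uH m) v)"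
    and enrich: "\<forall>m. VH (Suc m) = {v + w | v w. v \<in> VH m \<and> w \<in> dgv.span {\<phi> m}}"
  shows "(\<forall>m. (normA P (uh - uH m))\<^sup>2 \<le> 2 * inverse a0 * a1 * C0 *
          (\<Sum>z\<in>nodes P. (1 + real_of_ereal (1 / lam z (L z + 1))) * (mod_residual_norm P f (uH m) z)\<^sup>2)) \<and>
        (\<forall>m \<eta> \<theta>. 0 < \<eta> \<longrightarrow>
          \<eta>\<^sup>2 = 2 * inverse a0 * a1 * C0 *
            (\<Sum>z\<in>nodes P. (1 + real_of_ereal (1 / lam z (L z + 1))) * (mod_residual_norm P f (uH m) z)\<^sup>2) \<longrightarrow>
          \<theta> = (residual_norm P f (uH m) (sel m))\<^sup>2 / \<eta>\<^sup>2 \<longrightarrow>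
          (normA P (uh - uH (Suc m)))\<^sup>2 \<le> (1 - \<theta>) * (normA P (uh - uH m))\<^sup>2)"
proof -
  interpret dg_source P Cinv f
    by unfold_locales fact+
  have Vsub: "dgv.subspace (VH m)" "VH 0 \<subseteq> VH m" "VH m \<subseteq> VDG P" for m
  proof (induction m)
    case 0
    show "dgv.subspace (VH 0)"
      unfolding initial(1) initial_space_def by (rule dgv.subspace_span)
    show "VH 0 \<subseteq> VH 0" ..
    show "VH 0 \<subseteq> VDG P" by (rule initial(2))
  next
    case (Suc m)
    have V: "VH (Suc m) = {v + w | v w. v \<in> VH m \<and> w \<in> dgv.span {\<phi> m}}"
      using enrich by blast
    show "dgv.subspace (VH (Suc m))"
      unfolding V by (rule dgv.subspace_sums[OF Suc(1) dgv.subspace_span])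
    have "VH m \<subseteq> VH (Suc m)"
    proof
      fix v assume "v \<in> VH m"
      then have "v + 0 \<in> VH (Suc m)"
        unfolding V using dgv.span_zero by blast
      then show "v \<in> VH (Suc m)" by simp
    qed
    then show "VH 0 \<subseteq> VH (Suc m)"
      using Suc(2) by blast
    have "\<phi> m \<in> Vomega P (sel m)"
      using online unfolding Vomega0_def by blast
    then have "\<phi> m \<in> VDG P"
      using Vomega_subset by blast
    then have "dgv.span {\<phi> m} \<subseteq> VDG P"
      by (intro dgv.span_minimal subspace_VDG) auto
    then show "VH (Suc m) \<subseteq> VDG P"
      unfolding V using Suc(3) dgv.subspace_add[OF subspace_VDG] by blast
  qed
  have uHV: "uH m \<in> VDG P" for m
    using uH Vsub(3) by blast
  have galerkin: "residual P f (uH m) v = 0" if "v \<in> VH m" for m v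
    using uH that by (simp add: residual_def)
  have a0: "0 < a0" and a1: "1 \<le> a1"
    using Cinv_ratio inverse_ineq(1) penalty_pos by (simp_all add: constants)
  have norm: "(normA P (uh - uH m))\<^sup>2 = aDG P (uh - uH m) (uh - uH m)" for m
  proof -
    have "uh - uH m \<in> X"
      using dgv.subspace_diff[OF subspace_VDG uh(1) uHV] VDG_subset by blast
    then show ?thesis
      using psd_form.nonneg[OF psd_form_aDG] by (simp add: normA_def)
  qed
  define \<Sigma> where "\<Sigma> m = (\<Sum>z\<in>nodes P. (1 + real_of_ereal (1 / lam z (L z + 1))) * (mod_residual_norm P f (uH m) z)\<^sup>2)" for m
  have est: "(normA P (uh - uH m))\<^sup>2 \<le> 2 * inverse a0 * C0 * \<Sigma> m" for m
    unfolding norm \<Sigma>_def constants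
  proof (rule residual_estimate[OF spectral number uh uHV])
    show "residual P f (uH m) v = 0" if "v \<in> initial_space P L \<psi>" for v
      using galerkin Vsub(2) that initial(1) by blast
  qed
  \<comment> \<open>The stronger form that the second claim needs.\<close>
  have est1: "a1 * (normA P (uh - uH m))\<^sup>2 \<le> 2 * inverse a0 * a1 * C0 * \<Sigma> m" for m
    using mult_left_mono[OF est[of m], of a1] a1 by (simp add: mult_ac)
  show ?thesis
    unfolding \<Sigma>_def[symmetric]
  proof (intro conjI allI impI)
    fix m
    have "(normA P (uh - uH m))\<^sup>2 \<le> a1 * (normA P (uh - uH m))\<^sup>2"
      using a1 mult_right_mono[of 1 a1 "(normA P (uh - uH m))\<^sup>2"] by simp
    then show "(normA P (uh - uH m))\<^sup>2 \<le> 2 * inverse a0 * a1 * C0 * \<Sigma> m"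
      using est1[of m] by simp
  next
    fix m and \<eta> \<theta> :: real
    assume \<eta>: "0 < \<eta>" "\<eta>\<^sup>2 = 2 * inverse a0 * a1 * C0 * \<Sigma> m"
      and \<theta>: "\<theta> = (residual_norm P f (uH m) (sel m))\<^sup>2 / \<eta>\<^sup>2"
    define A where "A = (normA P (uh - uH m))\<^sup>2"
    define r where "r = (residual_norm P f (uH m) (sel m))\<^sup>2"
    have on: "\<phi> m \<in> Vomega0 P (sel m)"
      "\<forall>v\<in>Vomega0 P (sel m). aomega P (sel m) (\<phi> m) v = residual P f (uH m) v"
      using online by auto
    have gal: "residual P f (uH (Suc m)) (uH m + dgscale \<alpha> (\<phi> m) - uH (Suc m)) = 0" for \<alpha>
    proof (rule galerkin)
      have "uH m + dgscale \<alpha> (\<phi> m) \<in> VH (Suc m)"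
        using enrich uH dgv.span_scale[OF dgv.span_base] by blast
      then show "uH m + dgscale \<alpha> (\<phi> m) - uH (Suc m) \<in> VH (Suc m)"
        using uH dgv.subspace_diff[OF Vsub(1)] by blast
    qed
    have "(normA P (uh - uH (Suc m)))\<^sup>2 \<le> A - r / a1"
      unfolding A_def r_def norm constants(2)
      by (rule online_decrease[OF uh uHV uHV on gal])
    moreover have "r / \<eta>\<^sup>2 * A \<le> r / a1"
    proof -
      have "a1 * A \<le> \<eta>\<^sup>2"
        using est1[of m] \<eta>(2) by (simp add: A_def)
      then have "A / \<eta>\<^sup>2 \<le> 1 / a1"
        using a1 \<eta>(1) by (simp add: field_simps)
      then have "r * (A / \<eta>\<^sup>2) \<le> r * (1 / a1)"
        by (rule mult_left_mono) (simp add: r_def)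
      then show ?thesis by simp
    qed
    ultimately show "(normA P (uh - uH (Suc m)))\<^sup>2 \<le> (1 - \<theta>) * (normA P (uh - uH m))\<^sup>2"
      unfolding \<theta> A_def[symmetric] r_def[symmetric] by (simp add: left_diff_distrib)
  qed
qed

end
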